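(* Let $d\ge 2$ and let $D\subset\mathbb{R}^d$ be a bounded domain whose symmetry group is irreducible. Then for each $n\ge 1$ and each invertible linear transformation $T$ of $\mathbb{R}^d$, $$\lambda_1(T(D))+\dots+\lambda_n(T(D))\ \le\ \frac1d\,\lVert T^{-1}\rVert_{HS}^2\,\big(\lambda_1(D)+\dots+\lambda_n(D)\big),$$ and equality holds if $T$ is a scalar multiple of an orthogonal matrix. The same holds for the Neumann eigenvalues: if in addition $D$ has Lipschitz boundary, then for each $n\ge1$ and each invertible linear transformation $T$ of $\mathbb{R}^d$, $$\mu_1(T(D))+\dots+\mu_n(T(D))\ \le\ \frac1d\,\lVert T^{-1}\rVert_{HS}^2\,\big(\mu_1(D)+\dots+\mu_n(D)\big),$$ with equality if $T$ is a scalar multiple of an orthogonal matrix.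
   Context: A domain is a nonempty connected open set. For a bounded domain $D\subset\mathbb{R}^d$, $0<\lambda_1(D)<\lambda_2(D)\le\lambda_3(D)\le\cdots$ are the Dirichlet eigenvalues of the Laplacian, repeated according to multiplicity: $-\Delta u=\lambda u$ in $D$, $u=0$ on $\partial D$, in the weak sense, i.e. associated with the Rayleigh quotient $\int_D|\nabla u|^2\,dx/\int_D u^2\,dx$ on $H^1_0(D)$. For a bounded domain with Lipschitz boundary, $0=\mu_1(D)<\mu_2(D)\le\mu_3(D)\le\cdots$ are the Neumann eigenvalues, repeated according to multiplicity: $-\Delta u=\mu u$ in $D$, $\partial u/\partial n=0$ on $\partial D$, in the weak sense, i.e. associated with the same Rayleigh quotient on $H^1(D)$. A symmetry of $D$ is a real orthogonal $d\times d$ matrix $U$ with $U(D)=D$ (acting by $x\mapsto Ux$); the symmetry group of $D$ is the group of all symmetries of $D$. A group $\mathcal U$ of orthogonal matrices is irreducible if $\{Ux:U\in\mathcal U\}$ spans $\mathbb{R}^d$ for every $x\in\mathbb{R}^d\setminus\{0\}$. The Hilbert--Schmidt norm of a real matrix $M$ is $\lVert M\rVert_{HS}=\big(\sum_{j,k}M_{jk}^2\big)^{1/2}$. Linear transformations of $\mathbb{R}^d$ are identified with $d\times d$ real matrices. *)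

theory Defs
  imports "HOL-Analysis.Analysis"
begin

section \<open>Domains and their symmetries\<close>

definition bounded_domain :: "(real^'d) set \<Rightarrow> bool" where
  "bounded_domain D \<longleftrightarrow> D \<noteq> {} \<and> connected D \<and> open D \<and> bounded D"

text \<open>Near each boundary point, after a choice of a vertical unit direction \<open>e\<close>, the set is the
  region above the graph of a Lipschitz function \<open>\<gamma>\<close> on the hyperplane orthogonal to \<open>e\<close>.\<close>
definition lipschitz_boundary :: "(real^'d) set \<Rightarrow> bool" where
  "lipschitz_boundary D \<longleftrightarrow>
     (\<forall>p \<in> frontier D. \<exists>r > 0. \<exists>e \<gamma> L. norm e = 1 \<and> L-lipschitz_on {y. y \<bullet> e = 0} \<gamma> \<and>
        D \<inter> ball p r = {x \<in> ball p r. \<gamma> (x - (x \<bullet> e) *\<^sub>R e) < x \<bullet> e})"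

definition symmetry_group :: "(real^'d) set \<Rightarrow> (real^'d^'d) set" where
  "symmetry_group D = {U. orthogonal_matrix U \<and> (*v) U ` D = D}"

definition irreducible_group :: "(real^'d^'d) set \<Rightarrow> bool" where
  "irreducible_group G \<longleftrightarrow> (\<forall>x. x \<noteq> 0 \<longrightarrow> span {U *v x | U. U \<in> G} = UNIV)"

definition HS_norm :: "real^'n^'m \<Rightarrow> real" where
  "HS_norm M = sqrt (\<Sum>j\<in>UNIV. \<Sum>k\<in>UNIV. (M $ j $ k)\<^sup>2)"

section \<open>Sobolev spaces\<close>

definition partial_deriv :: "'d \<Rightarrow> (real^'d \<Rightarrow> real) \<Rightarrow> real^'d \<Rightarrow> real" where
  "partial_deriv i f x = frechet_derivative f (at x) (axis i 1)"

primrec C_times :: "nat \<Rightarrow> (real^'d \<Rightarrow> real) \<Rightarrow> bool" where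
  "C_times 0 f \<longleftrightarrow> continuous_on UNIV f"
| "C_times (Suc k) f \<longleftrightarrow>
     (\<forall>x. f differentiable (at x)) \<and> (\<forall>i. C_times k (partial_deriv i f))"

definition test_functions :: "(real^'d) set \<Rightarrow> (real^'d \<Rightarrow> real) set" where
  "test_functions D =
     {\<phi>. (\<forall>k. C_times k \<phi>) \<and> compact (closure {x. \<phi> x \<noteq> 0}) \<and> closure {x. \<phi> x \<noteq> 0} \<subseteq> D}"

text \<open>Elements of \<open>L\<^sup>2(D)\<close> and of the Sobolev spaces on \<open>D\<close> are represented by functions on the
  whole space; only their values on \<open>D\<close>, up to null sets, are significant.\<close>
definition L2 :: "(real^'d) set \<Rightarrow> (real^'d \<Rightarrow> 'b::euclidean_space) set" where
  "L2 D = {u. u \<in> borel_measurable (lebesgue_on D) \<and>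
              integrable (lebesgue_on D) (\<lambda>x. (norm (u x))\<^sup>2)}"

definition has_weak_grad :: "(real^'d) set \<Rightarrow> (real^'d \<Rightarrow> real) \<Rightarrow> (real^'d \<Rightarrow> real^'d) \<Rightarrow> bool" where
  "has_weak_grad D u g \<longleftrightarrow>
     (\<forall>\<phi> \<in> test_functions D. \<forall>i.
        (LINT x|lebesgue_on D. u x * partial_deriv i \<phi> x)
          = - (LINT x|lebesgue_on D. g x $ i * \<phi> x))"

definition H1 :: "(real^'d) set \<Rightarrow> (real^'d \<Rightarrow> real) set" where
  "H1 D = {u \<in> L2 D. \<exists>g \<in> L2 D. has_weak_grad D u g}"

text \<open>For \<open>u\<close> in \<open>H1 D\<close> with \<open>D\<close> open, the choice is unique up to a null subset of \<open>D\<close>.\<close>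
definition weak_grad :: "(real^'d) set \<Rightarrow> (real^'d \<Rightarrow> real) \<Rightarrow> real^'d \<Rightarrow> real^'d" where
  "weak_grad D u = (SOME g. g \<in> L2 D \<and> has_weak_grad D u g)"

definition H1_norm :: "(real^'d) set \<Rightarrow> (real^'d \<Rightarrow> real) \<Rightarrow> real" where
  "H1_norm D u = sqrt ((LINT x|lebesgue_on D. (u x)\<^sup>2) +
                       (LINT x|lebesgue_on D. (norm (weak_grad D u x))\<^sup>2))"

text \<open>The closure of the test functions in the \<open>H\<^sup>1\<close> norm.\<close>
definition H1_0 :: "(real^'d) set \<Rightarrow> (real^'d \<Rightarrow> real) set" where
  "H1_0 D = {u \<in> H1 D. \<forall>\<epsilon>>0. \<exists>\<phi> \<in> test_functions D. H1_norm D (\<lambda>x. u x - \<phi> x) < \<epsilon>}"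

section \<open>Eigenvalues\<close>

text \<open>The weak solutions \<open>u \<in> V\<close> of \<open>-\<Delta>u = t u\<close> tested against \<open>V\<close>, including \<open>u = 0\<close>.  The
  choices \<open>V = H1_0 D\<close> and \<open>V = H1 D\<close> give the Dirichlet and the Neumann problem.\<close>
definition eigenspace ::
    "(real^'d) set \<Rightarrow> (real^'d \<Rightarrow> real) set \<Rightarrow> real \<Rightarrow> (real^'d \<Rightarrow> real) set" where
  "eigenspace D V t =
     {u \<in> V. \<forall>v \<in> V. (LINT x|lebesgue_on D. weak_grad D u x \<bullet> weak_grad D v x)
                       = t * (LINT x|lebesgue_on D. u x * v x)}"

text \<open>\<open>E\<close>, taken modulo almost everywhere equality on \<open>D\<close>, has a basis of \<open>m\<close> elements.\<close>
definition has_dim_ae :: "(real^'d) set \<Rightarrow> (real^'d \<Rightarrow> real) set \<Rightarrow> nat \<Rightarrow> bool" where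
  "has_dim_ae D E m \<longleftrightarrow>
     (\<exists>f. (\<forall>i<m. f i \<in> E) \<and>
          (\<forall>c. (AE x in lebesgue_on D. (\<Sum>i<m. c i * f i x) = 0) \<longrightarrow> (\<forall>i<m. c i = (0::real))) \<and>
          (\<forall>u \<in> E. \<exists>c. AE x in lebesgue_on D. u x = (\<Sum>i<m. c i * f i x)))"

text \<open>\<open>s\<close> lists all eigenvalues in nondecreasing order, each as often as its multiplicity: the
  number of occurrences of \<open>t\<close> is the dimension of its eigenspace, hence \<open>0\<close> if \<open>t\<close> is not an
  eigenvalue.  There is at most one such \<open>s\<close>.\<close>
definition eigenvalue_sequence ::
    "(real^'d) set \<Rightarrow> (real^'d \<Rightarrow> real) set \<Rightarrow> (nat \<Rightarrow> real) \<Rightarrow> bool" where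
  "eigenvalue_sequence D V s \<longleftrightarrow>
     mono s \<and> (\<forall>t. finite {k. s k = t} \<and> has_dim_ae D (eigenspace D V t) (card {k. s k = t}))"

text \<open>The sequences are indexed from \<open>0\<close>, the eigenvalues from \<open>1\<close>.\<close>
definition dirichlet_eigenvalue :: "(real^'d) set \<Rightarrow> nat \<Rightarrow> real" where
  "dirichlet_eigenvalue D k = (THE s. eigenvalue_sequence D (H1_0 D) s) (k - 1)"

definition neumann_eigenvalue :: "(real^'d) set \<Rightarrow> nat \<Rightarrow> real" where
  "neumann_eigenvalue D k = (THE s. eigenvalue_sequence D (H1 D) s) (k - 1)"

end

theory Submission
  imports Defs "HOL-Library.Diagonal_Subsequence" "HOL-Library.Function_Algebras"
begin

text \<open>Let \<open>u\<^sub>1, \<dots>, u\<^sub>n\<close> be orthonormal eigenfunctions of \<open>D\<close>, let \<open>S\<close> be the inverse of \<open>T\<close>, and let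
  \<open>M = \<Sum>\<^sub>j \<integral> \<nabla>u\<^sub>j \<nabla>u\<^sub>j\<^sup>T\<close>, so that the trace of \<open>M\<close> is the eigenvalue sum of \<open>D\<close>.  For a symmetry
  \<open>U\<close> of \<open>D\<close>, the transplanted functions \<open>u\<^sub>j \<circ> U\<^sup>T S\<close>, suitably normalised, are admissible in Ky Fan's principle on
  \<open>T(D)\<close>, which bounds the eigenvalue sum of \<open>T(D)\<close> by \<open>tr (S\<^sup>T U M U\<^sup>T S)\<close>.  This bound is linear in
  \<open>U M U\<^sup>T\<close> and hence holds for every matrix in the closed convex hull of the orbit of \<open>M\<close>.  The
  element of least norm of that hull commutes with all symmetries, so by irreducibility it is the scalar
  matrix with the trace of \<open>M\<close>, and this gives the claim.

  The eigenvalues exist by compactness of the Sobolev embedding: Poincare inequalities on small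
  cubes handle the interior, while near the boundary one extends by zero (Dirichlet) or translates
  into the domain (Neumann, Lipschitz boundary).\<close>

text \<open>The factor 1/d arises because the scalar matrix with the trace of M is (tr M / d) I, and
  tr (S^T S) is the squared Hilbert--Schmidt norm of S. All symmetries bound one and the same number
  because T U maps D onto T(D). The symmetry group may be infinite, so a finite average need not
  exist. Equality for multiples of orthogonal matrices comes from applying the trial function bound
  to T and to its inverse.

  The eigenvalues are given by a definite description in terms of dimensions of eigenspaces. Hence
  the numbers found by minimisation must first be shown to form the unique sequence with these
  multiplicities.

  For the Neumann problem the boundary enters through compactness alone. Compactness is carried from
  D to T(D) by the change of variables, which avoids describing the boundary of T(D) by graphs. It
  is expressed through finitely many functionals because this form is stable under finite covers,
  small errors and bounded changes of variables.\<close>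

instantiation "fun" :: (type, real_vector) real_vector
begin

text \<open>Pointwise scaling makes the functions on the whole space a real vector space, so that
  the abstract locales apply directly to \<open>L2 D\<close>, \<open>H1 D\<close> and
  \<open>H1_0 D\<close>, without quotients by null functions.\<close>

definition "scaleR_fun c f = (\<lambda>x. c *\<^sub>R f x)"

instance by standard (simp_all add: scaleR_fun_def fun_eq_iff scaleR_add_right scaleR_add_left)

end

lemma scaleR_fun_apply [simp]: "(c *\<^sub>R f) x = c *\<^sub>R f x"
  by (simp add: scaleR_fun_def)

lemma sum_fun_apply: "(\<Sum>i\<in>I. f i) x = (\<Sum>i\<in>I. f i x)"
  by (induction I rule: infinite_finite_induct) auto

section \<open>The spectrum of a pair of semi-inner products\<close>

text \<open>Semidefinite forms are the right generality: \<open>L2_inner D\<close> vanishes on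
  functions that are null on \<open>D\<close>, and the gradient form vanishes on constants. The
  carrier \<open>V\<close> is explicit because the ambient type also contains functions on which the
  forms have no meaning.\<close>

locale semi_inner =
  fixes V :: "'v::real_vector set" and a :: "'v \<Rightarrow> 'v \<Rightarrow> real"
  assumes subspace: "subspace V"
    and sym: "\<lbrakk>u \<in> V; v \<in> V\<rbrakk> \<Longrightarrow> a u v = a v u"
    and add: "\<lbrakk>u \<in> V; v \<in> V; w \<in> V\<rbrakk> \<Longrightarrow> a (u + v) w = a u w + a v w"
    and scale: "\<lbrakk>u \<in> V; v \<in> V\<rbrakk> \<Longrightarrow> a (c *\<^sub>R u) v = c * a u v"
    and nonneg: "u \<in> V \<Longrightarrow> 0 \<le> a u u"
begin

lemma V_add: "\<lbrakk>u \<in> V; v \<in> V\<rbrakk> \<Longrightarrow> u + v \<in> V"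
  and V_diff: "\<lbrakk>u \<in> V; v \<in> V\<rbrakk> \<Longrightarrow> u - v \<in> V"
  and V_scale: "u \<in> V \<Longrightarrow> c *\<^sub>R u \<in> V"
  and V_zero: "0 \<in> V"
  and V_sum: "(\<And>i. i \<in> I \<Longrightarrow> f i \<in> V) \<Longrightarrow> (\<Sum>i\<in>I. f i) \<in> V"
  using subspace
  by (auto intro: subspace_add subspace_diff subspace_scale subspace_0 subspace_sum)

lemma add_right: "\<lbrakk>u \<in> V; v \<in> V; w \<in> V\<rbrakk> \<Longrightarrow> a w (u + v) = a w u + a w v"
  using add[of u v w] sym V_add by metis

lemma scale_right: "\<lbrakk>u \<in> V; v \<in> V\<rbrakk> \<Longrightarrow> a u (c *\<^sub>R v) = c * a u v"
  using scale[of v u c] sym V_scale by metis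

lemma diff: "\<lbrakk>u \<in> V; v \<in> V; w \<in> V\<rbrakk> \<Longrightarrow> a (u - v) w = a u w - a v w"
  using add[of u "- v" w] scale[of v w "-1"] V_scale[of v "-1"] by simp

lemma diff_right: "\<lbrakk>u \<in> V; v \<in> V; w \<in> V\<rbrakk> \<Longrightarrow> a w (u - v) = a w u - a w v"
  using diff[of u v w] sym V_diff by metis

lemma zero: "u \<in> V \<Longrightarrow> a 0 u = 0"
  using scale[of u u 0] by simp

lemma zero_right: "u \<in> V \<Longrightarrow> a u 0 = 0"
  using scale_right[of u u 0] by simp

lemma sum_left:
  "\<lbrakk>finite I; \<And>i. i \<in> I \<Longrightarrow> f i \<in> V; w \<in> V\<rbrakk> \<Longrightarrow> a (\<Sum>i\<in>I. f i) w = (\<Sum>i\<in>I. a (f i) w)"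
  by (induction I rule: finite_induct) (auto simp: zero add V_sum)

lemma sum_scale_left:
  "\<lbrakk>finite I; \<And>i. i \<in> I \<Longrightarrow> f i \<in> V; w \<in> V\<rbrakk>
    \<Longrightarrow> a (\<Sum>i\<in>I. c i *\<^sub>R f i) w = (\<Sum>i\<in>I. c i * a (f i) w)"
  using sum_left[of I "\<lambda>i. c i *\<^sub>R f i" w] by (auto simp: V_scale scale intro: sum.cong)

lemma sum_scale_right:
  "\<lbrakk>finite I; \<And>i. i \<in> I \<Longrightarrow> f i \<in> V; w \<in> V\<rbrakk>
    \<Longrightarrow> a w (\<Sum>i\<in>I. c i *\<^sub>R f i) = (\<Sum>i\<in>I. c i * a w (f i))"
  by (induction I rule: finite_induct)
    (auto simp: zero_right add_right V_sum V_scale scale_right)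

lemma sq_add: "\<lbrakk>u \<in> V; v \<in> V\<rbrakk> \<Longrightarrow> a (u + v) (u + v) = a u u + 2 * a u v + a v v"
  using sym[of u v] by (simp add: add add_right V_add)

lemma sq_diff: "\<lbrakk>u \<in> V; v \<in> V\<rbrakk> \<Longrightarrow> a (u - v) (u - v) = a u u - 2 * a u v + a v v"
  using sym[of u v] by (simp add: diff diff_right V_diff)

lemma sq_scale: "u \<in> V \<Longrightarrow> a (c *\<^sub>R u) (c *\<^sub>R u) = c\<^sup>2 * a u u"
  by (simp add: scale scale_right V_scale power2_eq_square)

lemma parallelogram:
  "\<lbrakk>u \<in> V; v \<in> V\<rbrakk> \<Longrightarrow> a (u - v) (u - v) = 2 * a u u + 2 * a v v - a (u + v) (u + v)"
  by (simp add: sq_add sq_diff)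

lemma sq_diff_le: "\<lbrakk>u \<in> V; v \<in> V\<rbrakk> \<Longrightarrow> a (u - v) (u - v) \<le> 2 * a u u + 2 * a v v"
  using parallelogram[of u v] nonneg[of "u + v"] V_add by simp

lemma sq_add_le: "\<lbrakk>u \<in> V; v \<in> V\<rbrakk> \<Longrightarrow> a (u + v) (u + v) \<le> 2 * a u u + 2 * a v v"
  using parallelogram[of u v] nonneg[of "u - v"] V_diff by simp

lemma Cauchy_Schwarz:
  assumes "u \<in> V" "v \<in> V" shows "(a u v)\<^sup>2 \<le> a u u * a v v"
proof -
  have q: "0 \<le> a u u + 2 * t * a u v + t\<^sup>2 * a v v" for t
    using nonneg[of "u + t *\<^sub>R v"] assms sq_scale[of v t]
    by (simp add: sq_add V_scale V_add scale_right mult.assoc del: scale)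
  show ?thesis
  proof (cases "a v v = 0")
    case True
    have "a u v = 0"
    proof (rule ccontr)
      assume "a u v \<noteq> 0"
      \<comment> \<open>With \<open>a v v = 0\<close> the quadratic is affine in t, and at this t
        its value is -1.\<close>
      then show False
        using q[of "- (a u u + 1) / (2 * a u v)"] True by (simp add: field_simps)
    qed
    then show ?thesis using True by simp
  next
    case False
    then have pos: "a v v > 0" using nonneg[of v] assms by simp
    have "0 \<le> (a u u + 2 * (- a u v / a v v) * a u v + (- a u v / a v v)\<^sup>2 * a v v) * a v v"
      using q[of "- a u v / a v v"] pos by (intro mult_nonneg_nonneg) auto
    also have "\<dots> = a u u * a v v - (a u v)\<^sup>2"
      using pos by (simp add: field_simps power2_eq_square)
    finally show ?thesis by simp
  qed
qed

text \<open>By Cauchy--Schwarz a null vector is orthogonal to everything. Applied to a form from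
  which its extremal value has been subtracted, this yields an eigenvalue equation without any
  differentiation.\<close>

lemma null_left: "\<lbrakk>u \<in> V; v \<in> V; a u u = 0\<rbrakk> \<Longrightarrow> a u v = 0"
  using Cauchy_Schwarz[of u v] by simp

lemma tendsto_inner:
  assumes X: "\<And>n. X n \<in> V" and u: "u \<in> V" and v: "v \<in> V"
    and lim: "(\<lambda>n. a (X n - u) (X n - u)) \<longlonglongrightarrow> 0"
  shows "(\<lambda>n. a (X n) v) \<longlonglongrightarrow> a u v"
proof -
  have "(\<lambda>n. sqrt (a (X n - u) (X n - u) * a v v)) \<longlonglongrightarrow> 0"
    using tendsto_real_sqrt[OF tendsto_mult_left_zero[OF lim, of "a v v"]] by simp
  moreover have "norm (a (X n) v - a u v) \<le> sqrt (a (X n - u) (X n - u) * a v v)" for n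
    using Cauchy_Schwarz[of "X n - u" v] X u v
    by (auto simp: V_diff diff intro!: real_le_rsqrt)
  ultimately have "(\<lambda>n. a (X n) v - a u v) \<longlonglongrightarrow> 0"
    by (rule_tac Lim_null_comparison[of _ "\<lambda>n. sqrt (a (X n - u) (X n - u) * a v v)"]) auto
  then show ?thesis by (simp add: LIM_zero_iff)
qed

lemma tendsto_sq:
  assumes X: "\<And>n. X n \<in> V" and u: "u \<in> V"
    and lim: "(\<lambda>n. a (X n - u) (X n - u)) \<longlonglongrightarrow> 0"
  shows "(\<lambda>n. a (X n) (X n)) \<longlonglongrightarrow> a u u"
proof -
  have "a (X n) (X n) = a (X n - u) (X n - u) + 2 * a (X n) u - a u u" for n
    using X u by (simp add: sq_diff)
  moreover have "(\<lambda>n. a (X n - u) (X n - u) + 2 * a (X n) u - a u u) \<longlonglongrightarrow> 0 + 2 * a u u - a u u"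
    by (intro tendsto_intros lim tendsto_inner[OF X u u])
  ultimately show ?thesis by simp
qed

section \<open>Finite orthonormal systems and Bessel's inequality\<close>

definition orthonormal :: "nat \<Rightarrow> (nat \<Rightarrow> 'v) \<Rightarrow> bool" where
  "orthonormal n f \<longleftrightarrow>
     (\<forall>i<n. f i \<in> V) \<and> (\<forall>i<n. \<forall>j<n. a (f i) (f j) = (if i = j then 1 else 0))"

definition residual :: "nat \<Rightarrow> (nat \<Rightarrow> 'v) \<Rightarrow> 'v \<Rightarrow> 'v" where
  "residual n f v = v - (\<Sum>i<n. a v (f i) *\<^sub>R f i)"

lemma residual_V: "\<lbrakk>orthonormal n f; v \<in> V\<rbrakk> \<Longrightarrow> residual n f v \<in> V"
  unfolding residual_def orthonormal_def by (intro V_diff V_sum V_scale) auto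

lemma residual_orth:
  assumes "orthonormal n f" "v \<in> V" "j < n"
  shows "a (residual n f v) (f j) = 0"
proof -
  have fV: "\<And>i. i < n \<Longrightarrow> f i \<in> V" using assms unfolding orthonormal_def by auto
  have "a (residual n f v) (f j) = a v (f j) - (\<Sum>i<n. a v (f i) * a (f i) (f j))"
    using assms(2,3) fV unfolding residual_def
    by (subst diff) (auto intro!: V_sum V_scale sum_scale_left)
  also have "(\<Sum>i<n. a v (f i) * a (f i) (f j)) = (\<Sum>i<n. if i = j then a v (f j) else 0)"
    using assms unfolding orthonormal_def by (intro sum.cong) auto
  finally show ?thesis using assms by simp
qed

lemma residual_sq:
  assumes "orthonormal n f" "v \<in> V"
  shows "a (residual n f v) (residual n f v) = a v v - (\<Sum>i<n. (a v (f i))\<^sup>2)"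
proof -
  define r where "r = residual n f v"
  define s where "s = (\<Sum>i<n. a v (f i) *\<^sub>R f i)"
  have fV: "\<And>i. i < n \<Longrightarrow> f i \<in> V" using assms unfolding orthonormal_def by auto
  have rV: "r \<in> V" using residual_V assms by (auto simp: r_def)
  have sV: "s \<in> V" using fV by (auto simp: s_def intro!: V_sum V_scale)
  have r: "r = v - s" by (simp add: r_def s_def residual_def)
  have "a r s = (\<Sum>i<n. a v (f i) * a r (f i))"
    unfolding s_def using fV rV by (intro sum_scale_right) auto
  also have "\<dots> = 0" using residual_orth[OF assms] by (simp add: r_def)
  finally have 1: "a r s = 0" .
  have "a s v = (\<Sum>i<n. a v (f i) * a (f i) v)"
    unfolding s_def using fV assms by (intro sum_scale_left) auto
  also have "\<dots> = (\<Sum>i<n. (a v (f i))\<^sup>2)"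
  proof (intro sum.cong refl)
    fix i assume "i \<in> {..<n}"
    then have "a (f i) v = a v (f i)" using fV assms(2) by (intro sym) auto
    then show "a v (f i) * a (f i) v = (a v (f i))\<^sup>2" by (simp add: power2_eq_square)
  qed
  finally have 2: "a s v = (\<Sum>i<n. (a v (f i))\<^sup>2)" .
  have "a r r = a r v - a r s" using diff_right[OF assms(2) sV rV] r by simp
  moreover have "a r v = a v v - a s v" unfolding r using assms(2) sV by (intro diff) auto
  ultimately show ?thesis using 1 2 unfolding r_def[symmetric] by linarith
qed

lemma Bessel: "\<lbrakk>orthonormal n f; v \<in> V\<rbrakk> \<Longrightarrow> (\<Sum>i<n. (a v (f i))\<^sup>2) \<le> a v v"
  using residual_sq[of n f v] nonneg[OF residual_V[of n f v]] by linarith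

end

text \<open>Compactness of the embedding, in the quantitative form that is directly provided by
  Poincare inequalities on small cubes: up to a small multiple of the full norm, \<open>q\<close> is controlled
  by finitely many \<open>b\<close>-bounded linear functionals.\<close>
definition finitely_controlled ::
    "'v::real_vector set \<Rightarrow> ('v \<Rightarrow> real) \<Rightarrow> ('v \<Rightarrow> real) \<Rightarrow> ('v \<Rightarrow> real) \<Rightarrow> bool" where
  "finitely_controlled V h b q \<longleftrightarrow>
     (\<forall>\<epsilon>>0. \<exists>L C. finite L
        \<and> (\<forall>l\<in>L. (\<forall>u\<in>V. (l u)\<^sup>2 \<le> C * b u) \<and> (\<forall>u\<in>V. \<forall>v\<in>V. l (u - v) = l u - l v))
        \<and> (\<forall>u\<in>V. q u \<le> \<epsilon> * h u + (\<Sum>l\<in>L. (l u)\<^sup>2)))"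

text \<open>The extracted sequence \<open>s\<close> occurs in the statement because the diagonal
  construction asks for a refinement of an arbitrary subsequence.\<close>

lemma simultaneous_convergent_subseq:
  fixes L :: "('v \<Rightarrow> real) set" and s :: "nat \<Rightarrow> nat"
  assumes "finite L" and "\<forall>l\<in>L. \<forall>n. \<bar>l (X n)\<bar> \<le> C"
  shows "\<exists>r. strict_mono (r::nat\<Rightarrow>nat) \<and> (\<forall>l\<in>L. convergent (\<lambda>n. l (X (s (r n)))))"
  using assms
proof (induction L rule: finite_induct)
  case empty
  then show ?case by (auto intro: exI[of _ id] strict_mono_id)
next
  case (insert l L)
  then obtain r where r: "strict_mono (r::nat\<Rightarrow>nat)" "\<forall>l\<in>L. convergent (\<lambda>n. l (X (s (r n))))"
    by auto
  have "bounded (range (\<lambda>n. l (X (s (r n)))))"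
    using insert.prems by (auto simp: bounded_iff)
  then obtain x r' where r': "strict_mono (r'::nat\<Rightarrow>nat)" "((\<lambda>n. l (X (s (r n)))) \<circ> r') \<longlonglongrightarrow> x"
    using bounded_imp_convergent_subsequence by blast
  have "\<forall>k\<in>insert l L. convergent (\<lambda>n. k (X (s ((r \<circ> r') n))))"
    using r' r(2) convergent_subseq_convergent[OF _ r'(1)]
    by (fastforce simp: convergent_def comp_def)
  then show ?case using strict_mono_o[OF r(1) r'(1)] by blast
qed

text \<open>Completeness refers to the energy a + b. Compactness bounds \<open>b\<close> by a small
  part of this energy plus finitely many functionals, and \<open>infinite_dim\<close> keeps the
  construction of eigenvectors from stopping.\<close>

locale spectral_pair = A: semi_inner V a + B: semi_inner V b
  for V :: "'v::real_vector set" and a b +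
  assumes complete: "\<And>X. \<lbrakk>\<And>n. X n \<in> V;
        \<And>e. e > 0 \<Longrightarrow> \<exists>N. \<forall>m\<ge>N. \<forall>n\<ge>N. a (X m - X n) (X m - X n) + b (X m - X n) (X m - X n) < e\<rbrakk>
      \<Longrightarrow> \<exists>u\<in>V. (\<lambda>n. a (X n - u) (X n - u) + b (X n - u) (X n - u)) \<longlonglongrightarrow> 0"
    and compact: "finitely_controlled V (\<lambda>u. a u u + b u u) (\<lambda>u. b u u) (\<lambda>u. b u u)"
    and infinite_dim: "\<And>N. \<exists>f. B.orthonormal N f"
begin

text \<open>For the tolerance \<open>1 / Suc k\<close> the finitely many functionals are bounded
  along \<open>X\<close>, and a diagonal subsequence makes all of them converge, for all k at once.
  Differences then have small functional values, while their bounded energy carries the small factor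
  \<open>1 / Suc k\<close>.\<close>

lemma compact_subseq:
  assumes X: "\<And>n. X n \<in> V" and K: "\<And>n. a (X n) (X n) + b (X n) (X n) \<le> K"
  shows "\<exists>r. strict_mono (r::nat\<Rightarrow>nat) \<and>
    (\<forall>e>0. \<exists>N. \<forall>m\<ge>N. \<forall>n\<ge>N. b (X (r m) - X (r n)) (X (r m) - X (r n)) < e)"
proof -
  have K0: "0 \<le> K" using K[of 0] A.nonneg[OF X, of 0] B.nonneg[OF X, of 0] by linarith
  have bK: "b (X n) (X n) \<le> K" for n using K[of n] A.nonneg[OF X, of n] by linarith
  have "\<forall>k::nat. \<exists>L C. finite L
        \<and> (\<forall>l\<in>L. (\<forall>u\<in>V. (l u)\<^sup>2 \<le> C * b u u) \<and> (\<forall>u\<in>V. \<forall>v\<in>V. l (u - v) = l u - l v))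
        \<and> (\<forall>u\<in>V. b u u \<le> 1 / Suc k * (a u u + b u u) + (\<Sum>l\<in>L. (l u)\<^sup>2))"
    using compact[unfolded finitely_controlled_def] by (intro allI) (drule spec, erule mp, simp)
  then obtain L C where L: "\<And>k::nat. finite (L k)"
      "\<And>k l u. l \<in> L k \<Longrightarrow> u \<in> V \<Longrightarrow> (l u)\<^sup>2 \<le> C k * b u u"
      "\<And>k l u v. l \<in> L k \<Longrightarrow> u \<in> V \<Longrightarrow> v \<in> V \<Longrightarrow> l (u - v) = l u - l v"
      "\<And>k u. u \<in> V \<Longrightarrow> b u u \<le> 1 / Suc k * (a u u + b u u) + (\<Sum>l\<in>L k. (l u)\<^sup>2)"
    by metis
  have bd: "\<bar>l (X n)\<bar> \<le> sqrt (\<bar>C k\<bar> * K)" if "l \<in> L k" for k l n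
  proof -
    have "(l (X n))\<^sup>2 \<le> C k * b (X n) (X n)" using L(2) that X by auto
    also have "\<dots> \<le> \<bar>C k\<bar> * K"
      using bK B.nonneg[OF X] by (intro mult_mono) auto
    finally show ?thesis by (intro real_le_rsqrt) simp
  qed
  let ?P = "\<lambda>k r. \<forall>l\<in>L k. convergent (\<lambda>n. l (X (r n)))"
  interpret subseqs ?P
  proof
    fix k and s :: "nat \<Rightarrow> nat" assume "strict_mono s"
    show "\<exists>r'. strict_mono r' \<and> ?P k (s \<circ> r')"
      using simultaneous_convergent_subseq[OF L(1), of k X "sqrt (\<bar>C k\<bar> * K)" s] bd by auto
  qed
  have conv: "convergent (\<lambda>n. l (X (diagseq n)))" if "l \<in> L k" for k l
  proof -
    have "?P k (diagseq \<circ> ((+) (Suc k)))"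
    proof (rule diagseq_holds)
      fix r s :: "nat \<Rightarrow> nat" and n assume "strict_mono r" "?P n s"
      then show "?P n (s \<circ> r)"
        using convergent_subseq_convergent[of "\<lambda>i. _ (X (s i))" r] by (auto simp: comp_def)
    qed
    then have "convergent (\<lambda>n. l (X (diagseq (n + Suc k))))"
      using that by (auto simp: comp_def add.commute)
    then show ?thesis by (subst (asm) convergent_ignore_initial_segment)
  qed
  show ?thesis
  proof (intro exI[of _ diagseq] conjI subseq_diagseq allI impI)
    fix e :: real assume e: "e > 0"
    \<comment> \<open>Differences have energy at most \<open>4 * K\<close>, so this \<open>k\<close>
      leaves less than e/2 for the energy term.\<close>
    obtain k :: nat where k: "8 * K / e < real k" using reals_Archimedean2 by blast
    have k': "1 / Suc k * (4 * K) < e / 2"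
    proof -
      have "8 * K < real (Suc k) * e" using k e by (simp add: field_simps)
      then show ?thesis by (simp add: field_simps)
    qed
    \<comment> \<open>The \<open>card (L k)\<close> squares, each at most \<open>d\<^sup>2\<close>,
      add up to at most e/2; the added 1 covers an empty \<open>L k\<close>.\<close>
    define d where "d = sqrt (e / (2 * (card (L k) + 1)))"
    have d: "d > 0" using e by (simp add: d_def)
    have "\<forall>l. \<exists>N. l \<in> L k \<longrightarrow>
        (\<forall>m\<ge>N. \<forall>n\<ge>N. \<bar>l (X (diagseq m)) - l (X (diagseq n))\<bar> < d)"
      using convergent_Cauchy[OF conv] d unfolding Cauchy_def dist_real_def by blast
    from choice[OF this] obtain N where N: "\<And>l m n. l \<in> L k \<Longrightarrow> m \<ge> N l \<Longrightarrow> n \<ge> N l \<Longrightarrow>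
        \<bar>l (X (diagseq m)) - l (X (diagseq n))\<bar> < d" by blast
    define M where "M = Max (insert 0 (N ` L k))"
    have M: "l \<in> L k \<Longrightarrow> N l \<le> M" for l using L(1) unfolding M_def by (intro Max_ge) auto
    have "b (X (diagseq m) - X (diagseq n)) (X (diagseq m) - X (diagseq n)) < e"
      if "m \<ge> M" "n \<ge> M" for m n
    proof -
      let ?x = "X (diagseq m)" and ?y = "X (diagseq n)"
      have "a (?x - ?y) (?x - ?y) + b (?x - ?y) (?x - ?y) \<le> 4 * K"
        using A.sq_diff_le[OF X X, of "diagseq m" "diagseq n"]
          B.sq_diff_le[OF X X, of "diagseq m" "diagseq n"] K[of "diagseq m"] K[of "diagseq n"]
        by linarith
      then have 1: "1 / Suc k * (a (?x - ?y) (?x - ?y) + b (?x - ?y) (?x - ?y)) < e / 2"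
        by (intro le_less_trans[OF _ k'] mult_left_mono) auto
      have "(\<Sum>l\<in>L k. (l (?x - ?y))\<^sup>2) \<le> (\<Sum>l\<in>L k. d\<^sup>2)"
      proof (rule sum_mono)
        fix l assume l: "l \<in> L k"
        have "\<bar>l ?x - l ?y\<bar> < d" using M[OF l] that by (intro N[OF l]) auto
        then have "\<bar>l (?x - ?y)\<bar> \<le> \<bar>d\<bar>" using L(3)[OF l X X] d by simp
        then show "(l (?x - ?y))\<^sup>2 \<le> d\<^sup>2" by (rule abs_le_square_iff[THEN iffD1])
      qed
      also have "\<dots> = card (L k) * (e / (2 * (card (L k) + 1)))"
        using e by (simp add: d_def)
      also have "\<dots> \<le> e / 2" using e by (simp add: field_simps)
      finally show ?thesis using 1 L(4)[OF A.V_diff[OF X X], of "diagseq m" "diagseq n" k] by linarith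
    qed
    then show "\<exists>N. \<forall>m\<ge>N. \<forall>n\<ge>N.
        b (X (diagseq m) - X (diagseq n)) (X (diagseq m) - X (diagseq n)) < e" by blast
  qed
qed

text \<open>A dimension count: if all n + 1 vectors \<open>g j\<close> had null residuals, their
  squared coefficients along the \<open>f i\<close> would sum to n + 1, whereas Bessel's inequality
  for each \<open>f i\<close> against the system \<open>g\<close> bounds the sum by n. A residual
  that is not null is then normalised.\<close>

lemma exists_orthogonal_unit:
  assumes f: "B.orthonormal n f"
  shows "\<exists>w\<in>V. b w w = 1 \<and> (\<forall>i<n. b w (f i) = 0)"
proof -
  obtain g where g: "B.orthonormal (Suc n) g" using infinite_dim by blast
  have gV: "g j \<in> V" "b (g j) (g j) = 1" if "j < Suc n" for j
    using g that unfolding B.orthonormal_def by auto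
  have fV: "f i \<in> V" if "i < n" for i using f that unfolding B.orthonormal_def by auto
  have "\<exists>j<Suc n. b (B.residual n f (g j)) (B.residual n f (g j)) \<noteq> 0"
  proof (rule ccontr)
    assume "\<not> ?thesis"
    then have "(\<Sum>i<n. (b (g j) (f i))\<^sup>2) = 1" if "j < Suc n" for j
      using B.residual_sq[OF f gV(1)[OF that]] gV(2)[OF that] that by simp
    then have "real (Suc n) = (\<Sum>j<Suc n. \<Sum>i<n. (b (g j) (f i))\<^sup>2)" by simp
    also have "\<dots> = (\<Sum>i<n. \<Sum>j<Suc n. (b (f i) (g j))\<^sup>2)"
      using fV gV(1) by (subst sum.swap) (intro sum.cong refl, metis B.sym lessThan_iff)
    also have "\<dots> \<le> (\<Sum>i<n. b (f i) (f i))"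
      using B.Bessel[OF g] fV by (intro sum_mono) auto
    also have "\<dots> = real n" using f unfolding B.orthonormal_def by simp
    finally show False by simp
  qed
  then obtain j where j: "j < Suc n" "b (B.residual n f (g j)) (B.residual n f (g j)) \<noteq> 0" by blast
  let ?r = "B.residual n f (g j)"
  have r: "?r \<in> V" "b ?r ?r > 0"
    using B.residual_V[OF f gV(1)[OF j(1)]] j B.nonneg[of ?r] by auto
  let ?w = "(1 / sqrt (b ?r ?r)) *\<^sub>R ?r"
  have "b ?w ?w = 1" using r by (simp add: B.sq_scale power_divide)
  moreover have "b ?w (f i) = 0" if "i < n" for i
    using B.residual_orth[OF f gV(1)[OF j(1)] that] r fV[OF that] by (simp add: B.scale)
  ultimately show ?thesis using B.V_scale[OF r(1)] by blast
qed

text \<open>Besides normalisation and orthogonality this asks for the weak eigenvalue equation with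
  eigenvalue \<open>a x x\<close> and for minimality of the Rayleigh quotient. Only values of
  \<open>f\<close> below \<open>n\<close> occur, as the recursive choice of the eigenbasis
  requires.\<close>

definition is_next :: "(nat \<Rightarrow> 'v) \<Rightarrow> nat \<Rightarrow> 'v \<Rightarrow> bool" where
  "is_next f n x \<longleftrightarrow> x \<in> V \<and> b x x = 1 \<and> (\<forall>i<n. b x (f i) = 0)
     \<and> (\<forall>v\<in>V. a x v = a x x * b x v)
     \<and> (\<forall>w\<in>V. (\<forall>i<n. b w (f i) = 0) \<longrightarrow> a x x * b w w \<le> a w w)"

lemma orthonormal_if_is_next:
  assumes "\<And>i. i < n \<Longrightarrow> is_next f i (f i)" shows "B.orthonormal n f"
proof -
  have "b (f i) (f j) = (if i = j then 1 else 0)" if "i < n" "j < n" for i j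
  proof (cases i j rule: linorder_cases)
    case less
    then have "b (f j) (f i) = 0" using assms[OF that(2)] by (auto simp: is_next_def)
    then show ?thesis
      using less B.sym[of "f i" "f j"] assms[OF that(1)] assms[OF that(2)]
      by (auto simp: is_next_def)
  qed (use assms that in \<open>auto simp: is_next_def\<close>)
  then show ?thesis using assms by (auto simp: B.orthonormal_def is_next_def)
qed

text \<open>Direct method: a minimising sequence on the unit sphere of \<open>W\<close> has a
  \<open>b\<close>-Cauchy subsequence by compactness. The parallelogram identity together with
  minimality makes it \<open>a\<close>-Cauchy as well, and by completeness its limit attains the
  infimum.\<close>

lemma exists_next:
  assumes prev: "\<And>i. i < n \<Longrightarrow> is_next f i (f i)"
  shows "\<exists>x. is_next f n x"
proof -
  have f: "B.orthonormal n f" by (rule orthonormal_if_is_next[OF prev])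
  have fV: "f i \<in> V" if "i < n" for i using prev[OF that] by (simp add: is_next_def)
  define W where "W = {w\<in>V. \<forall>i<n. b w (f i) = 0}"
  have WV: "w \<in> V" if "w \<in> W" for w using that by (simp add: W_def)
  define S where "S = (\<lambda>w. a w w) ` {w\<in>W. b w w = 1}"
  have Sne: "S \<noteq> {}" using exists_orthogonal_unit[OF f] unfolding S_def W_def by auto
  have Sbdd: "bdd_below S"
    unfolding S_def by (rule bdd_belowI2[of _ 0]) (auto intro: A.nonneg WV)
  define m where "m = Inf S"
  have m0: "0 \<le> m" unfolding m_def using Sne
    by (rule cInf_greatest) (auto simp: S_def intro: A.nonneg WV)
  have min: "m * b w w \<le> a w w" if "w \<in> W" for w
  proof (cases "b w w = 0")
    case True then show ?thesis using A.nonneg WV that by simp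
  next
    case False
    then have pos: "b w w > 0" using B.nonneg[OF WV[OF that]] by simp
    let ?w = "(1 / sqrt (b w w)) *\<^sub>R w"
    have "?w \<in> W" using that fV unfolding W_def by (auto simp: B.scale intro: B.V_scale)
    moreover have "b ?w ?w = 1" using pos WV[OF that] by (simp add: B.sq_scale power_divide)
    ultimately have "m \<le> a ?w ?w"
      unfolding m_def S_def by (intro cInf_lower Sbdd[unfolded S_def]) auto
    also have "a ?w ?w = a w w / b w w"
      using pos WV[OF that] by (simp add: A.sq_scale power_divide)
    finally show ?thesis using pos by (simp add: field_simps)
  qed
  have "\<exists>w. w \<in> W \<and> b w w = 1 \<and> a w w < m + 1 / Suc k" for k :: nat
  proof -
    have "Inf S < m + 1 / Suc k" by (simp add: m_def)
    then obtain y where "y \<in> S" "y < m + 1 / Suc k"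
      using cInf_lessD[OF Sne] by blast
    then show ?thesis by (auto simp: S_def)
  qed
  then obtain X where X: "\<And>k. X k \<in> W" "\<And>k. b (X k) (X k) = 1"
      "\<And>k::nat. a (X k) (X k) < m + 1 / Suc k" by metis
  have XV: "X k \<in> V" for k using WV X(1) by auto
  have "a (X k) (X k) + b (X k) (X k) \<le> m + 2" for k
  proof -
    have "1 / real (Suc k) \<le> 1" by (simp add: field_simps)
    then show ?thesis using X(2)[of k] X(3)[of k] by linarith
  qed
  then obtain r where r: "strict_mono (r::nat\<Rightarrow>nat)"
    "\<And>e. e > 0 \<Longrightarrow> \<exists>N. \<forall>i\<ge>N. \<forall>j\<ge>N. b (X (r i) - X (r j)) (X (r i) - X (r j)) < e"
    using compact_subseq[of X "m + 2", OF XV] by blast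
  let ?Y = "\<lambda>k. X (r k)"
  have "(1 / Suc (r i)) \<le> 1 / Suc i" for i
    using seq_suble[OF r(1), of i] by (simp add: field_simps)
  then have Y3: "a (?Y i) (?Y i) < m + 1 / Suc i" for i using X(3)[of "r i"] by (smt (verit))
  \<comment> \<open>The sum of two members lies in \<open>W\<close> and obeys the lower bound
    \<open>min\<close>; by the parallelogram identity this bounds their \<open>a\<close>-distance
    from above.\<close>
  have par: "a (?Y i - ?Y j) (?Y i - ?Y j)
      \<le> 2 / Suc i + 2 / Suc j + m * b (?Y i - ?Y j) (?Y i - ?Y j)" for i j
  proof -
    have "?Y i + ?Y j \<in> W" using X(1) fV unfolding W_def by (auto simp: B.add B.V_add)
    then have 1: "m * b (?Y i + ?Y j) (?Y i + ?Y j) \<le> a (?Y i + ?Y j) (?Y i + ?Y j)" by (rule min)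
    have 2: "b (?Y i + ?Y j) (?Y i + ?Y j) = 4 - b (?Y i - ?Y j) (?Y i - ?Y j)"
      using B.parallelogram[OF XV XV] X(2) by simp
    have "a (?Y i - ?Y j) (?Y i - ?Y j)
        \<le> 2 * (m + 1 / Suc i) + 2 * (m + 1 / Suc j) - m * (4 - b (?Y i - ?Y j) (?Y i - ?Y j))"
      using A.parallelogram[OF XV XV, of "r i" "r j"] Y3[of i] Y3[of j] 1[unfolded 2] by argo
    then show ?thesis by (simp add: algebra_simps)
  qed
  have "\<exists>u\<in>V. (\<lambda>n. a (?Y n - u) (?Y n - u) + b (?Y n - u) (?Y n - u)) \<longlonglongrightarrow> 0"
  proof (rule complete)
    fix e :: real assume e: "e > 0"
    \<comment> \<open>The \<open>b\<close>-distance occurs with total weight m + 1: m times in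
      \<open>par\<close> and once in the energy.\<close>
    obtain N1 where N1: "\<And>i j. i \<ge> N1 \<Longrightarrow> j \<ge> N1 \<Longrightarrow>
        b (?Y i - ?Y j) (?Y i - ?Y j) < e / (2 * (m + 1))"
      using r(2)[of "e / (2 * (m + 1))"] e m0 by auto
    obtain N2 :: nat where N2: "8 / e < real N2" using reals_Archimedean2 by blast
    have "a (?Y i - ?Y j) (?Y i - ?Y j) + b (?Y i - ?Y j) (?Y i - ?Y j) < e"
      if "i \<ge> max N1 N2" "j \<ge> max N1 N2" for i j
    proof -
      have small: "2 / Suc k < e / 4" if "k \<ge> max N1 N2" for k
      proof -
        have "8 / e < real (Suc k)" using N2 that by linarith
        then show ?thesis using e by (simp add: field_simps)
      qed
      have "(m + 1) * b (?Y i - ?Y j) (?Y i - ?Y j) < (m + 1) * (e / (2 * (m + 1)))"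
        using N1[of i j] that m0 by (intro mult_strict_left_mono) auto
      also have "\<dots> = e / 2" using m0 by (simp add: field_simps)
      finally have "(m + 1) * b (?Y i - ?Y j) (?Y i - ?Y j) < e / 2" .
      then show ?thesis
        using par[of i j] small[OF that(1)] small[OF that(2)] by (simp add: algebra_simps)
    qed
    then show "\<exists>N. \<forall>i\<ge>N. \<forall>j\<ge>N.
        a (?Y i - ?Y j) (?Y i - ?Y j) + b (?Y i - ?Y j) (?Y i - ?Y j) < e" by blast
  qed (rule XV)
  then obtain u where u: "u \<in> V"
    "(\<lambda>n. a (?Y n - u) (?Y n - u) + b (?Y n - u) (?Y n - u)) \<longlonglongrightarrow> 0" by blast
  have limA: "(\<lambda>n. a (?Y n - u) (?Y n - u)) \<longlonglongrightarrow> 0"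
    by (rule tendsto_sandwich[OF _ _ tendsto_const u(2)])
      (auto intro!: always_eventually A.nonneg B.nonneg A.V_diff XV u)
  have limB: "(\<lambda>n. b (?Y n - u) (?Y n - u)) \<longlonglongrightarrow> 0"
    by (rule tendsto_sandwich[OF _ _ tendsto_const u(2)])
      (auto intro!: always_eventually A.nonneg B.nonneg A.V_diff XV u)
  have bu: "b u u = 1"
    using B.tendsto_sq[OF XV u(1) limB] X(2) by (simp add: LIMSEQ_const_iff)
  have uf: "b u (f i) = 0" if "i < n" for i
    using B.tendsto_inner[OF XV u(1) fV[OF that] limB] X(1) that
    by (simp add: W_def LIMSEQ_const_iff)
  have uW: "u \<in> W" using u(1) uf by (simp add: W_def)
  have "a u u \<le> m"
  proof (rule LIMSEQ_le[OF A.tendsto_sq[OF XV u(1) limA]])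
    show "(\<lambda>i. m + 1 / real (Suc i)) \<longlonglongrightarrow> m"
      using tendsto_add[OF tendsto_const[of m] LIMSEQ_inverse_real_of_nat]
      by (simp add: inverse_eq_divide)
    show "\<exists>N. \<forall>i\<ge>N. a (?Y i) (?Y i) \<le> m + 1 / real (Suc i)"
      using Y3 by (auto intro: less_imp_le)
  qed
  then have au: "a u u = m" using min[OF uW] bu by simp
  \<comment> \<open>Minimality says that this form is nonnegative on \<open>W\<close>, and u is a
    null vector of it.\<close>
  let ?q = "\<lambda>x y. a x y - m * b x y"
  interpret Q: semi_inner W ?q
  proof
    show "subspace W"
      unfolding subspace_def W_def
      using fV by (auto simp: B.zero B.add B.scale intro: B.V_zero B.V_add B.V_scale)
    fix x y z c
    show "x \<in> W \<Longrightarrow> y \<in> W \<Longrightarrow> ?q x y = ?q y x" using A.sym[of x y] B.sym[of x y] WV by simp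
    show "x \<in> W \<Longrightarrow> y \<in> W \<Longrightarrow> z \<in> W \<Longrightarrow> ?q (x + y) z = ?q x z + ?q y z"
      using WV by (simp add: A.add B.add algebra_simps)
    show "x \<in> W \<Longrightarrow> y \<in> W \<Longrightarrow> ?q (c *\<^sub>R x) y = c * ?q x y"
      using WV by (simp add: A.scale B.scale algebra_simps)
    show "x \<in> W \<Longrightarrow> 0 \<le> ?q x x" using min by simp
  qed
  have qW: "a u w = m * b u w" if "w \<in> W" for w
    using Q.null_left[OF uW that] au bu by simp
  have "a u v = m * b u v" if v: "v \<in> V" for v
  proof -
    let ?r = "B.residual n f v" and ?s = "\<Sum>i<n. b v (f i) *\<^sub>R f i"
    have rW: "?r \<in> W"
      unfolding W_def using B.residual_V[OF f v] B.residual_orth[OF f v] by auto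
    have sV: "?s \<in> V" using fV by (auto intro!: B.V_sum B.V_scale)
    have vs: "v = ?r + ?s" by (simp add: B.residual_def)
    \<comment> \<open>The earlier eigenvectors satisfy their equation against all of
      \<open>V\<close>, so that u, being \<open>b\<close>-orthogonal to them, is also
      \<open>a\<close>-orthogonal. This extends the equation from \<open>W\<close> to
      \<open>V\<close>.\<close>
    have af: "a u (f i) = 0" if "i < n" for i
    proof -
      have "a (f i) u = a (f i) (f i) * b (f i) u"
        using prev[OF that] u(1) unfolding is_next_def by blast
      then show ?thesis
        using uf[OF that] A.sym[OF u(1) fV[OF that]] B.sym[OF u(1) fV[OF that]] by algebra
    qed
    have "a u ?s = 0" "b u ?s = 0"
      using fV u(1) af uf
      by (subst A.sum_scale_right B.sum_scale_right; auto intro!: sum.neutral)+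
    then have "a u (?r + ?s) = m * b u (?r + ?s)"
      using qW[OF rW] WV[OF rW] sV u(1) by (simp add: A.add_right B.add_right)
    then show ?thesis using vs by simp
  qed
  then have "is_next f n u"
    unfolding is_next_def using u(1) bu uf au min by (auto simp: W_def)
  then show ?thesis by blast
qed

lemma exists_eigenbasis: "\<exists>e. \<forall>n. is_next e n (e n)"
proof (rule dependent_wellorder_choice)
  fix r :: 'v and f g :: "nat \<Rightarrow> 'v" and x :: nat
  assume "\<And>y. y < x \<Longrightarrow> f y = g y"
  then show "is_next f x r = is_next g x r" by (simp add: is_next_def)
next
  fix x f assume "\<And>y. y < x \<Longrightarrow> is_next f y (f y)"
  then show "\<exists>r. is_next f x r" by (rule exists_next)
qed

section \<open>The eigenvalues, their eigenspaces and Ky Fan's principle\<close>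

definition eigenbasis :: "nat \<Rightarrow> 'v" where
  "eigenbasis = (SOME e. \<forall>n. is_next e n (e n))"

definition eigval :: "nat \<Rightarrow> real" where
  "eigval n = a (eigenbasis n) (eigenbasis n)"

lemma eigenbasis_next: "is_next eigenbasis n (eigenbasis n)"
  using someI_ex[OF exists_eigenbasis] unfolding eigenbasis_def by blast

lemma eigenbasis_V: "eigenbasis n \<in> V"
  and eigenbasis_eq: "v \<in> V \<Longrightarrow> a (eigenbasis n) v = eigval n * b (eigenbasis n) v"
  and eigval_min: "\<lbrakk>w \<in> V; \<And>i. i < n \<Longrightarrow> b w (eigenbasis i) = 0\<rbrakk> \<Longrightarrow> eigval n * b w w \<le> a w w"
  using eigenbasis_next[of n] unfolding is_next_def eigval_def by blast+

lemma eigenbasis_orthonormal: "B.orthonormal n eigenbasis"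
  using orthonormal_if_is_next eigenbasis_next by blast

lemma eigenbasis_inner: "b (eigenbasis i) (eigenbasis j) = (if i = j then 1 else 0)"
  using eigenbasis_orthonormal[of "Suc (max i j)"] unfolding B.orthonormal_def
  by (meson le_imp_less_Suc max.cobounded1 max.cobounded2)

lemma eigval_mono: "mono eigval"
proof (rule monoI)
  fix m n :: nat assume mn: "m \<le> n"
  have "eigval m * b (eigenbasis n) (eigenbasis n) \<le> a (eigenbasis n) (eigenbasis n)"
    using mn by (intro eigval_min eigenbasis_V) (simp add: eigenbasis_inner)
  then show "eigval m \<le> eigval n" by (simp add: eigenbasis_inner eigval_def)
qed

text \<open>Otherwise the eigenbasis would be bounded in energy and have a \<open>b\<close>-Cauchy
  subsequence, although distinct members have squared distance 2.\<close>

lemma eigval_unbounded: "\<exists>n. eigval n > t"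
proof (rule ccontr)
  assume "\<not> ?thesis"
  then have "a (eigenbasis n) (eigenbasis n) + b (eigenbasis n) (eigenbasis n) \<le> t + 1" for n
    by (simp add: eigval_def eigenbasis_inner not_less)
  then obtain r where r: "strict_mono (r::nat\<Rightarrow>nat)" "\<And>e. e > 0 \<Longrightarrow> \<exists>N. \<forall>m\<ge>N. \<forall>n\<ge>N.
      b (eigenbasis (r m) - eigenbasis (r n)) (eigenbasis (r m) - eigenbasis (r n)) < e"
    using compact_subseq[of eigenbasis "t + 1", OF eigenbasis_V] by blast
  obtain N where N: "\<And>m n. m \<ge> N \<Longrightarrow> n \<ge> N \<Longrightarrow>
      b (eigenbasis (r m) - eigenbasis (r n)) (eigenbasis (r m) - eigenbasis (r n)) < 1"
    using r(2)[of 1] by auto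
  have "r N \<noteq> r (Suc N)" using r(1) by (metis lessI less_irrefl strict_mono_less)
  then show False
    using N[of N "Suc N"] by (simp add: B.sq_diff eigenbasis_V eigenbasis_inner)
qed

lemma finite_eigval: "finite {k. eigval k \<le> t}"
proof -
  obtain n where "eigval n > t" using eigval_unbounded by blast
  then have "{k. eigval k \<le> t} \<subseteq> {..<n}"
    using monoD[OF eigval_mono] by (force simp: not_le[symmetric])
  then show ?thesis using finite_subset by blast
qed

text \<open>The remainder \<open>r\<close> again solves the equation for \<open>t\<close> and is
  orthogonal to the whole eigenbasis: components for other eigenvalues vanish by symmetry of both
  forms, those for \<open>t\<close> have been subtracted. Minimality at an index whose eigenvalue
  exceeds \<open>t\<close> leaves only a null vector. This is what makes the multiplicities come out
  right.\<close>

lemma eigenspace_expansion: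
  assumes u: "u \<in> V" and eig: "\<And>v. v \<in> V \<Longrightarrow> a u v = t * b u v"
  defines "r \<equiv> u - (\<Sum>k\<in>{k. eigval k = t}. b u (eigenbasis k) *\<^sub>R eigenbasis k)"
  shows "r \<in> V" "b r r = 0"
proof -
  let ?K = "{k. eigval k = t}"
  have fin: "finite ?K" by (rule finite_subset[OF _ finite_eigval[of t]]) auto
  have sV: "(\<Sum>k\<in>?K. b u (eigenbasis k) *\<^sub>R eigenbasis k) \<in> V"
    by (intro B.V_sum B.V_scale eigenbasis_V)
  show rV: "r \<in> V" unfolding r_def using u sV by (rule B.V_diff)
  have orth: "b r (eigenbasis i) = 0" for i
  proof -
    have "b r (eigenbasis i) = b u (eigenbasis i)
        - (\<Sum>k\<in>?K. b u (eigenbasis k) * b (eigenbasis k) (eigenbasis i))"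
      unfolding r_def using u sV fin eigenbasis_V
      by (simp add: B.diff B.sum_scale_left)
    also have "(\<Sum>k\<in>?K. b u (eigenbasis k) * b (eigenbasis k) (eigenbasis i))
        = (\<Sum>k\<in>?K. if k = i then b u (eigenbasis i) else 0)"
      by (intro sum.cong) (auto simp: eigenbasis_inner)
    also have "\<dots> = (if eigval i = t then b u (eigenbasis i) else 0)"
      using fin by simp
    finally have 1: "b r (eigenbasis i) = (if eigval i = t then 0 else b u (eigenbasis i))" by simp
    have "t * b u (eigenbasis i) = eigval i * b u (eigenbasis i)"
      using eig[OF eigenbasis_V, of i] eigenbasis_eq[OF u, of i]
        A.sym[OF u eigenbasis_V, of i] B.sym[OF u eigenbasis_V, of i] by metis
    then show ?thesis using 1 by auto
  qed
  have "a r r = t * b r r"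
  proof -
    have "a r v = t * b r v" if v: "v \<in> V" for v
    proof -
      have "a r v = t * b u v - (\<Sum>k\<in>?K. b u (eigenbasis k) * a (eigenbasis k) v)"
        unfolding r_def using u sV fin eigenbasis_V v eig[OF v]
        by (simp add: A.diff A.sum_scale_left)
      also have "(\<Sum>k\<in>?K. b u (eigenbasis k) * a (eigenbasis k) v)
          = t * (\<Sum>k\<in>?K. b u (eigenbasis k) * b (eigenbasis k) v)"
        unfolding sum_distrib_left using eigenbasis_eq[OF v] by (intro sum.cong) auto
      finally show ?thesis
        unfolding r_def using u sV fin eigenbasis_V v
        by (simp add: B.diff B.sum_scale_left algebra_simps)
    qed
    then show ?thesis using rV by blast
  qed
  moreover obtain n where "eigval n > t" using eigval_unbounded by blast
  moreover have "eigval n * b r r \<le> a r r" by (rule eigval_min[OF rV orth])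
  ultimately have "(eigval n - t) * b r r \<le> 0" "eigval n - t > 0" by (auto simp: algebra_simps)
  then show "b r r = 0" using B.nonneg[OF rV]
    by (metis linorder_not_le mult_pos_pos order_le_less)
qed

text \<open>Each \<open>v j\<close> is split into its part along the first n eigenvectors and a
  remainder, on which the Rayleigh quotient is at least \<open>eigval n\<close>. Measured down from
  \<open>eigval n\<close>, the coefficients carry the nonnegative weights
  \<open>eigval n - eigval k\<close>.\<close>

lemma Ky_Fan:
  assumes v: "B.orthonormal n v"
  shows "(\<Sum>k<n. eigval k) \<le> (\<Sum>j<n. a (v j) (v j))"
proof -
  have vV: "v j \<in> V" and vv: "b (v j) (v j) = 1" if "j < n" for j
    using v that unfolding B.orthonormal_def by auto
  let ?c = "\<lambda>j k. (b (v j) (eigenbasis k))\<^sup>2"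
  have low: "eigval n - (\<Sum>k<n. (eigval n - eigval k) * ?c j k) \<le> a (v j) (v j)" if j: "j < n" for j
  proof -
    let ?s = "\<Sum>k<n. b (v j) (eigenbasis k) *\<^sub>R eigenbasis k"
    let ?r = "B.residual n eigenbasis (v j)"
    have rV: "?r \<in> V" by (rule B.residual_V[OF eigenbasis_orthonormal vV[OF j]])
    have r0: "b ?r (eigenbasis k) = 0" if "k < n" for k
      by (rule B.residual_orth[OF eigenbasis_orthonormal vV[OF j] that])
    have sV: "?s \<in> V" by (intro B.V_sum B.V_scale eigenbasis_V)
    have "eigval n * b ?r ?r \<le> a ?r ?r" by (rule eigval_min[OF rV r0])
    then have 1: "eigval n * (1 - (\<Sum>k<n. ?c j k)) \<le> a ?r ?r"
      using B.residual_sq[OF eigenbasis_orthonormal vV[OF j], of n] vv[OF j] by simp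
    have ak: "a (eigenbasis k) ?r = 0" if "k < n" for k
      using eigenbasis_eq[OF rV] r0[OF that] B.sym[OF rV eigenbasis_V] by simp
    have 2: "a ?s ?r = 0"
      using ak rV eigenbasis_V by (subst A.sum_scale_left) (auto intro!: sum.neutral)
    have "a ?s ?s = (\<Sum>k<n. b (v j) (eigenbasis k) * a (eigenbasis k) ?s)"
      using sV eigenbasis_V by (simp add: A.sum_scale_left)
    also have "\<dots> = (\<Sum>k<n. eigval k * ?c j k)"
    proof (intro sum.cong refl)
      fix k assume k: "k \<in> {..<n}"
      have "b (eigenbasis k) (v j) = b (eigenbasis k) (?r + ?s)" by (simp add: B.residual_def)
      then have "b (eigenbasis k) ?s = b (v j) (eigenbasis k)"
        using r0 k B.sym[OF rV eigenbasis_V] B.sym[OF vV[OF j] eigenbasis_V] rV sV eigenbasis_V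
        by (simp add: B.add_right)
      then show "b (v j) (eigenbasis k) * a (eigenbasis k) ?s = eigval k * ?c j k"
        using eigenbasis_eq[OF sV] by (simp add: power2_eq_square)
    qed
    finally have 3: "a ?s ?s = (\<Sum>k<n. eigval k * ?c j k)" .
    have "a (v j) (v j) = a (?s + ?r) (?s + ?r)" by (simp add: B.residual_def)
    also have "\<dots> = (\<Sum>k<n. eigval k * ?c j k) + a ?r ?r"
      using A.sq_add[OF sV rV] 2 3 by simp
    finally show ?thesis
      using 1 by (simp add: left_diff_distrib sum_subtractf sum_distrib_left algebra_simps)
  qed
  have "(\<Sum>k<n. eigval k) = real n * eigval n - (\<Sum>k<n. eigval n - eigval k)"
    by (simp add: sum_subtractf)
  also have "\<dots> \<le> real n * eigval n - (\<Sum>k<n. (eigval n - eigval k) * (\<Sum>j<n. ?c j k))"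
  proof -
    \<comment> \<open>Bessel's inequality for the system \<open>v\<close>, applied to a single
      eigenvector, bounds each inner sum by 1.\<close>
    have "(\<Sum>k<n. (eigval n - eigval k) * (\<Sum>j<n. ?c j k)) \<le> (\<Sum>k<n. (eigval n - eigval k) * 1)"
    proof (intro sum_mono mult_left_mono)
      fix k assume k: "k \<in> {..<n}"
      have "(\<Sum>j<n. ?c j k) = (\<Sum>j<n. (b (eigenbasis k) (v j))\<^sup>2)"
        using B.sym[OF vV eigenbasis_V[of k]] by (intro sum.cong) simp_all
      then show "(\<Sum>j<n. ?c j k) \<le> 1"
        using B.Bessel[OF v eigenbasis_V, of k] by (simp add: eigenbasis_inner)
      show "0 \<le> eigval n - eigval k" using monoD[OF eigval_mono] k by simp
    qed
    then show ?thesis by simp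
  qed
  also have "\<dots> = (\<Sum>j<n. eigval n - (\<Sum>k<n. (eigval n - eigval k) * ?c j k))"
  proof -
    have "(\<Sum>k<n. (eigval n - eigval k) * (\<Sum>j<n. ?c j k))
        = (\<Sum>j<n. \<Sum>k<n. (eigval n - eigval k) * ?c j k)"
      by (simp only: sum_distrib_left) (rule sum.swap)
    then show ?thesis by (simp add: sum_subtractf)
  qed
  also have "\<dots> \<le> (\<Sum>j<n. a (v j) (v j))" using low by (intro sum_mono) auto
  finally show ?thesis .
qed

end

section \<open>The space of square integrable functions\<close>

text \<open>Values in any Euclidean space, so that one form serves both functions and gradient
  fields.\<close>

definition L2_inner :: "(real^'d) set \<Rightarrow> (real^'d \<Rightarrow> 'b::euclidean_space) \<Rightarrow> (real^'d \<Rightarrow> 'b) \<Rightarrow> real" where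
  "L2_inner D u v = (LINT x|lebesgue_on D. u x \<bullet> v x)"

lemma L2_measurable: "u \<in> L2 D \<Longrightarrow> u \<in> borel_measurable (lebesgue_on D)"
  and L2_integrable: "u \<in> L2 D \<Longrightarrow> integrable (lebesgue_on D) (\<lambda>x. (norm (u x))\<^sup>2)"
  by (auto simp: L2_def)

lemma L2_integrable_inner:
  assumes "u \<in> L2 D" "v \<in> L2 D"
  shows "integrable (lebesgue_on D) (\<lambda>x. u x \<bullet> v x)"
proof (rule Bochner_Integration.integrable_bound)
  show "integrable (lebesgue_on D) (\<lambda>x. (norm (u x))\<^sup>2 + (norm (v x))\<^sup>2)"
    using assms L2_integrable by (intro Bochner_Integration.integrable_add) auto
  show "(\<lambda>x. u x \<bullet> v x) \<in> borel_measurable (lebesgue_on D)"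
    using assms L2_measurable by (intro borel_measurable_inner) auto
  have "norm (u x \<bullet> v x) \<le> norm ((norm (u x))\<^sup>2 + (norm (v x))\<^sup>2)" for x
  proof -
    have "\<bar>u x \<bullet> v x\<bar> \<le> norm (u x) * norm (v x)" by (rule Cauchy_Schwarz_ineq2)
    moreover have "norm (u x) * norm (v x) \<le> (norm (u x))\<^sup>2 + (norm (v x))\<^sup>2"
      using sum_squares_bound[of "norm (u x)" "norm (v x)"]
        mult_nonneg_nonneg[OF norm_ge_zero[of "u x"] norm_ge_zero[of "v x"]] by linarith
    ultimately show ?thesis by simp
  qed
  then show "AE x in lebesgue_on D. norm (u x \<bullet> v x) \<le> norm ((norm (u x))\<^sup>2 + (norm (v x))\<^sup>2)"
    by simp
qed

lemma L2_add: assumes "u \<in> L2 D" "v \<in> L2 D" shows "u + v \<in> L2 D"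
proof -
  have "integrable (lebesgue_on D) (\<lambda>x. (norm (u x))\<^sup>2 + 2 * (u x \<bullet> v x) + (norm (v x))\<^sup>2)"
    using assms L2_integrable L2_integrable_inner
    by (intro Bochner_Integration.integrable_add integrable_mult_right) auto
  moreover have "(norm ((u + v) x))\<^sup>2 = (norm (u x))\<^sup>2 + 2 * (u x \<bullet> v x) + (norm (v x))\<^sup>2" for x
    by (simp add: power2_norm_eq_inner inner_add_left inner_add_right inner_commute)
  moreover have "u + v \<in> borel_measurable (lebesgue_on D)"
    using borel_measurable_add[OF L2_measurable[OF assms(1)] L2_measurable[OF assms(2)]]
    by (simp add: plus_fun_def)
  ultimately show ?thesis by (simp add: L2_def)
qed

lemma L2_scale: assumes "u \<in> L2 D" shows "c *\<^sub>R u \<in> L2 D"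
proof -
  have "(\<lambda>x. c *\<^sub>R u x) \<in> borel_measurable (lebesgue_on D)"
    using L2_measurable[OF assms] by (intro borel_measurable_scaleR) auto
  then show ?thesis
    using L2_integrable[OF assms] by (simp add: L2_def scaleR_fun_def power_mult_distrib)
qed

lemma subspace_L2: "subspace (L2 D)"
proof -
  have "0 \<in> L2 D" by (simp add: L2_def zero_fun_def)
  then show ?thesis unfolding subspace_def using L2_add L2_scale by blast
qed

lemma semi_inner_L2: "semi_inner (L2 D) (L2_inner D)"
proof
  fix u v w :: "real^'a \<Rightarrow> 'b" and c
  assume "u \<in> L2 D"
  then show "0 \<le> L2_inner D u u" by (simp add: L2_inner_def)
  assume v: "v \<in> L2 D"
  show "L2_inner D u v = L2_inner D v u" by (simp add: L2_inner_def inner_commute)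
  show "L2_inner D (c *\<^sub>R u) v = c * L2_inner D u v" by (simp add: L2_inner_def)
  assume "w \<in> L2 D"
  then show "L2_inner D (u + v) w = L2_inner D u w + L2_inner D v w"
    using \<open>u \<in> L2 D\<close> v
    by (simp add: L2_inner_def inner_add_left Bochner_Integration.integral_add L2_integrable_inner)
qed (rule subspace_L2)

global_interpretation L2: semi_inner "L2 D" "L2_inner D" for D
  by (rule semi_inner_L2)

lemma L2_inner_eq_norm: "L2_inner D u u = (LINT x|lebesgue_on D. (norm (u x))\<^sup>2)"
  by (simp add: L2_inner_def power2_norm_eq_inner)

lemma L2_inner_self_eq_0_iff:
  assumes "u \<in> L2 D"
  shows "L2_inner D u u = 0 \<longleftrightarrow> (AE x in lebesgue_on D. u x = 0)"
  unfolding L2_inner_eq_norm using L2_integrable[OF assms]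
  by (subst integral_nonneg_eq_0_iff_AE) auto

lemma L2_inner_cong_AE:
  assumes "AE x in lebesgue_on D. u x = u' x" "AE x in lebesgue_on D. v x = v' x"
    and "u \<in> L2 D" "u' \<in> L2 D" "v \<in> L2 D" "v' \<in> L2 D"
  shows "L2_inner D u v = L2_inner D u' v'"
  unfolding L2_inner_def
proof (rule integral_cong_AE)
  show "(\<lambda>x. u x \<bullet> v x) \<in> borel_measurable (lebesgue_on D)"
    using assms(3,5)[THEN L2_measurable] by measurable
  show "(\<lambda>x. u' x \<bullet> v' x) \<in> borel_measurable (lebesgue_on D)"
    using assms(4,6)[THEN L2_measurable] by measurable
  show "AE x in lebesgue_on D. u x \<bullet> v x = u' x \<bullet> v' x"
    using assms(1,2) by eventually_elim simp
qed

lemma integrable_lebesgue_on_subset: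
  fixes f :: "'a::euclidean_space \<Rightarrow> 'b::{banach,second_countable_topology}"
  assumes "integrable (lebesgue_on D) f" "E \<subseteq> D" "E \<in> sets lebesgue" "D \<in> sets lebesgue"
  shows "integrable (lebesgue_on E) f"
  using assms set_integrable_subset[of lebesgue D f E]
  by (simp add: set_integrable_def integrable_restrict_space)

lemma L2_subset:
  assumes "u \<in> L2 D" "E \<subseteq> D" "E \<in> sets lebesgue" "D \<in> sets lebesgue"
  shows "u \<in> L2 E"
proof -
  have 1: "u \<in> borel_measurable (lebesgue_on E)"
    using L2_measurable[OF assms(1)] assms(2)
    by (rule measurable_restrict_mono[of _ lebesgue])
  have "integrable (lebesgue_on E) (\<lambda>x. (norm (u x))\<^sup>2)"
    using integrable_lebesgue_on_subset[OF L2_integrable[OF assms(1)]] assms by auto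
  then show ?thesis using 1 by (simp add: L2_def)
qed

lemma integral_lebesgue_on_mono_set:
  fixes f :: "real^'d \<Rightarrow> real"
  assumes "integrable (lebesgue_on D) f" "\<And>x. 0 \<le> f x" "E \<subseteq> D" "E \<in> sets lebesgue" "D \<in> sets lebesgue"
  shows "integral\<^sup>L (lebesgue_on E) f \<le> integral\<^sup>L (lebesgue_on D) f"
proof -
  have iD: "integrable lebesgue (\<lambda>x. indicator D x *\<^sub>R f x)"
    using assms by (simp add: integrable_restrict_space)
  have iE: "integrable lebesgue (\<lambda>x. indicator E x *\<^sub>R f x)"
    using integrable_lebesgue_on_subset[OF assms(1)] assms by (simp add: integrable_restrict_space)
  have "(LINT x|lebesgue. indicator E x *\<^sub>R f x) \<le> (LINT x|lebesgue. indicator D x *\<^sub>R f x)"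
    using assms(2,3) by (intro integral_mono iE iD) (auto simp: indicator_def)
  then show ?thesis using assms by (simp add: integral_restrict_space)
qed

lemma L2_inner_mono_set:
  assumes "u \<in> L2 D" "E \<subseteq> D" "E \<in> sets lebesgue" "D \<in> sets lebesgue"
  shows "L2_inner E u u \<le> L2_inner D u u"
  unfolding L2_inner_eq_norm using assms
  by (intro integral_lebesgue_on_mono_set L2_integrable) auto

lemma L2_bounded:
  fixes u :: "real^'d \<Rightarrow> 'b::euclidean_space"
  assumes "u \<in> borel_measurable (lebesgue_on D)" "D \<in> lmeasurable" "\<And>x. x \<in> D \<Longrightarrow> norm (u x) \<le> C"
  shows "u \<in> L2 D"
proof -
  interpret finite_measure "lebesgue_on D"
    using assms(2) by (intro finite_measure_lebesgue_on)
  have "integrable (lebesgue_on D) (\<lambda>x. (norm (u x))\<^sup>2)"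
  proof (rule integrable_const_bound)
    show "AE x in lebesgue_on D. norm ((norm (u x))\<^sup>2) \<le> C\<^sup>2"
      using assms(2,3) by (auto intro!: AE_I2 power_mono simp: space_restrict_space)
    show "(\<lambda>x. (norm (u x))\<^sup>2) \<in> borel_measurable (lebesgue_on D)"
      using assms(1) by measurable
  qed
  then show ?thesis using assms(1) by (simp add: L2_def)
qed

lemma L2_const: "D \<in> lmeasurable \<Longrightarrow> (\<lambda>x. c) \<in> L2 D"
  by (rule L2_bounded[of _ _ "norm c"]) auto

lemma L2_imp_integrable:
  fixes u :: "real^'d \<Rightarrow> real"
  assumes "u \<in> L2 D" "D \<in> lmeasurable" shows "integrable (lebesgue_on D) u"
  using L2_integrable_inner[OF assms(1) L2_const[OF assms(2), of 1]] by simp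

section \<open>Completeness of the space of square integrable functions\<close>

lemma exists_fast_Cauchy_subseq:
  fixes d :: "nat \<Rightarrow> nat \<Rightarrow> real" and \<epsilon> :: "nat \<Rightarrow> real"
  assumes "\<And>e. e > 0 \<Longrightarrow> \<exists>N. \<forall>m\<ge>N. \<forall>n\<ge>N. d m n < e" and "\<And>i. \<epsilon> i > 0"
  shows "\<exists>r. strict_mono r \<and> (\<forall>i. \<forall>m\<ge>r i. \<forall>n\<ge>r i. d m n < \<epsilon> i)"
proof -
  have "\<forall>i. \<exists>N. \<forall>m\<ge>N. \<forall>n\<ge>N. d m n < \<epsilon> i" using assms by blast
  then obtain N where N: "\<And>i m n. m \<ge> N i \<Longrightarrow> n \<ge> N i \<Longrightarrow> d m n < \<epsilon> i" by metis
  define r where "r i = i + (\<Sum>j\<le>i. N j)" for i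
  have "strict_mono r" by (rule strict_monoI_Suc) (simp add: r_def)
  moreover have "N i \<le> r i" for i
    using member_le_sum[of i "{..i}" N] by (simp add: r_def)
  ultimately show ?thesis using N by (meson le_trans)
qed

text \<open>Along a rapidly Cauchy subsequence the squared increments, weighted by powers of 2, have
  a finite integral of their sum. Hence the subsequence converges almost everywhere, and Fatou's
  lemma identifies its pointwise limit as the limit in norm of the whole sequence.\<close>

lemma L2_complete:
  fixes X :: "nat \<Rightarrow> real^'d \<Rightarrow> 'b::euclidean_space"
  assumes X: "\<And>n. X n \<in> L2 D"
    and Cauchy: "\<And>e. e > 0 \<Longrightarrow> \<exists>N. \<forall>m\<ge>N. \<forall>n\<ge>N. L2_inner D (X m - X n) (X m - X n) < e"
  shows "\<exists>u\<in>L2 D. (\<lambda>n. L2_inner D (X n - u) (X n - u)) \<longlonglongrightarrow> 0"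
proof -
  let ?M = "lebesgue_on D"
  have meas: "X n \<in> borel_measurable ?M" for n using X by (rule L2_measurable)
  have nn: "(\<integral>\<^sup>+x. ennreal ((norm (X m x - X n x))\<^sup>2) \<partial>?M) = ennreal (L2_inner D (X m - X n) (X m - X n))" for m n
    unfolding L2_inner_eq_norm using L2_integrable[OF L2.V_diff[OF X X], of m n]
    by (subst nn_integral_eq_integral) auto
  obtain r where r: "strict_mono r"
      "\<And>i m n. m \<ge> r i \<Longrightarrow> n \<ge> r i \<Longrightarrow> L2_inner D (X m - X n) (X m - X n) < (1/4)^i"
    using exists_fast_Cauchy_subseq[OF Cauchy, of "\<lambda>i. (1/4)^i"] by auto
  define g where "g i x = X (r (Suc i)) x - X (r i) x" for i x
  have gmeas[measurable]: "g i \<in> borel_measurable ?M" for i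
    unfolding g_def using meas by (intro borel_measurable_diff) auto
  have "(\<integral>\<^sup>+x. (\<Sum>i. ennreal (2^i * (norm (g i x))\<^sup>2)) \<partial>?M)
      = (\<Sum>i. \<integral>\<^sup>+x. ennreal (2^i * (norm (g i x))\<^sup>2) \<partial>?M)"
    by (rule nn_integral_suminf) measurable
  also have "\<dots> \<le> (\<Sum>i. ennreal ((1/2)^i))"
  proof (intro suminf_le allI)
    fix i
    have "(\<integral>\<^sup>+x. ennreal (2^i * (norm (g i x))\<^sup>2) \<partial>?M)
        = ennreal (2^i) * (\<integral>\<^sup>+x. ennreal ((norm (g i x))\<^sup>2) \<partial>?M)"
      by (subst nn_integral_cmult[symmetric]) (auto simp: ennreal_mult)
    also have "\<dots> = ennreal (2^i * L2_inner D (X (r (Suc i)) - X (r i)) (X (r (Suc i)) - X (r i)))"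
      unfolding g_def nn by (simp add: ennreal_mult L2.nonneg L2.V_diff X)
    also have "\<dots> \<le> ennreal (2^i * (1/4)^i)"
      using r(2)[of i "r (Suc i)" "r i"] strict_monoD[OF r(1), of i "Suc i"]
      by (intro ennreal_leI mult_left_mono) auto
    also have "2^i * (1/4)^i = ((1/2)::real)^i" by (simp add: power_mult_distrib[symmetric])
    finally show "(\<integral>\<^sup>+x. ennreal (2^i * (norm (g i x))\<^sup>2) \<partial>?M) \<le> ennreal ((1/2)^i)" .
  qed auto
  also have "\<dots> = ennreal (\<Sum>i. (1/2)^i)"
    by (rule suminf_ennreal2) (auto intro: summable_geometric)
  also have "\<dots> < \<infinity>" by simp
  finally have fin: "(\<integral>\<^sup>+x. (\<Sum>i. ennreal (2^i * (norm (g i x))\<^sup>2)) \<partial>?M) \<noteq> \<infinity>" by simp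
  have "AE x in ?M. (\<Sum>i. ennreal (2^i * (norm (g i x))\<^sup>2)) \<noteq> \<infinity>"
    by (rule nn_integral_PInf_AE[OF _ fin]) measurable
  then have conv: "AE x in ?M. convergent (\<lambda>i. X (r i) x)"
  proof (rule AE_mp, intro AE_I2 impI)
    fix x assume "(\<Sum>i. ennreal (2^i * (norm (g i x))\<^sup>2)) \<noteq> \<infinity>"
    then have "summable (\<lambda>i. 2^i * (norm (g i x))\<^sup>2)"
      by (intro summable_suminf_not_top) auto
    then have "summable (\<lambda>i. (1/2)^i + 2^i * (norm (g i x))\<^sup>2)"
      by (intro summable_add summable_geometric) auto
    \<comment> \<open>The weights convert summable squares into summable norms, by the
      arithmetic--geometric mean inequality.\<close>
    moreover have "norm (g i x) \<le> (1/2)^i + 2^i * (norm (g i x))\<^sup>2" for i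
    proof -
      have "0 \<le> (1 - 2^i * norm (g i x))\<^sup>2 / 2^i" by simp
      also have "\<dots> = (1/2)^i - 2 * norm (g i x) + 2^i * (norm (g i x))\<^sup>2"
        by (simp add: power2_eq_square field_simps power_divide)
      finally show ?thesis using norm_ge_zero[of "g i x"] by linarith
    qed
    ultimately have "summable (\<lambda>i. g i x)"
      by (intro summable_comparison_test[of "\<lambda>i. g i x"]) auto
    then have "convergent (\<lambda>n. \<Sum>i<n. g i x)" by (simp add: summable_iff_convergent)
    moreover have "(\<lambda>n. X (r n) x) = (\<lambda>n. X (r 0) x + (\<Sum>i<n. g i x))"
      unfolding g_def by (subst sum_lessThan_telescope) simp
    ultimately show "convergent (\<lambda>i. X (r i) x)"
      by (simp only: convergent_add_const_iff)
  qed
  define u where "u x = lim (\<lambda>i. X (r i) x)" for x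
  have umeas: "u \<in> borel_measurable ?M"
    unfolding u_def using meas by (intro borel_measurable_lim_metric)
  \<comment> \<open>Fatou's lemma along the subsequence: the distances from \<open>X n\<close> to
    later members bound its distance to the limit.\<close>
  have est: "(\<integral>\<^sup>+x. ennreal ((norm (X n x - u x))\<^sup>2) \<partial>?M) \<le> ennreal e"
    if le: "\<And>m. m \<ge> N \<Longrightarrow> L2_inner D (X n - X m) (X n - X m) < e" for n N e
  proof -
    have "(\<integral>\<^sup>+x. ennreal ((norm (X n x - u x))\<^sup>2) \<partial>?M)
        = (\<integral>\<^sup>+x. liminf (\<lambda>i. ennreal ((norm (X n x - X (r i) x))\<^sup>2)) \<partial>?M)"
    proof (rule nn_integral_cong_AE, rule AE_mp[OF conv], intro AE_I2 impI)
      fix x assume "convergent (\<lambda>i. X (r i) x)"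
      then have "(\<lambda>i. X (r i) x) \<longlonglongrightarrow> u x" by (simp add: u_def convergent_LIMSEQ_iff)
      then have "(\<lambda>i. ennreal ((norm (X n x - X (r i) x))\<^sup>2)) \<longlonglongrightarrow> ennreal ((norm (X n x - u x))\<^sup>2)"
        by (intro tendsto_intros)
      then show "ennreal ((norm (X n x - u x))\<^sup>2) = liminf (\<lambda>i. ennreal ((norm (X n x - X (r i) x))\<^sup>2))"
        using lim_imp_Liminf[OF trivial_limit_sequentially] by metis
    qed
    also have "\<dots> \<le> liminf (\<lambda>i. \<integral>\<^sup>+x. ennreal ((norm (X n x - X (r i) x))\<^sup>2) \<partial>?M)"
      using meas by (intro nn_integral_liminf) measurable
    also have "\<dots> \<le> ennreal e"
    proof (rule order_trans[OF Liminf_le_Limsup[OF trivial_limit_sequentially] Limsup_bounded])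
      have "L2_inner D (X n - X (r i)) (X n - X (r i)) \<le> e" if "i \<ge> N" for i
        using le[of "r i"] seq_suble[OF r(1), of i] that by linarith
      then show "\<forall>\<^sub>F i in sequentially. (\<integral>\<^sup>+x. ennreal ((norm (X n x - X (r i) x))\<^sup>2) \<partial>?M) \<le> ennreal e"
        unfolding nn eventually_sequentially by (auto intro!: exI[of _ N] ennreal_leI)
    qed
    finally show ?thesis .
  qed
  have est2: "X n - u \<in> L2 D \<and> L2_inner D (X n - u) (X n - u) \<le> e"
    if le: "\<And>m. m \<ge> N \<Longrightarrow> L2_inner D (X n - X m) (X n - X m) < e" and "e \<ge> 0" for n N e
  proof -
    have m: "X n - u \<in> borel_measurable ?M"
      using borel_measurable_diff[OF meas umeas] by (simp add: fun_diff_def)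
    have m2: "(\<lambda>x. (norm (X n x - u x))\<^sup>2) \<in> borel_measurable ?M"
      using m by (simp add: fun_diff_def)
    have "integrable ?M (\<lambda>x. (norm ((X n - u) x))\<^sup>2)"
    proof (intro integrableI_nonneg)
      show "(\<integral>\<^sup>+x. ennreal ((norm ((X n - u) x))\<^sup>2) \<partial>?M) < \<infinity>"
        using le_less_trans[OF est[of N n e] ennreal_less_top] le by (simp add: fun_diff_def)
    qed (use m2 in \<open>auto simp: fun_diff_def\<close>)
    then have 1: "X n - u \<in> L2 D" using m by (simp add: L2_def)
    moreover have "ennreal (L2_inner D (X n - u) (X n - u)) \<le> ennreal e"
      unfolding L2_inner_eq_norm using est[OF le] L2_integrable[OF 1]
      by (subst nn_integral_eq_integral[symmetric]) auto
    ultimately show ?thesis using that by simp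
  qed
  obtain N where N: "\<And>m n. m \<ge> N \<Longrightarrow> n \<ge> N \<Longrightarrow> L2_inner D (X m - X n) (X m - X n) < 1"
    using Cauchy[of 1] by auto
  have "X N - u \<in> L2 D" using est2[of N N 1] N by auto
  then have uL2: "u \<in> L2 D" using L2.V_diff[OF X[of N], of "X N - u"] by simp
  have "(\<lambda>n. L2_inner D (X n - u) (X n - u)) \<longlonglongrightarrow> 0"
  proof (rule LIMSEQ_I)
    fix e :: real assume e: "e > 0"
    obtain N where N: "\<And>m n. m \<ge> N \<Longrightarrow> n \<ge> N \<Longrightarrow> L2_inner D (X m - X n) (X m - X n) < e/2"
      using Cauchy[of "e/2"] e by auto
    have "norm (L2_inner D (X n - u) (X n - u) - 0) < e" if "n \<ge> N" for n
      using est2[of N n "e/2"] N that e L2.nonneg[OF L2.V_diff[OF X uL2], of n] by auto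
    then show "\<exists>N. \<forall>n\<ge>N. norm (L2_inner D (X n - u) (X n - u) - 0) < e" by blast
  qed
  then show ?thesis using uL2 by blast
qed

section \<open>Smooth functions and test functions\<close>

lemma partial_deriv_eqI:
  "(f has_derivative f') (at x) \<Longrightarrow> partial_deriv i f x = f' (axis i 1)"
  unfolding partial_deriv_def by (metis frechet_derivative_at)

lemma has_derivative_partial_deriv:
  fixes f :: "real^'d \<Rightarrow> real"
  assumes "f differentiable (at x)"
  shows "(f has_derivative (\<lambda>v. \<Sum>i\<in>UNIV. v $ i * partial_deriv i f x)) (at x)"
proof -
  have d: "(f has_derivative frechet_derivative f (at x)) (at x)"
    using assms frechet_derivative_works by blast
  have "frechet_derivative f (at x) v = (\<Sum>i\<in>UNIV. v $ i * partial_deriv i f x)" for v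
  proof -
    interpret linear "frechet_derivative f (at x)" using d by (rule has_derivative_linear)
    have "frechet_derivative f (at x) v = frechet_derivative f (at x) (\<Sum>i\<in>UNIV. v $ i *\<^sub>R axis i 1)"
      by (simp add: basis_expansion scalar_mult_eq_scaleR[symmetric])
    also have "\<dots> = (\<Sum>i\<in>UNIV. v $ i * frechet_derivative f (at x) (axis i 1))"
      by (simp add: sum scaleR)
    finally show ?thesis by (simp add: partial_deriv_def)
  qed
  then show ?thesis using d by presburger
qed

lemma C_times_imp_continuous: "C_times k f \<Longrightarrow> continuous_on UNIV f"
  by (cases k) (auto intro!: continuous_at_imp_continuous_on differentiable_imp_continuous_within)

lemma C_times_SucD: "C_times (Suc k) f \<Longrightarrow> C_times k f"
  by (induction k arbitrary: f)
    (auto intro!: continuous_at_imp_continuous_on differentiable_imp_continuous_within)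

lemma C_times_const: "C_times k (\<lambda>x. c)"
proof (induction k arbitrary: c)
  case (Suc k)
  have "partial_deriv i (\<lambda>x. c) = (\<lambda>x. 0)" for i :: 'a
    by (rule ext, subst partial_deriv_eqI) (auto intro: has_derivative_const)
  then show ?case using Suc by simp
qed simp

lemma partial_deriv_add:
  assumes "f differentiable (at x)" "g differentiable (at x)"
  shows "partial_deriv i (\<lambda>x. f x + g x) x = partial_deriv i f x + partial_deriv i g x"
  by (subst partial_deriv_eqI)
    (use assms in \<open>auto intro!: has_derivative_add simp: frechet_derivative_works partial_deriv_def\<close>)

lemma C_times_add: "C_times k f \<Longrightarrow> C_times k g \<Longrightarrow> C_times k (\<lambda>x. f x + g x)"
proof (induction k arbitrary: f g)
  case (Suc k)
  then have "partial_deriv i (\<lambda>x. f x + g x) = (\<lambda>x. partial_deriv i f x + partial_deriv i g x)" for i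
    by (auto intro!: ext partial_deriv_add)
  then show ?case using Suc by (auto intro!: differentiable_add)
qed (auto intro: continuous_intros)

lemma partial_deriv_mult:
  fixes f g :: "real^'d \<Rightarrow> real"
  assumes "f differentiable (at x)" "g differentiable (at x)"
  shows "partial_deriv i (\<lambda>x. f x * g x) x = f x * partial_deriv i g x + partial_deriv i f x * g x"
proof -
  have "((\<lambda>x. f x * g x) has_derivative
      (\<lambda>h. f x * frechet_derivative g (at x) h + frechet_derivative f (at x) h * g x)) (at x)"
    using assms by (intro has_derivative_mult) (auto simp: frechet_derivative_works)
  from partial_deriv_eqI[OF this, of i] show ?thesis by (simp add: partial_deriv_def)
qed

lemma C_times_mult: "C_times k f \<Longrightarrow> C_times k g \<Longrightarrow> C_times k (\<lambda>x. f x * g x)"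
proof (induction k arbitrary: f g)
  case (Suc k)
  then have "partial_deriv i (\<lambda>x. f x * g x) = (\<lambda>x. f x * partial_deriv i g x + partial_deriv i f x * g x)" for i
    by (auto intro!: ext partial_deriv_mult)
  moreover have "C_times k f" "C_times k g" using Suc.prems C_times_SucD by auto
  ultimately show ?case using Suc by (auto intro!: differentiable_mult C_times_add)
qed (auto intro: continuous_intros)

lemma C_times_sum: "(\<And>i. i \<in> I \<Longrightarrow> C_times k (f i)) \<Longrightarrow> C_times k (\<lambda>x. \<Sum>i\<in>I. f i x)"
  by (induction I rule: infinite_finite_induct) (auto intro: C_times_add C_times_const)

lemma C_times_nth: "C_times k (\<lambda>x. x $ i)"
proof (cases k)
  case (Suc j)
  have d: "((\<lambda>x. x $ i) has_derivative (\<lambda>x. x $ i)) (at x)" for x :: "real^'a"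
    by (auto intro: bounded_linear_imp_has_derivative bounded_linear_vec_nth)
  then have "partial_deriv l (\<lambda>x. x $ i) = (\<lambda>x. axis l 1 $ i)" for l :: 'a
    by (intro ext) (rule partial_deriv_eqI)
  then show ?thesis using Suc d by (auto simp: differentiable_def C_times_const)
qed (auto intro: continuous_intros)

lemma partial_deriv_affine:
  fixes A :: "real^'d^'d"
  assumes "f differentiable (at (A *v x + b))"
  shows "((\<lambda>x. f (A *v x + b)) has_derivative
           (\<lambda>v. \<Sum>j\<in>UNIV. (A *v v) $ j * partial_deriv j f (A *v x + b))) (at x)"
    and "partial_deriv i (\<lambda>x. f (A *v x + b)) x = (\<Sum>j\<in>UNIV. A $ j $ i * partial_deriv j f (A *v x + b))"
proof -
  have "((\<lambda>x. A *v x + b) has_derivative (\<lambda>v. A *v v)) (at x)"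
    by (auto intro!: derivative_eq_intros bounded_linear_imp_has_derivative
        matrix_vector_mul_bounded_linear)
  from diff_chain_at[OF this has_derivative_partial_deriv[OF assms]]
  show 1: "((\<lambda>x. f (A *v x + b)) has_derivative
           (\<lambda>v. \<Sum>j\<in>UNIV. (A *v v) $ j * partial_deriv j f (A *v x + b))) (at x)"
    by (simp add: comp_def)
  show "partial_deriv i (\<lambda>x. f (A *v x + b)) x = (\<Sum>j\<in>UNIV. A $ j $ i * partial_deriv j f (A *v x + b))"
    using partial_deriv_eqI[OF 1, of i] by (simp add: matrix_vector_mul_component inner_axis)
qed

lemma C_times_affine:
  fixes A :: "real^'d^'d"
  shows "C_times k f \<Longrightarrow> C_times k (\<lambda>x. f (A *v x + b))"
proof (induction k arbitrary: f)
  case 0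
  then have "continuous_on UNIV f" by simp
  moreover have "continuous_on UNIV (\<lambda>x. A *v x + b)"
    by (intro continuous_on_add continuous_on_const linear_continuous_on
        matrix_vector_mul_bounded_linear)
  ultimately show ?case
    unfolding C_times.simps by (rule continuous_on_compose2) auto
next
  case (Suc k)
  then have "partial_deriv i (\<lambda>x. f (A *v x + b))
      = (\<lambda>x. \<Sum>j\<in>UNIV. A $ j $ i * partial_deriv j f (A *v x + b))" for i
    by (intro ext partial_deriv_affine(2)) auto
  moreover have "(\<lambda>x. f (A *v x + b)) differentiable (at x)" for x
    using partial_deriv_affine(1)[of f A x b] Suc.prems by (auto simp: differentiable_def)
  ultimately show ?case
    using Suc by (auto intro!: C_times_sum C_times_mult C_times_const)
qed

text \<open>The functions \<open>y \<mapsto> y\<^sup>-\<^sup>n exp (-1/y)\<close>, extended by zero, are closed under differentiation up to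
  linear combinations.\<close>
definition flat :: "nat \<Rightarrow> real \<Rightarrow> real" where
  "flat n y = (if y \<le> 0 then 0 else (1 / y) ^ n * exp (- (1 / y)))"

lemma flat_nonneg: "0 \<le> flat n y"
  by (simp add: flat_def)

lemma flat_0_le_1: "flat 0 y \<le> 1"
  by (simp add: flat_def)

lemma flat_pos_iff: "0 < flat n y \<longleftrightarrow> 0 < y"
  by (simp add: flat_def)

lemma flat_eq_0_iff: "flat n y = 0 \<longleftrightarrow> y \<le> 0"
  by (simp add: flat_def)

text \<open>The term of degree n + m in the exponential series at 1/y alone gives the bound;
  \<open>m\<close> is free, so the decay at 0 is of every order.\<close>

lemma flat_le: "flat n y \<le> fact (n + m) * \<bar>y\<bar> ^ m"
proof (cases "y \<le> 0")
  case False
  then have t: "1 / y > 0" by simp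
  have "(1 / y) ^ (n + m) /\<^sub>R fact (n + m) \<le> exp (1 / y)"
    unfolding exp_def using t
    by (intro sum_le_suminf[of _ "{n + m}", simplified] summable_exp_generic) auto
  then have "(1 / y) ^ (n + m) / fact (n + m) \<le> exp (1 / y)"
    by (simp add: divide_inverse mult.commute)
  then have "(1 / y) ^ (n + m) \<le> fact (n + m) * exp (1 / y)"
    by (subst (asm) pos_divide_le_eq) (auto simp: mult.commute)
  then have "(1 / y) ^ (n + m) * exp (- (1 / y)) \<le> fact (n + m) * exp (1 / y) * exp (- (1 / y))"
    by (rule mult_right_mono) simp
  also have "\<dots> = fact (n + m)" by (simp add: mult.assoc flip: exp_add)
  finally have "(1 / y) ^ (n + m) * exp (- (1 / y)) \<le> fact (n + m)" .
  then have "(1 / y) ^ n * exp (- (1 / y)) \<le> fact (n + m) * y ^ m"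
    using False by (simp add: field_simps power_add)
  then show ?thesis using False by (simp add: flat_def)
qed (simp add: flat_def)

lemma flat_deriv: "(flat n has_real_derivative (- real n * flat (n + 1) y + flat (n + 2) y)) (at y)"
proof (cases y "0::real" rule: linorder_cases)
  case less
  have "(flat n has_real_derivative 0) (at y)"
    by (rule has_field_derivative_transform_within_open[OF DERIV_const[of 0], of "{..<0}"])
      (use less in \<open>auto simp: flat_def\<close>)
  then show ?thesis using less by (simp add: flat_def)
next
  case equal
  define K :: real where "K = fact (n + 2)"
  have "(\<lambda>h. flat n (0 + h) / h) \<midarrow>0\<rightarrow> 0"
  proof (rule Lim_null_comparison)
    show "\<forall>\<^sub>F h in at 0. norm (flat n (0 + h) / h) \<le> K * \<bar>h\<bar>"
    proof (rule eventually_at_topological[THEN iffD2], intro exI[of _ UNIV] conjI ballI impI)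
      fix h :: real assume "h \<noteq> 0"
      \<comment> \<open>Decay of order 2 makes the difference quotient at 0 of size at most a
        multiple of \<bar>h\<bar>.\<close>
      have "\<bar>flat n h\<bar> \<le> K * (\<bar>h\<bar> * \<bar>h\<bar>)"
        using flat_le[of n h 2] flat_nonneg[of n h] unfolding K_def power2_eq_square by simp
      then show "norm (flat n (0 + h) / h) \<le> K * \<bar>h\<bar>"
        using \<open>h \<noteq> 0\<close> by (simp add: pos_divide_le_eq mult.assoc)
    qed auto
    have "((\<lambda>h::real. K * \<bar>h\<bar>) \<longlongrightarrow> K * \<bar>0\<bar>) (at 0)"
      by (intro tendsto_intros)
    then show "((\<lambda>h::real. K * \<bar>h\<bar>) \<longlongrightarrow> 0) (at 0)" by simp
  qed
  then show ?thesis using equal by (simp add: DERIV_def flat_def)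
next
  case greater
  define t where "t = 1 / y"
  have "((\<lambda>y. 1 / y) has_real_derivative - (t * t)) (at y)"
    using greater by (auto intro!: derivative_eq_intros simp: t_def)
  note DERIV_mult[OF DERIV_power[OF this, of n] DERIV_fun_exp[OF DERIV_minus[OF this]],
      folded t_def]
  moreover have "real n * (- (t * t) * t ^ (n - Suc 0)) * exp (- t) + exp (- t) * - (- (t * t)) * t ^ n
      = - real n * t ^ (n + 1) * exp (- t) + t ^ (n + 2) * exp (- t)"
    by (cases n) (simp_all add: algebra_simps)
  ultimately have "((\<lambda>y. (1 / y) ^ n * exp (- (1 / y))) has_real_derivative
      (- real n * (1 / y) ^ (n + 1) * exp (- (1 / y)) + (1 / y) ^ (n + 2) * exp (- (1 / y)))) (at y)"
    unfolding t_def by (rule DERIV_cong)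
  moreover have "\<forall>\<^sub>F x in nhds y. (1 / x) ^ n * exp (- (1 / x)) = flat n x"
    using eventually_nhds_in_open[of "{0<..}" y] greater
    by (auto simp: flat_def elim!: eventually_mono)
  ultimately have "(flat n has_real_derivative
      (- real n * (1 / y) ^ (n + 1) * exp (- (1 / y)) + (1 / y) ^ (n + 2) * exp (- (1 / y)))) (at y)"
    by (subst (asm) DERIV_cong_ev[OF refl _ refl]) auto
  then show ?thesis using greater unfolding flat_def by (simp add: mult.assoc)
qed

text \<open>Differentiation replaces \<open>flat n\<close> by \<open>flat (n + 1)\<close> and
  \<open>flat (n + 2)\<close>, so the induction on \<open>k\<close> runs over all \<open>n\<close>
  simultaneously.\<close>

lemma C_times_flat:
  "(\<And>j. C_times j q) \<Longrightarrow> C_times k (\<lambda>x. flat n (q x))"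
proof (induction k arbitrary: n)
  case 0
  have "continuous_on UNIV (flat n)"
    by (intro continuous_at_imp_continuous_on ballI DERIV_isCont[OF flat_deriv])
  then show ?case using 0 C_times_imp_continuous continuous_on_compose2[of UNIV "flat n" UNIV q] by auto
next
  case (Suc k)
  have d: "((\<lambda>x. flat n (q x)) has_derivative
      (\<lambda>v. (- real n * flat (n + 1) (q x) + flat (n + 2) (q x)) * frechet_derivative q (at x) v)) (at x)" for x
  proof -
    have "(q has_derivative frechet_derivative q (at x)) (at x)"
      using Suc.prems[of 1] by (simp add: frechet_derivative_works)
    then show ?thesis
      using has_derivative_compose[of q "frechet_derivative q (at x)" x UNIV "flat n"]
        flat_deriv[of n "q x", unfolded has_field_derivative_def] by blast
  qed
  have "partial_deriv i (\<lambda>x. flat n (q x))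
      = (\<lambda>x. (- real n * flat (n + 1) (q x) + flat (n + 2) (q x)) * partial_deriv i q x)" for i
    by (rule ext, subst partial_deriv_eqI[OF d]) (simp add: partial_deriv_def)
  moreover have "C_times k (\<lambda>x. (- real n * flat (n + 1) (q x) + flat (n + 2) (q x)) * partial_deriv i q x)" for i
  proof -
    have "C_times k (partial_deriv i q)" using Suc.prems[of "Suc k"] by simp
    then show ?thesis by (intro C_times_mult C_times_add C_times_const Suc.IH Suc.prems)
  qed
  moreover have "(\<lambda>x. flat n (q x)) differentiable (at x)" for x
    using d by (auto simp: differentiable_def)
  ultimately show ?case by simp
qed

section \<open>Test functions and bumps on balls\<close>

lemma test_functionsI:
  assumes "\<And>k. C_times k \<phi>" "compact K" "K \<subseteq> D" "\<And>x. x \<notin> K \<Longrightarrow> \<phi> x = 0"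
  shows "\<phi> \<in> test_functions D"
proof -
  have "{x. \<phi> x \<noteq> 0} \<subseteq> K" using assms(4) by auto
  then have "closure {x. \<phi> x \<noteq> 0} \<subseteq> K" using assms(2) by (simp add: closure_minimal compact_imp_closed)
  then show ?thesis
    using assms compact_Int_closed[of K "closure {x. \<phi> x \<noteq> 0}"]
    by (auto simp: test_functions_def Int_absorb1)
qed

lemma test_functionsE:
  assumes "\<phi> \<in> test_functions D"
  obtains K where "compact K" "K \<subseteq> D" "\<And>x. x \<notin> K \<Longrightarrow> \<phi> x = 0" "\<And>k. C_times k \<phi>"
proof
  show "x \<notin> closure {x. \<phi> x \<noteq> 0} \<Longrightarrow> \<phi> x = 0" for x
    using closure_subset[of "{x. \<phi> x \<noteq> 0}"] by auto
qed (use assms in \<open>auto simp: test_functions_def\<close>)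

lemma test_functions_C: "\<phi> \<in> test_functions D \<Longrightarrow> C_times k \<phi>"
  by (simp add: test_functions_def)

lemma test_functions_differentiable: "\<phi> \<in> test_functions D \<Longrightarrow> \<phi> differentiable (at x)"
  using test_functions_C[of \<phi> D 1] by simp

lemma test_functions_continuous: "\<phi> \<in> test_functions D \<Longrightarrow> continuous_on UNIV \<phi>"
  using test_functions_C[of \<phi> D 0] by simp

lemma test_functions_mono: "D \<subseteq> E \<Longrightarrow> \<phi> \<in> test_functions D \<Longrightarrow> \<phi> \<in> test_functions E"
  by (auto simp: test_functions_def)

lemma test_functions_outside: "\<phi> \<in> test_functions D \<Longrightarrow> x \<notin> D \<Longrightarrow> \<phi> x = 0"
  by (metis subsetD test_functionsE)

lemma test_functions_smooth_combination:
  assumes "\<phi> \<in> test_functions D" "\<psi> \<in> test_functions D" "\<And>k. C_times k f"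
    "\<And>x. \<phi> x = 0 \<Longrightarrow> \<psi> x = 0 \<Longrightarrow> f x = 0"
  shows "f \<in> test_functions D"
proof -
  obtain K L where "compact K" "K \<subseteq> D" "\<And>x. x \<notin> K \<Longrightarrow> \<phi> x = 0"
    "compact L" "L \<subseteq> D" "\<And>x. x \<notin> L \<Longrightarrow> \<psi> x = 0"
    by (metis assms(1,2) test_functionsE)
  then show ?thesis using assms(3,4) by (intro test_functionsI[of _ "K \<union> L"]) auto
qed

lemma subspace_test_functions: "subspace (test_functions D)"
  unfolding subspace_def
proof (intro conjI ballI allI)
  show "0 \<in> test_functions D"
    by (rule test_functionsI[of _ "{}"]) (auto simp: zero_fun_def C_times_const)
  fix \<phi> \<psi> assume \<phi>: "\<phi> \<in> test_functions D" and "\<psi> \<in> test_functions D"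
  then show "\<phi> + \<psi> \<in> test_functions D"
    by (rule test_functions_smooth_combination)
      (auto simp: plus_fun_def intro: C_times_add test_functions_C \<phi> \<open>\<psi> \<in> _\<close>)
next
  fix c \<phi> assume \<phi>: "\<phi> \<in> test_functions D"
  show "c *\<^sub>R \<phi> \<in> test_functions D"
    by (rule test_functions_smooth_combination[OF \<phi> \<phi>])
      (auto simp: scaleR_fun_def intro: C_times_mult[OF C_times_const test_functions_C[OF \<phi>]])
qed

lemma partial_deriv_test_function:
  assumes "\<phi> \<in> test_functions D" shows "partial_deriv i \<phi> \<in> test_functions D"
proof -
  obtain K where K: "compact K" "K \<subseteq> D" "\<And>x. x \<notin> K \<Longrightarrow> \<phi> x = 0" "\<And>k. C_times k \<phi>"
    by (rule test_functionsE[OF assms]) blast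
  have "partial_deriv i \<phi> x = 0" if "x \<notin> K" for x
  proof -
    have "(\<phi> has_derivative (\<lambda>x. 0)) (at x)"
      by (rule has_derivative_transform_within_open[of "\<lambda>x. 0" _ _ _ "- K"])
        (use K that in \<open>auto simp: compact_imp_closed\<close>)
    then show ?thesis using partial_deriv_eqI by fastforce
  qed
  moreover have "C_times k (partial_deriv i \<phi>)" for k using K(4)[of "Suc k"] by simp
  ultimately show ?thesis using K by (intro test_functionsI) auto
qed

lemma test_functions_bounded:
  assumes "\<phi> \<in> test_functions D" shows "\<exists>C. \<forall>x. \<bar>\<phi> x\<bar> \<le> C"
proof -
  obtain K where K: "compact K" "\<And>x. x \<notin> K \<Longrightarrow> \<phi> x = 0"
    by (rule test_functionsE[OF assms]) blast
  have "bounded (\<phi> ` K)"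
    using K(1) test_functions_continuous[OF assms] 
    by (intro compact_imp_bounded compact_continuous_image) (auto intro: continuous_on_subset)
  then obtain C where "\<And>x. x \<in> K \<Longrightarrow> \<bar>\<phi> x\<bar> \<le> C" by (auto simp: bounded_iff)
  then have "\<bar>\<phi> x\<bar> \<le> max C 0" for x using K(2)[of x] by (cases "x \<in> K") (auto simp: le_max_iff_disj)
  then show ?thesis by blast
qed

lemma continuous_on_borel_lebesgue_on:
  fixes f :: "real^'d \<Rightarrow> 'b::euclidean_space"
  assumes "continuous_on UNIV f" shows "f \<in> borel_measurable (lebesgue_on D)"
  using borel_measurable_continuous_onI[OF assms]
  by (intro measurable_restrict_space1 measurable_completion) simp

lemma test_functions_L2:
  assumes "\<phi> \<in> test_functions E" "D \<in> lmeasurable" shows "\<phi> \<in> L2 D"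
proof -
  obtain C where "\<And>x. \<bar>\<phi> x\<bar> \<le> C" using test_functions_bounded[OF assms(1)] by blast
  then show ?thesis
    using assms by (intro L2_bounded[of _ _ C])
      (auto intro: continuous_on_borel_lebesgue_on test_functions_continuous)
qed

lemma flat_test_function:
  assumes "\<And>k. C_times k q" "compact K" "K \<subseteq> D" "\<And>x. q x > 0 \<Longrightarrow> x \<in> K"
  shows "(\<lambda>x. flat 0 (q x)) \<in> test_functions D"
  using assms by (intro test_functionsI[of _ K] C_times_flat) (auto simp: flat_eq_0_iff not_less[symmetric])

text \<open>\<open>r\<^sup>2 - (dist x p)\<^sup>2\<close> is a polynomial in the coordinates and
  therefore smooth also at the centre, where the distance itself is not.\<close>

definition ball_bump :: "real^'d \<Rightarrow> real \<Rightarrow> real^'d \<Rightarrow> real" where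
  "ball_bump p r x = flat 0 (r\<^sup>2 - (dist x p)\<^sup>2)"

lemma ball_bump_nonneg: "0 \<le> ball_bump p r x"
  by (simp add: ball_bump_def flat_nonneg)

lemma ball_bump_pos_iff: "r > 0 \<Longrightarrow> 0 < ball_bump p r x \<longleftrightarrow> x \<in> ball p r"
  unfolding ball_bump_def flat_pos_iff
  by (auto simp: dist_commute intro: power_strict_mono power_less_imp_less_base[of _ 2])

lemma ball_bump_test:
  assumes "r > 0" "cball p r \<subseteq> D"
  shows "ball_bump p r \<in> test_functions D"
proof -
  have eq: "r\<^sup>2 - (dist x p)\<^sup>2 = r\<^sup>2 + (-1) * (\<Sum>i\<in>UNIV. (x $ i + (- (p $ i))) * (x $ i + (- (p $ i))))" for x
    by (simp add: dist_norm power2_norm_eq_inner inner_vec_def)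
  have "C_times k (\<lambda>x. r\<^sup>2 - (dist x p)\<^sup>2)" for k
    unfolding eq
    by (intro C_times_add C_times_mult C_times_sum C_times_const C_times_nth)
  moreover have "r\<^sup>2 - (dist x p)\<^sup>2 > 0 \<Longrightarrow> x \<in> cball p r" for x
    using assms(1) by (simp add: dist_commute) (metis abs_le_square_iff abs_of_nonneg abs_of_pos less_imp_le zero_le_dist)
  ultimately show ?thesis
    unfolding ball_bump_def[abs_def] using assms by (intro flat_test_function[of _ "cball p r"]) auto
qed

section \<open>Maps that scale Lebesgue measure\<close>

lemma nn_integral_lborel_translate:
  fixes f :: "'a::euclidean_space \<Rightarrow> ennreal"
  assumes [measurable]: "f \<in> borel_measurable borel"
  shows "(\<integral>\<^sup>+x. f (x + t) \<partial>lborel) = (\<integral>\<^sup>+x. f x \<partial>lborel)"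
  by (subst (2) lborel_distr_plus[of t, symmetric])
    (simp add: nn_integral_distr add.commute)

lemma nn_integral_lborel_reflect:
  fixes f :: "'a::euclidean_space \<Rightarrow> ennreal"
  assumes [measurable]: "f \<in> borel_measurable borel"
  shows "(\<integral>\<^sup>+x. f (t - x) \<partial>lborel) = (\<integral>\<^sup>+x. f x \<partial>lborel)"
  by (subst (2) lborel_affine[of "-1" t])
    (simp_all add: nn_integral_distr nn_integral_density)

text \<open>Uniqueness of translation invariant measures, in the form needed for the push-forward of
  Lebesgue measure under a linear isomorphism.  The argument avoids determinants, which the library
  only treats for well-ordered index types.\<close>
lemma nn_integral_linear_swap:
  fixes T :: "'a::euclidean_space \<Rightarrow> 'a" and f g :: "'a \<Rightarrow> ennreal"
  assumes T: "linear T" "bij T"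
    and [measurable]: "f \<in> borel_measurable borel" "g \<in> borel_measurable borel"
  shows "(\<integral>\<^sup>+x. f (T x) \<partial>lborel) * (\<integral>\<^sup>+y. g y \<partial>lborel)
       = (\<integral>\<^sup>+x. f x \<partial>lborel) * (\<integral>\<^sup>+y. g (T y) \<partial>lborel)"
proof -
  have [measurable]: "T \<in> borel_measurable borel"
    using T(1) by (intro borel_measurable_continuous_onI linear_continuous_on)
      (simp add: linear_conv_bounded_linear)
  obtain S where S: "\<And>x. T (S x) = x" using T(2) by (metis bij_pointE)
  have "(\<integral>\<^sup>+x. f (T x) \<partial>lborel) * (\<integral>\<^sup>+y. g y \<partial>lborel)
      = (\<integral>\<^sup>+y. \<integral>\<^sup>+x. f (T x) * g y \<partial>lborel \<partial>lborel)"
    by (simp add: nn_integral_cmult nn_integral_multc)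
  \<comment> \<open>Shifting x by \<open>S y\<close>, then y by \<open>T x\<close>, and finally
    reflecting x moves \<open>T\<close> from \<open>f\<close> to \<open>g\<close>.\<close>
  also have "\<dots> = (\<integral>\<^sup>+y. \<integral>\<^sup>+x. f (T x + y) * g y \<partial>lborel \<partial>lborel)"
  proof (rule nn_integral_cong)
    fix y
    have "(\<integral>\<^sup>+x. f (T x) * g y \<partial>lborel) = (\<integral>\<^sup>+x. f (T (x + S y)) * g y \<partial>lborel)"
      by (rule nn_integral_lborel_translate[symmetric]) measurable
    then show "(\<integral>\<^sup>+x. f (T x) * g y \<partial>lborel) = (\<integral>\<^sup>+x. f (T x + y) * g y \<partial>lborel)"
      using T(1) S by (simp add: linear_add)
  qed
  also have "\<dots> = (\<integral>\<^sup>+x. \<integral>\<^sup>+y. f (T x + y) * g y \<partial>lborel \<partial>lborel)"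
    by (rule lborel_pair.Fubini') measurable
  also have "\<dots> = (\<integral>\<^sup>+x. \<integral>\<^sup>+y. f y * g (y - T x) \<partial>lborel \<partial>lborel)"
  proof (rule nn_integral_cong)
    fix x
    have "(\<integral>\<^sup>+y. f (y + T x) * g ((y + T x) - T x) \<partial>lborel) = (\<integral>\<^sup>+y. f y * g (y - T x) \<partial>lborel)"
      by (rule nn_integral_lborel_translate) measurable
    then show "(\<integral>\<^sup>+y. f (T x + y) * g y \<partial>lborel) = (\<integral>\<^sup>+y. f y * g (y - T x) \<partial>lborel)"
      by (simp add: add.commute)
  qed
  also have "\<dots> = (\<integral>\<^sup>+y. \<integral>\<^sup>+x. f y * g (y - T x) \<partial>lborel \<partial>lborel)"
    by (rule lborel_pair.Fubini'[symmetric]) measurable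
  also have "\<dots> = (\<integral>\<^sup>+y. f y * (\<integral>\<^sup>+x. g (T x) \<partial>lborel) \<partial>lborel)"
  proof (rule nn_integral_cong)
    fix y
    have "(\<integral>\<^sup>+x. g (T (S y - x)) \<partial>lborel) = (\<integral>\<^sup>+x. g (T x) \<partial>lborel)"
      by (rule nn_integral_lborel_reflect) measurable
    then have "(\<integral>\<^sup>+x. g (y - T x) \<partial>lborel) = (\<integral>\<^sup>+x. g (T x) \<partial>lborel)"
      using T(1) S by (simp add: linear_diff)
    then show "(\<integral>\<^sup>+x. f y * g (y - T x) \<partial>lborel) = f y * (\<integral>\<^sup>+x. g (T x) \<partial>lborel)"
      by (simp add: nn_integral_cmult)
  qed
  also have "\<dots> = (\<integral>\<^sup>+x. f x \<partial>lborel) * (\<integral>\<^sup>+y. g (T y) \<partial>lborel)"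
    by (simp add: nn_integral_multc)
  finally show ?thesis .
qed

text \<open>A set has \<open>c\<close> times the measure of its preimage; for linear \<phi> the
  constant is thus the absolute value of the determinant.\<close>

definition scales_lebesgue :: "('a::euclidean_space \<Rightarrow> 'a) \<Rightarrow> real \<Rightarrow> bool" where
  "scales_lebesgue \<phi> c \<longleftrightarrow> inj \<phi> \<and> c > 0 \<and> \<phi> \<in> lebesgue \<rightarrow>\<^sub>M lebesgue \<and>
     lebesgue = density (distr lebesgue lebesgue \<phi>) (\<lambda>_. ennreal c)"

text \<open>The swap identity with the unit ball as second test set shows that the measures of a
  Borel set and of its preimage have a ratio independent of the set. In particular preimages of null
  sets are null, which lets the identity pass to the completed measure.\<close>

lemma scales_lebesgue_linear:
  fixes T :: "'a::euclidean_space \<Rightarrow> 'a"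
  assumes T: "linear T" "bij T"
  shows "\<exists>c. scales_lebesgue T c"
proof -
  have [measurable]: "T \<in> borel_measurable borel"
    using T(1) by (intro borel_measurable_continuous_onI linear_continuous_on)
      (simp add: linear_conv_bounded_linear)
  have cT: "continuous_on UNIV T"
    using T(1) by (intro linear_continuous_on) (simp add: linear_conv_bounded_linear)
  let ?B = "ball (0::'a) 1"
  define p where "p = measure lborel ?B"
  have p: "emeasure lborel ?B = ennreal p" "p > 0"
    using content_ball_pos[of 1 "0::'a"] emeasure_bounded_finite[of ?B]
    by (auto simp: p_def emeasure_eq_ennreal_measure)
  have inv: "T -` ?B = inv T ` ?B" using bij_vimage_eq_inv_image[OF T(2)] .
  have linv: "linear (inv T)" using T by (simp add: inj_linear_imp_inv_linear bij_is_inj)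
  have bd: "bounded (T -` ?B)" unfolding inv
    using linv by (intro bounded_linear_image) (auto simp: linear_conv_bounded_linear)
  have op: "open (T -` ?B)" using cT open_vimage by blast
  have "0 \<in> T -` ?B" using T(1) by (simp add: linear_0)
  then have ne: "T -` ?B \<noteq> {}" by blast
  define q where "q = measure lborel (T -` ?B)"
  have fin: "emeasure lborel (T -` ?B) < \<infinity>" by (rule emeasure_bounded_finite[OF bd])
  have q: "emeasure lborel (T -` ?B) = ennreal q"
    using fin by (simp add: q_def emeasure_eq_ennreal_measure)
  have "q > 0"
  proof -
    obtain x r where "r > 0" "ball x r \<subseteq> T -` ?B" using op ne open_contains_ball by blast
    then have "emeasure lborel (ball x r) \<le> emeasure lborel (T -` ?B)"
      using op by (intro emeasure_mono) auto
    then have "emeasure lborel (T -` ?B) \<noteq> 0"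
      using content_ball_pos[OF \<open>r > 0\<close>, of x] by (auto simp: measure_def)
    then show ?thesis using q by (cases "q > 0") (auto simp: ennreal_neg)
  qed
  define c where "c = p / q"
  have c: "c > 0" using p \<open>q > 0\<close> by (simp add: c_def)
  have em: "emeasure lborel A = ennreal c * emeasure lborel (T -` A)" if [measurable]: "A \<in> sets borel" for A
  proof -
    have [measurable]: "T -` A \<in> sets borel" using measurable_sets[of T borel borel A] by simp
    have [measurable]: "T -` ?B \<in> sets borel" using op by auto
    have "(\<integral>\<^sup>+x. indicator A (T x) \<partial>lborel) * (\<integral>\<^sup>+y. indicator ?B y \<partial>lborel)
       = (\<integral>\<^sup>+x. indicator A x \<partial>lborel) * (\<integral>\<^sup>+y. indicator ?B (T y) \<partial>lborel)"
      by (rule nn_integral_linear_swap[OF T]; intro borel_measurable_indicator)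
        (auto intro: that borel_open)
    moreover have "indicator A (T x) = (indicator (T -` A) x :: ennreal)" for A x
      by (auto simp: indicator_def)
    ultimately have eq: "emeasure lborel (T -` A) * ennreal p = emeasure lborel A * ennreal q"
      using p q by simp
    have "emeasure lborel A = emeasure lborel A * (ennreal q * ennreal (1/q))"
      using \<open>q > 0\<close> by (simp flip: ennreal_mult)
    also have "\<dots> = emeasure lborel (T -` A) * (ennreal p * ennreal (1/q))"
      using eq by (simp add: mult.assoc[symmetric])
    also have "ennreal p * ennreal (1/q) = ennreal c"
      using p \<open>q > 0\<close> by (simp add: c_def flip: ennreal_mult)
    finally show ?thesis by (simp add: mult.commute)
  qed
  have lb: "lborel = density (distr lborel borel T) (\<lambda>_. ennreal c)"
  proof (rule measure_eqI)
    fix A :: "'a set" assume "A \<in> sets lborel"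
    then show "emeasure lborel A = emeasure (density (distr lborel borel T) (\<lambda>_. ennreal c)) A"
      using em[of A] by (simp add: emeasure_density nn_integral_cmult emeasure_distr)
  qed simp
  have null: "null_sets (distr lborel lborel T) = null_sets lborel"
    using em c by (auto simp: null_sets_def emeasure_distr)
  have meas: "T \<in> lebesgue \<rightarrow>\<^sub>M lebesgue"
  proof (rule completion.measurable_completion2)
    show "T \<in> lebesgue \<rightarrow>\<^sub>M lborel" by (rule measurable_completion) simp
    show "null_sets lborel \<subseteq> null_sets (distr lebesgue lborel T)"
    proof
      fix A :: "'a set" assume A: "A \<in> null_sets lborel"
      then have "emeasure lborel (T -` A) = 0"
        using em[of A] c by (auto simp: null_sets_def)
      moreover have "T -` A \<in> sets borel"
        using A measurable_sets[of T borel borel A] by (auto simp: null_sets_def)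
      ultimately show "A \<in> null_sets (distr lebesgue lborel T)"
        using A measurable_completion[of T lborel borel]
        by (auto simp: null_sets_def emeasure_distr)
    qed
  qed
  have "lebesgue = density (distr lebesgue lebesgue T) (\<lambda>_. ennreal c)"
  proof (rule measure_eqI)
    fix A :: "'a set" assume A: "A \<in> sets lebesgue"
    have 1: "emeasure lebesgue A = emeasure lborel (main_part lborel A)"
      using A by (simp add: emeasure_completion)
    have 2: "T -` main_part lborel A \<in> sets borel"
      using measurable_sets[of T borel borel "main_part lborel A"] main_part_sets[OF A] by simp
    obtain N where N: "N \<in> null_sets lborel" "null_part lborel A \<subseteq> N"
      using null_part[OF A] by auto
    have "emeasure lborel (T -` N) = 0" using em[of N] N c by (auto simp: null_sets_def)
    moreover have "T -` N \<in> sets borel"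
      using N measurable_sets[of T borel borel N] by (auto simp: null_sets_def)
    ultimately have N0: "T -` N \<in> null_sets lborel" by (auto simp: null_sets_def)
    have "T -` A = T -` main_part lborel A \<union> T -` null_part lborel A"
      using main_part_null_part_Un[OF A] by blast
    moreover have "T -` null_part lborel A \<in> null_sets lebesgue"
      using N0 N(2) null_sets_completion_subset[of "T -` null_part lborel A" "T -` N" lborel]
      by (auto simp: null_sets_completionI)
    ultimately have "emeasure lebesgue (T -` A) = emeasure lborel (T -` main_part lborel A)"
      using 2 by (simp add: emeasure_Un_null_set)
    then have "emeasure lebesgue A = ennreal c * emeasure lebesgue (T -` A)"
      using 1 em main_part_sets[OF A] by simp
    then show "emeasure lebesgue A = emeasure (density (distr lebesgue lebesgue T) (\<lambda>_. ennreal c)) A"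
      using A meas by (simp add: emeasure_density nn_integral_cmult emeasure_distr)
  qed simp
  then show ?thesis
    unfolding scales_lebesgue_def using c meas T(2) by (auto intro!: exI[of _ c] simp: bij_is_inj)
qed

lemma scales_lebesgue_translation: "scales_lebesgue (\<lambda>x::'a::euclidean_space. x + t) 1"
proof -
  have eq: "(\<lambda>x. t + (\<Sum>j\<in>Basis. (1 * (x \<bullet> j)) *\<^sub>R j)) = (\<lambda>x::'a. x + t)"
    by (simp add: euclidean_representation add.commute)
  show ?thesis
    unfolding scales_lebesgue_def
    using lebesgue_affine_measurable[of "\<lambda>_::'a. 1" t] lebesgue_affine_euclidean[of "\<lambda>_::'a. 1" t]
    unfolding eq by (auto simp: inj_on_def)
qed

context
  fixes \<phi> :: "'a::euclidean_space \<Rightarrow> 'a" and c :: real and D :: "'a set"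
  assumes \<phi>: "scales_lebesgue \<phi> c" and D: "D \<in> sets lebesgue" "\<phi> ` D \<in> sets lebesgue"
begin

lemma measurable_compose_scaling:
  "f \<in> borel_measurable (lebesgue_on (\<phi> ` D)) \<Longrightarrow> (\<lambda>x. f (\<phi> x)) \<in> borel_measurable (lebesgue_on D)"
proof (rule measurable_compose[of \<phi> _ "lebesgue_on (\<phi> ` D)"])
  show "\<phi> \<in> lebesgue_on D \<rightarrow>\<^sub>M lebesgue_on (\<phi> ` D)"
    using \<phi> by (intro measurable_restrict_space3) (auto simp: scales_lebesgue_def)
qed

lemma
  fixes f :: "'a \<Rightarrow> 'b::{banach,second_countable_topology}"
  assumes f: "f \<in> borel_measurable (lebesgue_on (\<phi> ` D))"
  shows integrable_scaling: "integrable (lebesgue_on (\<phi> ` D)) f \<longleftrightarrow> integrable (lebesgue_on D) (\<lambda>x. f (\<phi> x))"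
    and integral_scaling: "integral\<^sup>L (lebesgue_on (\<phi> ` D)) f = c *\<^sub>R integral\<^sup>L (lebesgue_on D) (\<lambda>x. f (\<phi> x))"
proof -
  have [measurable]: "\<phi> \<in> lebesgue \<rightarrow>\<^sub>M lebesgue" and c: "c > 0" and "inj \<phi>"
    and leb: "lebesgue = density (distr lebesgue lebesgue \<phi>) (\<lambda>_. ennreal c)"
    using \<phi> by (auto simp: scales_lebesgue_def)
  define g where "g = (\<lambda>x. indicator (\<phi> ` D) x *\<^sub>R f x)"
  have g[measurable]: "g \<in> borel_measurable lebesgue"
    using f D unfolding g_def by (subst (asm) borel_measurable_restrict_space_iff) auto
  have gphi: "g (\<phi> x) = indicator D x *\<^sub>R f (\<phi> x)" for x
    using \<open>inj \<phi>\<close> by (auto simp: g_def indicator_def inj_on_def)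
  have "integrable (lebesgue_on (\<phi> ` D)) f \<longleftrightarrow> integrable lebesgue g"
    using D by (simp add: integrable_restrict_space g_def)
  also have "\<dots> \<longleftrightarrow> integrable (density (distr lebesgue lebesgue \<phi>) (\<lambda>_. ennreal c)) g"
    using leb by simp
  also have "\<dots> \<longleftrightarrow> integrable lebesgue (\<lambda>x. c *\<^sub>R g (\<phi> x))"
    using c by (subst integrable_density) (auto simp: integrable_distr_eq)
  also have "\<dots> \<longleftrightarrow> integrable lebesgue (\<lambda>x. indicator D x *\<^sub>R f (\<phi> x))"
  proof
    assume "integrable lebesgue (\<lambda>x. c *\<^sub>R g (\<phi> x))"
    then have "integrable lebesgue (\<lambda>x. (1 / c) *\<^sub>R (c *\<^sub>R g (\<phi> x)))"
      by (rule integrable_scaleR_right)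
    then show "integrable lebesgue (\<lambda>x. indicator D x *\<^sub>R f (\<phi> x))" using c by (simp add: gphi)
  next
    assume "integrable lebesgue (\<lambda>x. indicator D x *\<^sub>R f (\<phi> x))"
    then show "integrable lebesgue (\<lambda>x. c *\<^sub>R g (\<phi> x))"
      unfolding gphi by (rule integrable_scaleR_right)
  qed
  finally show "integrable (lebesgue_on (\<phi> ` D)) f \<longleftrightarrow> integrable (lebesgue_on D) (\<lambda>x. f (\<phi> x))"
    using D by (simp add: integrable_restrict_space)
  have "integral\<^sup>L (lebesgue_on (\<phi> ` D)) f = integral\<^sup>L lebesgue g"
    using D by (simp add: integral_restrict_space g_def)
  also have "\<dots> = integral\<^sup>L (density (distr lebesgue lebesgue \<phi>) (\<lambda>_. ennreal c)) g"
    using leb by simp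
  also have "\<dots> = integral\<^sup>L lebesgue (\<lambda>x. c *\<^sub>R g (\<phi> x))"
    using c by (subst integral_density) (auto simp: integral_distr)
  also have "\<dots> = c *\<^sub>R integral\<^sup>L lebesgue (\<lambda>x. indicator D x *\<^sub>R f (\<phi> x))"
    unfolding gphi by (rule integral_scaleR_right)
  finally show "integral\<^sup>L (lebesgue_on (\<phi> ` D)) f = c *\<^sub>R integral\<^sup>L (lebesgue_on D) (\<lambda>x. f (\<phi> x))"
    using D by (simp add: integral_restrict_space)
qed

end

lemma
  assumes \<phi>: "scales_lebesgue \<phi> c" and D: "D \<in> sets lebesgue" "\<phi> ` D \<in> sets lebesgue"
    and u: "u \<in> L2 (\<phi> ` D)"
  shows L2_scaling: "(\<lambda>x. u (\<phi> x)) \<in> L2 D"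
    and L2_inner_scaling: "v \<in> L2 (\<phi> ` D) \<Longrightarrow>
      L2_inner (\<phi> ` D) u v = c * L2_inner D (\<lambda>x. u (\<phi> x)) (\<lambda>x. v (\<phi> x))"
proof -
  have m: "(\<lambda>x. (norm (u x))\<^sup>2) \<in> borel_measurable (lebesgue_on (\<phi> ` D))"
    using L2_measurable[OF u] by measurable
  show "(\<lambda>x. u (\<phi> x)) \<in> L2 D"
    using measurable_compose_scaling[OF \<phi> D L2_measurable[OF u]] integrable_scaling[OF \<phi> D m]
      L2_integrable[OF u] by (simp add: L2_def)
  assume v: "v \<in> L2 (\<phi> ` D)"
  have "(\<lambda>x. u x \<bullet> v x) \<in> borel_measurable (lebesgue_on (\<phi> ` D))"
    using L2_measurable[OF u] L2_measurable[OF v] by measurable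
  from integral_scaling[OF \<phi> D this]
  show "L2_inner (\<phi> ` D) u v = c * L2_inner D (\<lambda>x. u (\<phi> x)) (\<lambda>x. v (\<phi> x))"
    by (simp add: L2_inner_def)
qed

section \<open>Density of test functions\<close>

lemma L2_cong:
  assumes "\<And>x. x \<in> D \<Longrightarrow> f x = g x" shows "f \<in> L2 D \<longleftrightarrow> g \<in> L2 D"
proof -
  have "f \<in> borel_measurable (lebesgue_on D) \<longleftrightarrow> g \<in> borel_measurable (lebesgue_on D)"
    using assms by (intro measurable_cong) (simp add: space_restrict_space)
  moreover have "integrable (lebesgue_on D) (\<lambda>x. (norm (f x))\<^sup>2) \<longleftrightarrow> integrable (lebesgue_on D) (\<lambda>x. (norm (g x))\<^sup>2)"
    using assms by (intro Bochner_Integration.integrable_cong) (auto simp: space_restrict_space)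
  ultimately show ?thesis by (simp add: L2_def)
qed

lemma L2_inner_cong:
  assumes "\<And>x. x \<in> D \<Longrightarrow> f x = f' x" "\<And>x. x \<in> D \<Longrightarrow> g x = g' x"
  shows "L2_inner D f g = L2_inner D f' g'"
  unfolding L2_inner_def using assms
  by (intro Bochner_Integration.integral_cong) (auto simp: space_restrict_space)

definition test_closure :: "(real^'d) set \<Rightarrow> (real^'d \<Rightarrow> real) set" where
  "test_closure D = {f \<in> L2 D. \<forall>e>0. \<exists>\<psi>\<in>test_functions D. L2_inner D (f - \<psi>) (f - \<psi>) < e}"

lemma test_closureD: "f \<in> test_closure D \<Longrightarrow> f \<in> L2 D"
  by (simp add: test_closure_def)

lemma test_closure_closed:
  assumes D: "D \<in> lmeasurable" and f: "f \<in> L2 D"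
    and g: "\<And>e. e > 0 \<Longrightarrow> \<exists>g\<in>test_closure D. L2_inner D (f - g) (f - g) < e"
  shows "f \<in> test_closure D"
proof -
  have "\<exists>\<psi>\<in>test_functions D. L2_inner D (f - \<psi>) (f - \<psi>) < e" if "e > 0" for e
  proof -
    obtain g where g: "g \<in> test_closure D" "L2_inner D (f - g) (f - g) < e / 4"
      using g[of "e / 4"] \<open>e > 0\<close> by auto
    then obtain \<psi> where \<psi>: "\<psi> \<in> test_functions D" "L2_inner D (g - \<psi>) (g - \<psi>) < e / 4"
      using \<open>e > 0\<close> unfolding test_closure_def by (auto dest!: spec[of _ "e / 4"])
    have "L2_inner D ((f - g) + (g - \<psi>)) ((f - g) + (g - \<psi>)) < e"
      using L2.sq_add_le[of "f - g" D "g - \<psi>"] f test_closureD[OF g(1)]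
        test_functions_L2[OF \<psi>(1) D] g(2) \<psi>(2) by (simp add: L2.V_diff)
    then show ?thesis using \<psi>(1) by auto
  qed
  then show ?thesis using f by (simp add: test_closure_def)
qed

lemma subspace_test_closure:
  assumes D: "D \<in> lmeasurable" shows "subspace (test_closure D)"
  unfolding subspace_def
proof (intro conjI ballI allI)
  show "0 \<in> test_closure D"
    using subspace_0[OF subspace_test_functions[of D]] L2.V_zero[of D]
    by (auto simp: test_closure_def L2.zero intro!: bexI[of _ 0])
  fix f g assume f: "f \<in> test_closure D" and g: "g \<in> test_closure D"
  show "f + g \<in> test_closure D"
    unfolding test_closure_def
  proof (intro CollectI conjI allI impI)
    show "f + g \<in> L2 D" using f g by (auto intro: L2.V_add test_closureD)
    fix e :: real assume "e > 0"
    then obtain \<phi> \<psi> where 1: "\<phi> \<in> test_functions D" "L2_inner D (f - \<phi>) (f - \<phi>) < e / 4"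
      "\<psi> \<in> test_functions D" "L2_inner D (g - \<psi>) (g - \<psi>) < e / 4"
      using f g unfolding test_closure_def by (auto dest!: spec[of _ "e / 4"])
    have "L2_inner D ((f - \<phi>) + (g - \<psi>)) ((f - \<phi>) + (g - \<psi>)) < e"
      using L2.sq_add_le[of "f - \<phi>" D "g - \<psi>"] f g 1 test_functions_L2[OF _ D]
      by (auto simp: L2.V_diff test_closureD)
    moreover have "(f - \<phi>) + (g - \<psi>) = (f + g) - (\<phi> + \<psi>)" by simp
    ultimately show "\<exists>\<psi>\<in>test_functions D. L2_inner D (f + g - \<psi>) (f + g - \<psi>) < e"
      using subspace_add[OF subspace_test_functions 1(1,3)] by metis
  qed
next
  fix f c assume f: "f \<in> test_closure D"
  show "c *\<^sub>R f \<in> test_closure D"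
    unfolding test_closure_def
  proof (intro CollectI conjI allI impI)
    show "c *\<^sub>R f \<in> L2 D" using f by (auto intro: L2.V_scale test_closureD)
    fix e :: real assume e: "e > 0"
    then obtain \<phi> where 1: "\<phi> \<in> test_functions D" "L2_inner D (f - \<phi>) (f - \<phi>) < e / (c\<^sup>2 + 1)"
      using f unfolding test_closure_def by (auto dest!: spec[of _ "e / (c\<^sup>2 + 1)"] simp: add_nonneg_pos)
    have V: "f - \<phi> \<in> L2 D" using f 1 test_functions_L2[OF _ D] by (auto intro: L2.V_diff test_closureD)
    have "c\<^sup>2 * L2_inner D (f - \<phi>) (f - \<phi>) \<le> c\<^sup>2 * (e / (c\<^sup>2 + 1))"
      using 1 by (intro mult_left_mono) auto
    also have "\<dots> < e"
    proof -
      have "0 < c\<^sup>2 + 1" by (simp add: add_nonneg_pos)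
      then show ?thesis using e by (simp add: pos_divide_less_eq algebra_simps)
    qed
    finally have "L2_inner D (c *\<^sub>R (f - \<phi>)) (c *\<^sub>R (f - \<phi>)) < e"
      using V by (simp add: L2.sq_scale)
    then show "\<exists>\<psi>\<in>test_functions D. L2_inner D (c *\<^sub>R f - \<psi>) (c *\<^sub>R f - \<psi>) < e"
      using subspace_scale[OF subspace_test_functions 1(1), of c]
      by (auto simp: scaleR_diff_right)
  qed
qed

lemma L2_indicator:
  assumes "D \<in> lmeasurable" "A \<in> sets lebesgue"
  shows "indicator A \<in> (L2 D :: (real^'d \<Rightarrow> real) set)"
proof (rule L2_bounded[of _ _ 1])
  show "indicator A \<in> borel_measurable (lebesgue_on D)"
    using assms(2) by (intro measurable_restrict_space1 borel_measurable_indicator)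
qed (use assms in \<open>auto simp: indicator_def\<close>)

lemma L2_sq_diff_indicator:
  fixes A B :: "(real^'d) set"
  assumes "D \<in> lmeasurable" "A \<in> sets lebesgue" "B \<in> sets lebesgue" "A \<subseteq> D" "B \<subseteq> D"
  shows "L2_inner D (indicator A - indicator B :: _ \<Rightarrow> real) (indicator A - indicator B)
       = measure lebesgue (A - B) + measure lebesgue (B - A)"
proof -
  have fin: "A - B \<in> lmeasurable" "B - A \<in> lmeasurable"
    by (rule bounded_set_imp_lmeasurable fmeasurableI2[OF assms(1)]; use assms in auto)+
  have eq: "indicator D x *\<^sub>R ((norm ((indicator A - indicator B :: _ \<Rightarrow> real) x))\<^sup>2)
      = indicator (A - B) x + (indicator (B - A) x :: real)" for x
    using assms by (auto simp: indicator_def)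
  have "L2_inner D (indicator A - indicator B :: _ \<Rightarrow> real) (indicator A - indicator B)
      = (LINT x|lebesgue. indicator D x *\<^sub>R ((norm ((indicator A - indicator B :: _ \<Rightarrow> real) x))\<^sup>2))"
    unfolding L2_inner_eq_norm using assms by (subst integral_restrict_space) auto
  also have "\<dots> = (LINT x|lebesgue. indicator (A - B) x + (indicator (B - A) x :: real))"
    by (simp only: eq)
  also have "\<dots> = measure lebesgue (A - B) + measure lebesgue (B - A)"
    using fin by (subst Bochner_Integration.integral_add) (auto simp: fmeasurable_def)
  finally show ?thesis .
qed

text \<open>By regularity \<open>A\<close> differs little from a compact subset \<open>K\<close>,
  and \<open>K\<close> little from an open set \<open>U\<close> around it. Finitely many balls
  inside both \<open>U\<close> and \<open>D\<close> cover \<open>K\<close>, and the indicator of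
  their union is a pointwise limit of test functions.\<close>

lemma indicator_in_test_closure:
  fixes A :: "(real^'d) set"
  assumes D: "open D" "bounded D" and A: "A \<in> sets lebesgue" "A \<subseteq> D"
  shows "(indicator A :: _ \<Rightarrow> real) \<in> test_closure D"
proof -
  have Dm: "D \<in> lmeasurable" using D by (simp add: lmeasurable_open)
  show ?thesis
  proof (rule test_closure_closed[OF Dm L2_indicator[OF Dm A(1)]])
    fix e :: real assume e: "e > 0"
    obtain K where K: "closed K" "K \<subseteq> A" "A - K \<in> lmeasurable" "emeasure lebesgue (A - K) < ennreal (e/2)"
      using sets_lebesgue_inner_closed[OF A(1), of "e/2"] e by auto
    have cK: "compact K"
      using K A D bounded_subset compact_eq_bounded_closed by (metis subset_trans)
    obtain U where U: "open U" "K \<subseteq> U" "U - K \<in> lmeasurable" "emeasure lebesgue (U - K) < ennreal (e/2)"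
      using sets_lebesgue_outer_open[of K "e/2"] e cK by (auto simp: lmeasurable_compact fmeasurableD)
    have "\<forall>x\<in>K. \<exists>r>0. cball x r \<subseteq> U \<inter> D"
      using K A U D open_contains_cball[of "U \<inter> D"] by (meson IntI open_Int subsetD)
    then obtain r where r: "\<And>x. x \<in> K \<Longrightarrow> r x > 0" "\<And>x. x \<in> K \<Longrightarrow> cball x (r x) \<subseteq> U \<inter> D" by metis
    obtain P where P: "P \<subseteq> K" "finite P" "K \<subseteq> (\<Union>x\<in>P. ball x (r x))"
      using compactE_image[OF cK, of K "\<lambda>x. ball x (r x)"] r(1) by force
    define \<sigma> where "\<sigma> x = (\<Sum>p\<in>P. ball_bump p (r p) x)" for x
    define Q where "Q = {x. \<sigma> x > 0}"
    have C: "C_times k \<sigma>" for k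
    proof -
      have "ball_bump p (r p) \<in> test_functions D" if "p \<in> P" for p
        using that P r by (intro ball_bump_test) blast+
      then show ?thesis
        unfolding \<sigma>_def[abs_def] by (intro C_times_sum) (rule test_functions_C)
    qed
    have \<sigma>0: "\<sigma> x \<ge> 0" for x unfolding \<sigma>_def by (intro sum_nonneg ball_bump_nonneg)
    have Q: "x \<in> Q \<longleftrightarrow> (\<exists>p\<in>P. x \<in> ball p (r p))" for x
    proof -
      have "x \<in> Q \<longleftrightarrow> \<sigma> x \<noteq> 0" using \<sigma>0[of x] by (auto simp: Q_def)
      also have "\<dots> \<longleftrightarrow> (\<exists>p\<in>P. ball_bump p (r p) x \<noteq> 0)"
        unfolding \<sigma>_def using P(2) by (subst sum_nonneg_eq_0_iff) (auto intro: ball_bump_nonneg)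
      also have "\<dots> \<longleftrightarrow> (\<exists>p\<in>P. x \<in> ball p (r p))"
        using ball_bump_pos_iff[of "r _"] P r(1) ball_bump_nonneg by (metis less_irrefl order_le_less subsetD)
      finally show ?thesis .
    qed
    have QU: "Q \<subseteq> U \<inter> D" "K \<subseteq> Q" using Q r P by force+
    have Qo: "open Q"
    proof -
      have "Q = (\<Union>p\<in>P. ball p (r p))" using Q by auto
      then show ?thesis by auto
    qed
    \<comment> \<open>On \<open>Q\<close> the values are exp (-1 / (m \<sigma>)) for positive m and
      tend to 1; elsewhere they are 0. All lie in [0, 1], so convergence is dominated.\<close>
    define \<psi> where "\<psi> m x = flat 0 (real m * \<sigma> x)" for m x
    have \<psi>t: "\<psi> m \<in> test_functions D" for m
      unfolding \<psi>_def[abs_def]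
    proof (rule flat_test_function[of _ "\<Union>p\<in>P. cball p (r p)"])
      show "C_times k (\<lambda>x. real m * \<sigma> x)" for k by (intro C_times_mult C_times_const C)
      show "compact (\<Union>p\<in>P. cball p (r p))" using P by auto
      show "(\<Union>p\<in>P. cball p (r p)) \<subseteq> D" using P r by blast
      show "x \<in> (\<Union>p\<in>P. cball p (r p))" if "real m * \<sigma> x > 0" for x
      proof -
        have "x \<in> Q" using that \<sigma>0[of x] by (simp add: Q_def zero_less_mult_iff)
        then obtain p where "p \<in> P" "x \<in> ball p (r p)" using Q by blast
        then show ?thesis using ball_subset_cball by blast
      qed
    qed
    have Qm: "Q \<in> sets lebesgue" using Qo by auto
    have conv: "(\<lambda>m. L2_inner D (indicator Q - \<psi> m) (indicator Q - \<psi> m)) \<longlonglongrightarrow> (LINT x|lebesgue_on D. 0)"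
      unfolding L2_inner_eq_norm
    proof (rule integral_dominated_convergence[where w="\<lambda>_. 1"])
      show "integrable (lebesgue_on D) (\<lambda>_. 1::real)"
        using L2_imp_integrable[OF L2_const Dm, of 1] Dm by simp
      show "(\<lambda>x. (norm ((indicator Q - \<psi> m) x))\<^sup>2) \<in> borel_measurable (lebesgue_on D)" for m
        using L2_integrable[OF L2.V_diff[OF L2_indicator[OF Dm Qm] test_functions_L2[OF \<psi>t Dm]]]
        by (rule borel_measurable_integrable)
      have "(\<lambda>m. (norm ((indicator Q - \<psi> m) x))\<^sup>2) \<longlonglongrightarrow> 0" for x
      proof (cases "x \<in> Q")
        case True
        then have s: "\<sigma> x > 0" by (simp add: Q_def)
        have "(\<lambda>m. \<psi> m x) \<longlonglongrightarrow> 1"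
        proof -
          have "(\<lambda>m. exp (- (1 / \<sigma> x) * (1 / real m))) \<longlonglongrightarrow> exp (- (1 / \<sigma> x) * 0)"
            by (intro tendsto_intros lim_1_over_n)
          moreover have "\<forall>\<^sub>F m in sequentially. exp (- (1 / \<sigma> x) * (1 / real m)) = \<psi> m x"
            using eventually_gt_at_top[of "0::nat"]
            by (rule eventually_mono) (use s in \<open>auto simp: \<psi>_def flat_def mult_le_0_iff field_simps\<close>)
          ultimately have "(\<lambda>m. \<psi> m x) \<longlonglongrightarrow> exp (- (1 / \<sigma> x) * 0)"
            by (rule Lim_transform_eventually)
          then show ?thesis by simp
        qed
        then have "(\<lambda>m. (norm (1 - \<psi> m x))\<^sup>2) \<longlonglongrightarrow> (norm (1 - 1::real))\<^sup>2"
          by (intro tendsto_intros)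
        then show ?thesis using True by simp
      next
        case False
        then have "\<psi> m x = 0" for m using \<sigma>0[of x] by (simp add: Q_def \<psi>_def flat_eq_0_iff)
        then show ?thesis using False by simp
      qed
      then show "AE x in lebesgue_on D. (\<lambda>m. (norm ((indicator Q - \<psi> m) x))\<^sup>2) \<longlonglongrightarrow> 0" by simp
      have "norm ((norm ((indicator Q - \<psi> m) x))\<^sup>2) \<le> 1" for m x
      proof -
        have "0 \<le> \<psi> m x" "\<psi> m x \<le> 1" by (simp_all add: \<psi>_def flat_nonneg flat_0_le_1)
        then have "\<bar>indicator Q x - \<psi> m x\<bar> \<le> 1" by (simp add: indicator_def)
        then show ?thesis by (simp add: abs_square_le_1)
      qed
      then show "AE x in lebesgue_on D. norm ((norm ((indicator Q - \<psi> m) x))\<^sup>2) \<le> 1" for m by simp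
    qed simp
    have Qc: "indicator Q \<in> test_closure D"
      unfolding test_closure_def
    proof (intro CollectI conjI allI impI L2_indicator Dm Qm)
      fix d :: real assume "d > 0"
      then obtain m where "L2_inner D (indicator Q - \<psi> m) (indicator Q - \<psi> m) < d"
        using order_tendstoD(2)[OF conv, of d] by (auto simp: eventually_sequentially)
      then show "\<exists>\<psi>\<in>test_functions D. L2_inner D (indicator Q - \<psi>) (indicator Q - \<psi>) < d"
        using \<psi>t by blast
    qed
    have "L2_inner D (indicator A - indicator Q :: _ \<Rightarrow> real) (indicator A - indicator Q)
        = measure lebesgue (A - Q) + measure lebesgue (Q - A)"
      using QU A Qm by (intro L2_sq_diff_indicator Dm) auto
    also have "measure lebesgue (A - Q) \<le> measure lebesgue (A - K)"
      using QU A Qm K(3) by (intro measure_mono_fmeasurable) auto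
    also have "measure lebesgue (Q - A) \<le> measure lebesgue (U - K)"
      using QU A K Qm U(3) by (intro measure_mono_fmeasurable) auto
    also have "measure lebesgue (A - K) < e/2"
      using K(3,4) e by (simp add: emeasure_eq_measure2 ennreal_less_iff)
    also have "measure lebesgue (U - K) < e/2"
      using U(3,4) e by (simp add: emeasure_eq_measure2 ennreal_less_iff)
    finally show "\<exists>g\<in>test_closure D. L2_inner D (indicator A - g) (indicator A - g) < e"
      using Qc by (intro bexI[of _ "indicator Q"]) auto
  qed
qed

lemma test_closure_cong:
  assumes "\<And>x. x \<in> D \<Longrightarrow> f x = g x" shows "f \<in> test_closure D \<longleftrightarrow> g \<in> test_closure D"
proof -
  have "L2_inner D (f - \<psi>) (f - \<psi>) = L2_inner D (g - \<psi>) (g - \<psi>)" for \<psi>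
    using assms by (intro L2_inner_cong) auto
  then show ?thesis using L2_cong[of D f g] assms by (simp add: test_closure_def)
qed

lemma test_functions_dense:
  assumes D: "open D" "bounded D" and f: "f \<in> L2 D"
  shows "f \<in> test_closure D"
proof -
  have Dm: "D \<in> lmeasurable" using D by (simp add: lmeasurable_open)
  then have Ds: "D \<in> sets lebesgue" by auto
  obtain s where s: "\<And>i. simple_function (lebesgue_on D) (s i)"
    "\<And>x. x \<in> D \<Longrightarrow> (\<lambda>i. s i x) \<longlonglongrightarrow> f x"
    "\<And>i x. x \<in> D \<Longrightarrow> \<bar>s i x\<bar> \<le> 2 * \<bar>f x\<bar>"
    using borel_measurable_implies_sequence_metric[OF L2_measurable[OF f], of 0]
    by (simp add: space_restrict_space dist_real_def) metis
  have sc: "s i \<in> test_closure D" for i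
  proof -
    let ?A = "\<lambda>y. s i -` {y} \<inter> D"
    let ?g = "\<Sum>y\<in>s i ` D. y *\<^sub>R (indicator (?A y) :: _ \<Rightarrow> real)"
    have fin: "finite (s i ` D)" and "\<And>y. ?A y \<in> sets (lebesgue_on D)"
      using s(1)[of i] simple_functionD[OF s(1), of i] by (auto simp: space_restrict_space simple_function_def)
    then have "?A y \<in> sets lebesgue" for y
      using Ds by (auto simp: sets_restrict_space_iff)
    then have "?g \<in> test_closure D"
      by (intro subspace_sum[OF subspace_test_closure[OF Dm]]
          subspace_scale[OF subspace_test_closure[OF Dm]] indicator_in_test_closure D) auto
    moreover have "s i x = ?g x" if "x \<in> D" for x
    proof -
      have "?g x = (\<Sum>y\<in>s i ` D. if y = s i x then y else 0)"
        unfolding sum_fun_apply using that by (intro sum.cong) auto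
      then show ?thesis using fin that by simp
    qed
    ultimately show ?thesis using test_closure_cong[of D "s i" ?g] by blast
  qed
  have conv: "(\<lambda>i. L2_inner D (f - s i) (f - s i)) \<longlonglongrightarrow> (LINT x|lebesgue_on D. 0)"
    unfolding L2_inner_eq_norm
  \<comment> \<open>The simple functions are bounded by twice \<bar>f\<bar>, hence the differences
    by three times \<bar>f\<bar>, which gives the factor 9 after squaring.\<close>
  proof (rule integral_dominated_convergence[where w="\<lambda>x. 9 * (norm (f x))\<^sup>2"])
    show "integrable (lebesgue_on D) (\<lambda>x. 9 * (norm (f x))\<^sup>2)"
      using L2_integrable[OF f] by simp
    show "(\<lambda>x. (norm ((f - s i) x))\<^sup>2) \<in> borel_measurable (lebesgue_on D)" for i
      using L2_integrable[OF L2.V_diff[OF f test_closureD[OF sc]]]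
      by (rule borel_measurable_integrable)
    show "AE x in lebesgue_on D. (\<lambda>i. (norm ((f - s i) x))\<^sup>2) \<longlonglongrightarrow> 0"
    proof (rule AE_I2)
      fix x assume "x \<in> space (lebesgue_on D)"
      then have "(\<lambda>i. (norm (f x - s i x))\<^sup>2) \<longlonglongrightarrow> (norm (f x - f x))\<^sup>2"
        by (intro tendsto_intros s(2)) (simp add: space_restrict_space)
      then show "(\<lambda>i. (norm ((f - s i) x))\<^sup>2) \<longlonglongrightarrow> 0" by simp
    qed
    show "AE x in lebesgue_on D. norm ((norm ((f - s i) x))\<^sup>2) \<le> 9 * (norm (f x))\<^sup>2" for i
    proof (rule AE_I2)
      fix x assume "x \<in> space (lebesgue_on D)"
      then have "\<bar>f x - s i x\<bar> \<le> \<bar>3 * f x\<bar>"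
        using s(3)[of x i] by (simp add: space_restrict_space abs_mult)
      then have "(f x - s i x)\<^sup>2 \<le> (3 * f x)\<^sup>2" by (rule abs_le_square_iff[THEN iffD1])
      then show "norm ((norm ((f - s i) x))\<^sup>2) \<le> 9 * (norm (f x))\<^sup>2"
        by (simp add: power_mult_distrib)
    qed
  qed simp
  show ?thesis
  proof (rule test_closure_closed[OF Dm f])
    fix e :: real assume "e > 0"
    then obtain i where "L2_inner D (f - s i) (f - s i) < e"
      using order_tendstoD(2)[OF conv, of e] by (auto simp: eventually_sequentially)
    then show "\<exists>g\<in>test_closure D. L2_inner D (f - g) (f - g) < e" using sc by blast
  qed
qed

text \<open>Norm by duality: \<open>f\<close> is itself a limit of test functions, so that the bound
  may be tested with \<open>f\<close>. The case C = 0 gives uniqueness of weak gradients; another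
  choice of \<open>C\<close> gives the difference quotient estimate.\<close>

lemma L2_bound_by_test_functions:
  assumes D: "open D" "bounded D" and f: "f \<in> L2 D" and C: "C \<ge> 0"
    and bound: "\<And>\<psi>. \<psi> \<in> test_functions D \<Longrightarrow> L2_inner D f \<psi> \<le> C * sqrt (L2_inner D \<psi> \<psi>)"
  shows "L2_inner D f f \<le> C\<^sup>2"
proof -
  have Dm: "D \<in> lmeasurable" using D by (simp add: lmeasurable_open)
  have "\<exists>\<psi>\<in>test_functions D. L2_inner D (\<psi> - f) (\<psi> - f) < 1 / Suc n" for n
  proof -
    obtain \<psi> where \<psi>: "\<psi> \<in> test_functions D" "L2_inner D (f - \<psi>) (f - \<psi>) < 1 / Suc n"
      using test_functions_dense[OF D f] unfolding test_closure_def by (auto dest!: spec[of _ "1 / Suc n"])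
    moreover have "L2_inner D (f - \<psi>) (f - \<psi>) = L2_inner D (\<psi> - f) (\<psi> - f)"
      by (simp add: L2_inner_eq_norm power2_commute)
    ultimately show ?thesis by auto
  qed
  then obtain \<psi> where \<psi>: "\<And>n. \<psi> n \<in> test_functions D"
    "\<And>n. L2_inner D (\<psi> n - f) (\<psi> n - f) < 1 / Suc n" by metis
  have \<psi>2: "\<psi> n \<in> L2 D" for n using \<psi>(1) Dm by (rule test_functions_L2)
  have lim: "(\<lambda>n. L2_inner D (\<psi> n - f) (\<psi> n - f)) \<longlonglongrightarrow> 0"
  proof (rule tendsto_sandwich[OF _ _ tendsto_const])
    show "(\<lambda>n. 1 / real (Suc n)) \<longlonglongrightarrow> 0" using LIMSEQ_inverse_real_of_nat by (simp add: inverse_eq_divide)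
    show "\<forall>\<^sub>F n in sequentially. 0 \<le> L2_inner D (\<psi> n - f) (\<psi> n - f)"
      using \<psi>2 f by (auto intro!: always_eventually L2.nonneg L2.V_diff)
    show "\<forall>\<^sub>F n in sequentially. L2_inner D (\<psi> n - f) (\<psi> n - f) \<le> 1 / real (Suc n)"
      using \<psi>(2) by (auto intro!: always_eventually less_imp_le)
  qed
  have "L2_inner D f f \<le> C * sqrt (L2_inner D f f)"
  proof (rule LIMSEQ_le)
    show "(\<lambda>n. L2_inner D (\<psi> n) f) \<longlonglongrightarrow> L2_inner D f f"
      by (rule L2.tendsto_inner[OF \<psi>2 f f lim])
    show "(\<lambda>n. C * sqrt (L2_inner D (\<psi> n) (\<psi> n))) \<longlonglongrightarrow> C * sqrt (L2_inner D f f)"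
      by (intro tendsto_intros L2.tendsto_sq[OF \<psi>2 f lim])
    show "\<exists>N. \<forall>n\<ge>N. L2_inner D (\<psi> n) f \<le> C * sqrt (L2_inner D (\<psi> n) (\<psi> n))"
      using bound[OF \<psi>(1)] L2.sym[OF f \<psi>2] by metis
  qed
  then have *: "sqrt (L2_inner D f f) * sqrt (L2_inner D f f) \<le> C * sqrt (L2_inner D f f)"
    using L2.nonneg[OF f] by simp
  then have "sqrt (L2_inner D f f) \<le> C"
  proof (cases "L2_inner D f f = 0")
    case False
    then have "sqrt (L2_inner D f f) > 0" using L2.nonneg[OF f] by simp
    then show ?thesis using * by (simp only: mult_le_cancel_right_pos)
  qed (use C in auto)
  then show ?thesis using L2.nonneg[OF f] C by (metis sqrt_le_D)
qed

section \<open>Weak gradients\<close>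

lemma L2_component:
  fixes g :: "real^'d \<Rightarrow> real^'d"
  assumes "g \<in> L2 D" shows "(\<lambda>x. h \<bullet> g x) \<in> L2 D"
    and "L2_inner D (\<lambda>x. h \<bullet> g x) (\<lambda>x. h \<bullet> g x) \<le> (norm h)\<^sup>2 * L2_inner D g g"
proof -
  have m: "(\<lambda>x. h \<bullet> g x) \<in> borel_measurable (lebesgue_on D)"
    using L2_measurable[OF assms] by measurable
  have le: "(norm (h \<bullet> g x))\<^sup>2 \<le> (norm h)\<^sup>2 * (norm (g x))\<^sup>2" for x
    using power_mono[OF Cauchy_Schwarz_ineq2[of h "g x"], of 2] by (simp add: power_mult_distrib)
  have i: "integrable (lebesgue_on D) (\<lambda>x. (norm h)\<^sup>2 * (norm (g x))\<^sup>2)"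
    using L2_integrable[OF assms] by simp
  have i2: "integrable (lebesgue_on D) (\<lambda>x. (norm (h \<bullet> g x))\<^sup>2)"
    using m le by (intro Bochner_Integration.integrable_bound[OF i]) auto
  then show "(\<lambda>x. h \<bullet> g x) \<in> L2 D" using m by (simp add: L2_def)
  have "(LINT x|lebesgue_on D. (norm (h \<bullet> g x))\<^sup>2) \<le> (LINT x|lebesgue_on D. (norm h)\<^sup>2 * (norm (g x))\<^sup>2)"
    using le by (intro integral_mono i i2)
  then show "L2_inner D (\<lambda>x. h \<bullet> g x) (\<lambda>x. h \<bullet> g x) \<le> (norm h)\<^sup>2 * L2_inner D g g"
    by (simp add: L2_inner_eq_norm)
qed

lemma L2_nth:
  fixes g :: "real^'d \<Rightarrow> real^'d"
  assumes "g \<in> L2 D" shows "(\<lambda>x. g x $ i) \<in> L2 D"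
  using L2_component(1)[OF assms, of "axis i 1"] by (simp add: inner_axis' )

lemma L2_inner_sum_left:
  fixes f :: "'i \<Rightarrow> real^'d \<Rightarrow> real"
  assumes "finite I" "\<And>i. i \<in> I \<Longrightarrow> f i \<in> L2 D" "v \<in> L2 D"
  shows "L2_inner D (\<lambda>x. \<Sum>i\<in>I. c i * f i x) v = (\<Sum>i\<in>I. c i * L2_inner D (f i) v)"
proof -
  have "(\<lambda>x. \<Sum>i\<in>I. c i * f i x) = (\<Sum>i\<in>I. c i *\<^sub>R f i)" by (simp add: fun_eq_iff sum_fun_apply)
  then show ?thesis using L2.sum_scale_left[OF assms] by simp
qed

lemma L2_vector_inner_eq_sum:
  fixes g h :: "real^'d \<Rightarrow> real^'d"
  assumes "g \<in> L2 D" "h \<in> L2 D"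
  shows "L2_inner D g h = (\<Sum>i\<in>UNIV. L2_inner D (\<lambda>x. g x $ i) (\<lambda>x. h x $ i))"
  unfolding L2_inner_def inner_vec_def
  using L2_integrable_inner[OF L2_nth[OF assms(1)] L2_nth[OF assms(2)]]
  by (simp add: Bochner_Integration.integral_sum)

lemma L2_vecI:
  fixes g :: "real^'d \<Rightarrow> real^'d"
  assumes "\<And>i. (\<lambda>x. g x $ i) \<in> L2 D" shows "g \<in> L2 D"
proof -
  have "g \<in> borel_measurable (lebesgue_on D)"
    using assms L2_measurable
    by (subst borel_measurable_euclidean_space) (auto simp: Basis_vec_def inner_axis)
  moreover have "(norm (g x))\<^sup>2 = (\<Sum>i\<in>UNIV. (norm (g x $ i))\<^sup>2)" for x
    unfolding power2_norm_eq_inner inner_vec_def by simp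
  then have "integrable (lebesgue_on D) (\<lambda>x. (norm (g x))\<^sup>2)"
    using assms L2_integrable by (simp only:) (intro Bochner_Integration.integrable_sum, blast)
  ultimately show ?thesis by (simp add: L2_def)
qed

lemma has_weak_grad_iff:
  "has_weak_grad D u g \<longleftrightarrow> (\<forall>\<phi>\<in>test_functions D. \<forall>i.
     L2_inner D u (partial_deriv i \<phi>) = - L2_inner D (\<lambda>x. g x $ i) \<phi>)"
  by (simp add: has_weak_grad_def L2_inner_def)

lemma has_weak_gradD:
  "\<lbrakk>has_weak_grad D u g; \<phi> \<in> test_functions D\<rbrakk>
    \<Longrightarrow> L2_inner D u (partial_deriv i \<phi>) = - L2_inner D (\<lambda>x. g x $ i) \<phi>"
  by (simp add: has_weak_grad_iff)

lemma has_weak_grad_unique: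
  assumes D: "open D" "bounded D" and gh: "g \<in> L2 D" "h \<in> L2 D"
    and "has_weak_grad D u g" "has_weak_grad D u h"
  shows "AE x in lebesgue_on D. g x = h x"
proof -
  have Dm: "D \<in> lmeasurable" using D by (simp add: lmeasurable_open)
  have "AE x in lebesgue_on D. g x $ i = h x $ i" for i
  proof -
    let ?f = "(\<lambda>x. g x $ i) - (\<lambda>x. h x $ i)"
    have f: "?f \<in> L2 D" by (intro L2.V_diff L2_nth gh)
    have "L2_inner D ?f ?f \<le> 0\<^sup>2"
    proof (rule L2_bound_by_test_functions[OF D f order_refl])
      fix \<psi> assume \<psi>: "\<psi> \<in> test_functions D"
      have "L2_inner D ?f \<psi> = L2_inner D (\<lambda>x. g x $ i) \<psi> - L2_inner D (\<lambda>x. h x $ i) \<psi>"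
        by (intro L2.diff L2_nth gh test_functions_L2[OF \<psi> Dm])
      also have "\<dots> = 0" using has_weak_gradD[OF assms(5) \<psi>, of i] has_weak_gradD[OF assms(6) \<psi>, of i] by simp
      finally show "L2_inner D ?f \<psi> \<le> 0 * sqrt (L2_inner D \<psi> \<psi>)" by simp
    qed
    then have "L2_inner D ?f ?f = 0" using L2.nonneg[OF f] by simp
    then have "AE x in lebesgue_on D. ?f x = 0" using L2_inner_self_eq_0_iff[OF f] by blast
    then show ?thesis by simp
  qed
  then have "AE x in lebesgue_on D. \<forall>i. g x $ i = h x $ i" by (simp add: AE_all_countable)
  then show ?thesis by (simp add: vec_eq_iff)
qed

lemma H1_L2: "u \<in> H1 D \<Longrightarrow> u \<in> L2 D"
  by (simp add: H1_def)

lemma weak_grad_works: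
  assumes "u \<in> H1 D"
  shows weak_grad_L2: "weak_grad D u \<in> L2 D" and has_weak_grad_weak_grad: "has_weak_grad D u (weak_grad D u)"
proof -
  have "\<exists>g. g \<in> L2 D \<and> has_weak_grad D u g" using assms by (auto simp: H1_def)
  from someI_ex[OF this] show "weak_grad D u \<in> L2 D" "has_weak_grad D u (weak_grad D u)"
    by (auto simp: weak_grad_def)
qed

lemma H1I: "\<lbrakk>u \<in> L2 D; g \<in> L2 D; has_weak_grad D u g\<rbrakk> \<Longrightarrow> u \<in> H1 D"
  by (auto simp: H1_def)

lemma weak_grad_AE_eq:
  assumes "open D" "bounded D" "u \<in> L2 D" "g \<in> L2 D" "has_weak_grad D u g"
  shows "AE x in lebesgue_on D. weak_grad D u x = g x"
  using assms weak_grad_works[OF H1I[OF assms(3-5)]] by (intro has_weak_grad_unique) auto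

definition grad_inner :: "(real^'d) set \<Rightarrow> (real^'d \<Rightarrow> real) \<Rightarrow> (real^'d \<Rightarrow> real) \<Rightarrow> real" where
  "grad_inner D u v = L2_inner D (weak_grad D u) (weak_grad D v)"

text \<open>The chosen \<open>weak_grad\<close> is determined only up to null sets; this lets any
  known weak gradient take its place.\<close>

lemma grad_inner_eq:
  assumes D: "open D" "bounded D"
    and "u \<in> L2 D" "g \<in> L2 D" "has_weak_grad D u g" "v \<in> L2 D" "h \<in> L2 D" "has_weak_grad D v h"
  shows "grad_inner D u v = L2_inner D g h"
  unfolding grad_inner_def
  by (rule L2_inner_cong_AE)
    (use assms in \<open>auto intro!: weak_grad_AE_eq weak_grad_L2 H1I[of u D g] H1I[of v D h]\<close>)

lemma has_weak_grad_add:
  assumes D: "D \<in> lmeasurable" and "u \<in> L2 D" "g \<in> L2 D" "v \<in> L2 D" "h \<in> L2 D"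
    and "has_weak_grad D u g" "has_weak_grad D v h"
  shows "has_weak_grad D (u + v) (g + h)"
  unfolding has_weak_grad_iff
proof (intro ballI allI)
  fix \<phi> i assume \<phi>: "\<phi> \<in> test_functions D"
  have eq: "(\<lambda>x. (g + h) x $ i) = (\<lambda>x. g x $ i) + (\<lambda>x. h x $ i)" by (simp add: fun_eq_iff)
  show "L2_inner D (u + v) (partial_deriv i \<phi>) = - L2_inner D (\<lambda>x. (g + h) x $ i) \<phi>"
    unfolding eq using has_weak_gradD[OF assms(6) \<phi>, of i] has_weak_gradD[OF assms(7) \<phi>, of i]
      L2.add[OF assms(2,4) test_functions_L2[OF partial_deriv_test_function[OF \<phi>] D], of i]
      L2.add[OF L2_nth[OF assms(3)] L2_nth[OF assms(5)] test_functions_L2[OF \<phi> D], of i i]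
    by simp
qed

lemma has_weak_grad_scale:
  assumes D: "D \<in> lmeasurable" and "u \<in> L2 D" "g \<in> L2 D" "has_weak_grad D u g"
  shows "has_weak_grad D (c *\<^sub>R u) (c *\<^sub>R g)"
  unfolding has_weak_grad_iff
proof (intro ballI allI)
  fix \<phi> i assume \<phi>: "\<phi> \<in> test_functions D"
  have eq: "(\<lambda>x. (c *\<^sub>R g) x $ i) = c *\<^sub>R (\<lambda>x. g x $ i)" by (simp add: fun_eq_iff)
  show "L2_inner D (c *\<^sub>R u) (partial_deriv i \<phi>) = - L2_inner D (\<lambda>x. (c *\<^sub>R g) x $ i) \<phi>"
    unfolding eq using has_weak_gradD[OF assms(4) \<phi>, of i]
      L2.scale[OF assms(2) test_functions_L2[OF partial_deriv_test_function[OF \<phi>] D], of c i]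
      L2.scale[OF L2_nth[OF assms(3)] test_functions_L2[OF \<phi> D], of c i]
    by simp
qed

lemma subspace_H1:
  assumes D: "D \<in> lmeasurable" shows "subspace (H1 D)"
  unfolding subspace_def
proof (intro conjI ballI allI)
  show "0 \<in> H1 D"
    by (rule H1I[of _ _ 0]) (auto simp: L2.V_zero has_weak_grad_def)
  fix u v assume "u \<in> H1 D" "v \<in> H1 D"
  then show "u + v \<in> H1 D"
    using weak_grad_works has_weak_grad_add[OF D] by (meson H1I H1_L2 L2.V_add)
next
  fix c u assume "u \<in> H1 D"
  then show "c *\<^sub>R u \<in> H1 D"
    using weak_grad_works has_weak_grad_scale[OF D] by (meson H1I H1_L2 L2.V_scale)
qed

lemma semi_inner_grad:
  assumes D: "open D" "bounded D" shows "semi_inner (H1 D) (grad_inner D)"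
proof
  have Dm: "D \<in> lmeasurable" using D by (simp add: lmeasurable_open)
  then show "subspace (H1 D)" by (rule subspace_H1)
  fix u v w c assume u: "u \<in> H1 D"
  note U = H1_L2[OF u] weak_grad_works[OF u]
  show "0 \<le> grad_inner D u u" unfolding grad_inner_def by (rule L2.nonneg[OF U(2)])
  assume v: "v \<in> H1 D"
  note V = H1_L2[OF v] weak_grad_works[OF v]
  show "grad_inner D u v = grad_inner D v u" unfolding grad_inner_def by (rule L2.sym[OF U(2) V(2)])
  show "grad_inner D (c *\<^sub>R u) v = c * grad_inner D u v"
    using grad_inner_eq[OF D L2.V_scale[OF U(1)] L2.V_scale[OF U(2)] has_weak_grad_scale[OF Dm U] V]
    by (simp add: L2.scale U V grad_inner_def)
  assume w: "w \<in> H1 D"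
  note W = H1_L2[OF w] weak_grad_works[OF w]
  show "grad_inner D (u + v) w = grad_inner D u w + grad_inner D v w"
    using grad_inner_eq[OF D L2.V_add[OF U(1) V(1)] L2.V_add[OF U(2) V(2)]
        has_weak_grad_add[OF Dm U(1,2) V(1,2) U(3) V(3)] W]
    by (simp add: L2.add U V W grad_inner_def)
qed

section \<open>Integration by parts and difference quotients\<close>

lemma has_real_derivative_along_line:
  fixes \<psi> :: "real^'d \<Rightarrow> real"
  assumes "\<And>x. \<psi> differentiable (at x)"
  shows "((\<lambda>s. \<psi> (y - s *\<^sub>R h)) has_real_derivative
           - (\<Sum>i\<in>UNIV. h $ i * partial_deriv i \<psi> (y - s *\<^sub>R h))) (at s)"
proof -
  have "((\<lambda>s. y - s *\<^sub>R h) has_derivative (\<lambda>s. - (s *\<^sub>R h))) (at s)"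
    by (auto intro!: derivative_eq_intros)
  from diff_chain_at[OF this has_derivative_partial_deriv[OF assms]]
  have "((\<lambda>s. \<psi> (y - s *\<^sub>R h)) has_derivative
      (\<lambda>v. \<Sum>i\<in>UNIV. (- (v *\<^sub>R h)) $ i * partial_deriv i \<psi> (y - s *\<^sub>R h))) (at s)"
    by (simp add: comp_def)
  moreover have "(\<lambda>v. \<Sum>i\<in>UNIV. (- (v *\<^sub>R h)) $ i * partial_deriv i \<psi> (y - s *\<^sub>R h))
      = (*) (- (\<Sum>i\<in>UNIV. h $ i * partial_deriv i \<psi> (y - s *\<^sub>R h)))"
    by (auto simp: sum_distrib_left sum_distrib_right fun_eq_iff sum_negf mult_ac)
  ultimately show ?thesis by (simp add: has_field_derivative_def)
qed

lemma sum_axis_mult: "(\<Sum>j\<in>UNIV. axis i 1 $ j * f j) = (f i :: real)"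
proof -
  have "axis i 1 $ j * f j = (if j = i then f i else 0)" for j by (simp add: axis_def)
  then show ?thesis by simp
qed

lemma partial_deriv_shift:
  fixes \<psi> :: "real^'d \<Rightarrow> real"
  assumes "\<And>x. \<psi> differentiable (at x)"
  shows "partial_deriv i (\<lambda>x. \<psi> (x + b)) x = partial_deriv i \<psi> (x + b)"
proof -
  have "((\<lambda>x. x + b) has_derivative (\<lambda>v. v)) (at x)" by (auto intro!: derivative_eq_intros)
  from diff_chain_at[OF this has_derivative_partial_deriv[OF assms]]
  have "((\<lambda>x. \<psi> (x + b)) has_derivative (\<lambda>v. \<Sum>i\<in>UNIV. v $ i * partial_deriv i \<psi> (x + b))) (at x)"
    by (simp add: comp_def)
  from partial_deriv_eqI[OF this, of i] show ?thesis by (simp only: sum_axis_mult)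
qed

lemma test_functions_shift:
  fixes \<psi> :: "real^'d \<Rightarrow> real"
  assumes \<psi>: "\<psi> \<in> test_functions W" and sub: "\<And>x. x \<in> W \<Longrightarrow> x - b \<in> D"
  shows "(\<lambda>x. \<psi> (x + b)) \<in> test_functions D"
proof -
  obtain K where K: "compact K" "K \<subseteq> W" "\<And>x. x \<notin> K \<Longrightarrow> \<psi> x = 0" "\<And>k. C_times k \<psi>"
    by (rule test_functionsE[OF \<psi>]) blast
  show ?thesis
  proof (rule test_functionsI[of _ "(\<lambda>x. x - b) ` K"])
    show "C_times k (\<lambda>x. \<psi> (x + b))" for k
      using C_times_affine[OF K(4), of k "mat 1" b] by simp
    show "compact ((\<lambda>x. x - b) ` K)"
      using K(1) by (intro compact_continuous_image continuous_intros)
    show "(\<lambda>x. x - b) ` K \<subseteq> D" using sub K(2) by auto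
    show "\<psi> (x + b) = 0" if "x \<notin> (\<lambda>x. x - b) ` K" for x
    proof (rule K(3))
      show "x + b \<notin> K"
      proof
        assume "x + b \<in> K"
        then have "(x + b) - b \<in> (\<lambda>x. x - b) ` K" by (rule imageI)
        then show False using that by simp
      qed
    qed
  qed
qed

text \<open>Differentiation under the integral sign. The parameter occurs in the smooth factor
  alone, whose difference quotients are bounded by a bound \<open>M\<close> of its directional
  derivative, so a multiple of \<bar>w\<bar> dominates.\<close>

lemma shifted_integral_has_derivative:
  fixes \<psi> w :: "real^'d \<Rightarrow> real"
  assumes \<psi>: "\<psi> \<in> test_functions E" and w: "integrable (lebesgue_on D) w"
  shows "((\<lambda>t. LINT y|lebesgue_on D. w y * \<psi> (y - t *\<^sub>R h)) has_real_derivative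
     - (LINT y|lebesgue_on D. w y * (\<Sum>i\<in>UNIV. h $ i * partial_deriv i \<psi> (y - t *\<^sub>R h)))) (at t)"
proof -
  let ?F = "\<lambda>t. LINT y|lebesgue_on D. w y * \<psi> (y - t *\<^sub>R h)"
  define q where "q x = (\<Sum>i\<in>UNIV. h $ i * partial_deriv i \<psi> x)" for x
  note diff = test_functions_differentiable[OF \<psi>]
  have contq: "continuous_on UNIV q"
    unfolding q_def using partial_deriv_test_function[OF \<psi>]
    by (intro continuous_intros test_functions_continuous)
  have wm: "w \<in> borel_measurable (lebesgue_on D)" using w by auto
  have mshift: "(\<lambda>y. f (y - s *\<^sub>R h)) \<in> borel_measurable (lebesgue_on D)"
    if "continuous_on UNIV f" for f :: "real^'d \<Rightarrow> real" and s
    by (intro continuous_on_borel_lebesgue_on continuous_on_compose2[OF that] continuous_intros) auto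
  obtain M where M: "\<And>x. \<bar>q x\<bar> \<le> M"
  proof -
    have "\<exists>C. \<forall>x. \<bar>partial_deriv i \<psi> x\<bar> \<le> C" for i
      using test_functions_bounded[OF partial_deriv_test_function[OF \<psi>]] .
    then obtain C where C: "\<And>i x. \<bar>partial_deriv i \<psi> x\<bar> \<le> C i" by metis
    have "\<bar>q x\<bar> \<le> (\<Sum>i\<in>UNIV. \<bar>h $ i\<bar> * C i)" for x
      unfolding q_def
      by (rule order_trans[OF sum_abs]) (auto simp: abs_mult intro!: sum_mono mult_left_mono C)
    then show ?thesis by (rule that)
  qed
  obtain B where B: "\<And>x. \<bar>\<psi> x\<bar> \<le> B" using test_functions_bounded[OF \<psi>] by blast
  have int: "integrable (lebesgue_on D) (\<lambda>y. w y * \<psi> (y - s *\<^sub>R h))" for s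
  proof (rule Bochner_Integration.integrable_bound)
    show "integrable (lebesgue_on D) (\<lambda>y. w y * B)" using w by simp
    show "(\<lambda>y. w y * \<psi> (y - s *\<^sub>R h)) \<in> borel_measurable (lebesgue_on D)"
      using wm mshift[OF test_functions_continuous[OF \<psi>]] by (intro borel_measurable_times)
    show "AE y in lebesgue_on D. norm (w y * \<psi> (y - s *\<^sub>R h)) \<le> norm (w y * B)"
      using order_trans[OF B abs_ge_self] by (intro AE_I2) (simp add: abs_mult mult_left_mono)
  qed
  have lip: "\<bar>\<psi> (y - s *\<^sub>R h) - \<psi> (y - r *\<^sub>R h)\<bar> \<le> M * \<bar>s - r\<bar>" for y s r
    using field_differentiable_bound[of UNIV "\<lambda>s. \<psi> (y - s *\<^sub>R h)" "\<lambda>s. - q (y - s *\<^sub>R h)" M s r]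
      has_real_derivative_along_line[OF diff, of y h] M by (simp add: q_def)
  have "((\<lambda>s. (?F (t + s) - ?F t) / s) \<longlongrightarrow> - (LINT y|lebesgue_on D. w y * q (y - t *\<^sub>R h))) (at 0)"
    unfolding tendsto_at_iff_sequentially
  proof (intro allI impI)
    fix X :: "nat \<Rightarrow> real" assume X: "\<forall>i. X i \<in> UNIV - {0}" and X0: "X \<longlonglongrightarrow> 0"
    have eq: "(?F (t + X n) - ?F t) / X n
        = (LINT y|lebesgue_on D. w y * ((\<psi> (y - (t + X n) *\<^sub>R h) - \<psi> (y - t *\<^sub>R h)) / X n))" for n
    proof -
      have "?F (t + X n) - ?F t
        = (LINT y|lebesgue_on D. w y * \<psi> (y - (t + X n) *\<^sub>R h) - w y * \<psi> (y - t *\<^sub>R h))"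
        by (rule Bochner_Integration.integral_diff[symmetric]; rule int)
      then have "(?F (t + X n) - ?F t) / X n
        = (LINT y|lebesgue_on D. (w y * \<psi> (y - (t + X n) *\<^sub>R h) - w y * \<psi> (y - t *\<^sub>R h)) / X n)"
        by simp
      also have "\<dots> = (LINT y|lebesgue_on D. w y * ((\<psi> (y - (t + X n) *\<^sub>R h) - \<psi> (y - t *\<^sub>R h)) / X n))"
        by (simp add: right_diff_distrib diff_divide_distrib)
      finally show ?thesis .
    qed
    have "(\<lambda>n. LINT y|lebesgue_on D. w y * ((\<psi> (y - (t + X n) *\<^sub>R h) - \<psi> (y - t *\<^sub>R h)) / X n))
        \<longlonglongrightarrow> (LINT y|lebesgue_on D. w y * - q (y - t *\<^sub>R h))"
    proof (rule integral_dominated_convergence[where w="\<lambda>y. norm (w y) * M"])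
      show "integrable (lebesgue_on D) (\<lambda>y. norm (w y) * M)" using w by simp
      show "(\<lambda>y. w y * - q (y - t *\<^sub>R h)) \<in> borel_measurable (lebesgue_on D)"
        using wm mshift[OF contq] by (intro borel_measurable_times borel_measurable_uminus)
      show "(\<lambda>y. w y * ((\<psi> (y - (t + X n) *\<^sub>R h) - \<psi> (y - t *\<^sub>R h)) / X n))
          \<in> borel_measurable (lebesgue_on D)" for n
        using wm mshift[OF test_functions_continuous[OF \<psi>]]
        by (intro borel_measurable_times borel_measurable_divide borel_measurable_diff borel_measurable_const)
      show "AE y in lebesgue_on D. (\<lambda>n. w y * ((\<psi> (y - (t + X n) *\<^sub>R h) - \<psi> (y - t *\<^sub>R h)) / X n))
          \<longlonglongrightarrow> w y * - q (y - t *\<^sub>R h)"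
      proof (rule AE_I2)
        fix y
        have "((\<lambda>s. (\<psi> (y - (t + s) *\<^sub>R h) - \<psi> (y - t *\<^sub>R h)) / s) \<longlongrightarrow> - q (y - t *\<^sub>R h)) (at 0)"
          using has_real_derivative_along_line[OF diff, of y h t] by (simp add: DERIV_def q_def)
        then have "(\<lambda>n. (\<psi> (y - (t + X n) *\<^sub>R h) - \<psi> (y - t *\<^sub>R h)) / X n) \<longlonglongrightarrow> - q (y - t *\<^sub>R h)"
          unfolding tendsto_at_iff_sequentially using X X0 by (auto simp: comp_def)
        then show "(\<lambda>n. w y * ((\<psi> (y - (t + X n) *\<^sub>R h) - \<psi> (y - t *\<^sub>R h)) / X n))
            \<longlonglongrightarrow> w y * - q (y - t *\<^sub>R h)" by (rule tendsto_mult_left)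
      qed
      show "AE y in lebesgue_on D. norm (w y * ((\<psi> (y - (t + X n) *\<^sub>R h) - \<psi> (y - t *\<^sub>R h)) / X n))
          \<le> norm (w y) * M" for n
      proof (rule AE_I2)
        fix y
        have "X n \<noteq> 0" using X by auto
        then have "\<bar>(\<psi> (y - (t + X n) *\<^sub>R h) - \<psi> (y - t *\<^sub>R h)) / X n\<bar> \<le> M"
          using lip[of y "t + X n" t] by (simp add: pos_divide_le_eq)
        then show "norm (w y * ((\<psi> (y - (t + X n) *\<^sub>R h) - \<psi> (y - t *\<^sub>R h)) / X n)) \<le> norm (w y) * M"
          unfolding norm_mult by (intro mult_left_mono) auto
      qed
    qed
    then show "((\<lambda>s. (?F (t + s) - ?F t) / s) \<circ> X) \<longlonglongrightarrow> - (LINT y|lebesgue_on D. w y * q (y - t *\<^sub>R h))"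
      by (simp add: comp_def eq)
  qed
  then show ?thesis by (simp add: DERIV_def q_def)
qed

lemma integral_lebesgue_on_eq_UNIV:
  fixes f :: "real^'d \<Rightarrow> real"
  assumes "D \<in> sets lebesgue" "\<And>x. x \<notin> D \<Longrightarrow> f x = 0"
  shows "(LINT x|lebesgue_on D. f x) = (LINT x|lebesgue. f x)"
proof -
  have "indicator D x *\<^sub>R f x = f x" for x using assms(2)[of x] by (auto simp: indicator_def)
  moreover have "(LINT x|lebesgue_on D. f x) = (LINT x|lebesgue. indicator D x *\<^sub>R f x)"
    using assms(1) by (simp add: integral_restrict_space)
  ultimately show ?thesis by (simp only:)
qed

lemma integral_lebesgue_shift:
  fixes f :: "real^'d \<Rightarrow> real"
  assumes "f \<in> borel_measurable lebesgue"
  shows "(LINT x|lebesgue. f (x + b)) = (LINT x|lebesgue. f x)"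
  using integral_scaling[OF scales_lebesgue_translation[of b], of UNIV f] assms
  by (simp add: surj_plus_right lebesgue_on_UNIV_eq)

text \<open>The integral of a translate does not depend on the translation; its derivative at 0 in
  direction \<open>i\<close> is minus the integral in question.\<close>

lemma integral_partial_deriv_test_function:
  assumes \<phi>: "\<phi> \<in> test_functions D" and D: "bounded D"
  shows "(LINT x|lebesgue. partial_deriv i \<phi> x) = 0"
proof -
  obtain R where R: "D \<subseteq> ball 0 R" using D bounded_subset_ballD by blast
  \<comment> \<open>One unit of room keeps the support of all translates with parameter in (-1, 1)
    inside the ball.\<close>
  let ?B = "ball (0::real^'a) (R + 1)" and ?e = "axis i 1 :: real^'a"
  have Bm: "?B \<in> sets lebesgue" by simp
  have out: "\<phi> x = 0" if "norm x \<ge> R" for x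
  proof -
    have "x \<notin> D" using R that by auto
    then show ?thesis by (rule test_functions_outside[OF \<phi>])
  qed
  have const: "(LINT y|lebesgue_on ?B. 1 * \<phi> (y - t *\<^sub>R ?e)) = (LINT y|lebesgue. \<phi> y)"
    if "t \<in> {-1<..<1}" for t
  proof -
    have "(LINT y|lebesgue_on ?B. 1 * \<phi> (y - t *\<^sub>R ?e)) = (LINT y|lebesgue. 1 * \<phi> (y - t *\<^sub>R ?e))"
    proof (rule integral_lebesgue_on_eq_UNIV[OF Bm])
      fix y assume "y \<notin> ?B"
      then have "norm (y - t *\<^sub>R ?e) \<ge> R"
        using norm_triangle_ineq2[of y "t *\<^sub>R ?e"] that by auto
      then show "1 * \<phi> (y - t *\<^sub>R ?e) = 0" using out by simp
    qed
    also have "\<dots> = (LINT y|lebesgue. \<phi> (y + (- (t *\<^sub>R ?e))))" by simp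
    also have "\<dots> = (LINT y|lebesgue. \<phi> y)"
      using continuous_on_borel_lebesgue_on[OF test_functions_continuous[OF \<phi>], of UNIV]
      by (intro integral_lebesgue_shift) (simp add: lebesgue_on_UNIV_eq)
    finally show ?thesis .
  qed
  have "((\<lambda>t. LINT y|lebesgue_on ?B. 1 * \<phi> (y - t *\<^sub>R ?e)) has_real_derivative 0) (at 0)"
  proof (rule has_field_derivative_transform_within_open[OF DERIV_const])
    show "(LINT y|lebesgue. \<phi> y) = (LINT y|lebesgue_on ?B. 1 * \<phi> (y - t *\<^sub>R ?e))"
      if "t \<in> {-1<..<1}" for t by (rule const[OF that, symmetric])
  qed auto
  moreover have "((\<lambda>t. LINT y|lebesgue_on ?B. 1 * \<phi> (y - t *\<^sub>R ?e)) has_real_derivative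
      - (LINT y|lebesgue_on ?B. 1 * (\<Sum>j\<in>UNIV. ?e $ j * partial_deriv j \<phi> (y - 0 *\<^sub>R ?e)))) (at 0)"
    using L2_imp_integrable[OF L2_const, of ?B 1] by (intro shifted_integral_has_derivative[OF \<phi>]) auto
  ultimately have "(LINT y|lebesgue_on ?B. 1 * (\<Sum>j\<in>UNIV. ?e $ j * partial_deriv j \<phi> (y - 0 *\<^sub>R ?e))) = 0"
    using DERIV_unique by fastforce
  moreover have "(\<Sum>j\<in>UNIV. ?e $ j * partial_deriv j \<phi> y) = partial_deriv i \<phi> y" for y
    by (rule sum_axis_mult)
  ultimately have "(LINT y|lebesgue_on ?B. partial_deriv i \<phi> y) = 0" by simp
  moreover have out': "partial_deriv i \<phi> x = 0" if "x \<notin> ?B" for x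
  proof -
    have "x \<notin> D" using R that by auto
    then show ?thesis by (rule test_functions_outside[OF partial_deriv_test_function[OF \<phi>]])
  qed
  moreover have "(LINT y|lebesgue_on ?B. partial_deriv i \<phi> y) = (LINT y|lebesgue. partial_deriv i \<phi> y)"
    by (rule integral_lebesgue_on_eq_UNIV[OF Bm out'])
  ultimately show ?thesis by (simp only:)
qed

definition classical_grad :: "(real^'d \<Rightarrow> real) \<Rightarrow> real^'d \<Rightarrow> real^'d" where
  "classical_grad \<phi> x = (\<chi> i. partial_deriv i \<phi> x)"

lemma classical_grad_L2: "\<lbrakk>\<phi> \<in> test_functions E; D \<in> lmeasurable\<rbrakk> \<Longrightarrow> classical_grad \<phi> \<in> L2 D"
  by (intro L2_vecI) (simp add: classical_grad_def test_functions_L2[OF partial_deriv_test_function])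

text \<open>The product is a test function on \<open>D\<close> because \<psi> is one, so the
  integral of its partial derivative vanishes; the product rule gives the two terms.\<close>

lemma integration_by_parts_test_functions:
  fixes \<phi> \<psi> :: "real^'d \<Rightarrow> real"
  assumes \<phi>: "\<phi> \<in> test_functions E" and \<psi>: "\<psi> \<in> test_functions D"
    and D: "D \<in> lmeasurable" "bounded D"
  shows "L2_inner D \<phi> (partial_deriv i \<psi>) = - L2_inner D (partial_deriv i \<phi>) \<psi>"
proof -
  have C: "C_times k (\<lambda>x. \<phi> x * \<psi> x)" for k
    by (intro C_times_mult test_functions_C[OF \<phi>] test_functions_C[OF \<psi>])
  have p: "(\<lambda>x. \<phi> x * \<psi> x) \<in> test_functions D"
    by (rule test_functions_smooth_combination[OF \<psi> \<psi> C]) auto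
  have "(LINT x|lebesgue_on D. partial_deriv i (\<lambda>x. \<phi> x * \<psi> x) x) = (LINT x|lebesgue. partial_deriv i (\<lambda>x. \<phi> x * \<psi> x) x)"
    using D test_functions_outside[OF partial_deriv_test_function[OF p]]
    by (intro integral_lebesgue_on_eq_UNIV) auto
  also have "\<dots> = 0" by (rule integral_partial_deriv_test_function[OF p D(2)])
  finally have "(LINT x|lebesgue_on D. \<phi> x * partial_deriv i \<psi> x + partial_deriv i \<phi> x * \<psi> x) = 0"
    by (subst (asm) partial_deriv_mult)
      (auto intro: test_functions_differentiable[OF \<phi>] test_functions_differentiable[OF \<psi>])
  moreover have "(LINT x|lebesgue_on D. \<phi> x * partial_deriv i \<psi> x + partial_deriv i \<phi> x * \<psi> x)
      = L2_inner D \<phi> (partial_deriv i \<psi>) + L2_inner D (partial_deriv i \<phi>) \<psi>"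
    unfolding L2_inner_def inner_real_def
    using L2_integrable_inner[OF test_functions_L2[OF \<phi> D(1)]
        test_functions_L2[OF partial_deriv_test_function[OF \<psi>] D(1)], of i]
      L2_integrable_inner[OF test_functions_L2[OF partial_deriv_test_function[OF \<phi>] D(1)]
        test_functions_L2[OF \<psi> D(1)], of i]
    by (intro Bochner_Integration.integral_add) auto
  ultimately show ?thesis by simp
qed

lemma has_weak_grad_test_function:
  assumes "\<phi> \<in> test_functions E" "D \<in> lmeasurable" "bounded D"
  shows "has_weak_grad D \<phi> (classical_grad \<phi>)"
  unfolding has_weak_grad_iff classical_grad_def
  using integration_by_parts_test_functions[OF assms(1) _ assms(2,3)] by simp

lemma test_functions_H1:
  assumes "\<phi> \<in> test_functions E" "D \<in> lmeasurable" "bounded D" shows "\<phi> \<in> H1 D"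
  using assms by (intro H1I[of _ _ "classical_grad \<phi>"])
    (auto intro: test_functions_L2 classical_grad_L2 has_weak_grad_test_function)

text \<open>The difference quotient estimate is proved by duality: tested against \<open>\<psi>\<close>, the translated
  function becomes a function of the translation parameter whose derivative is given by the weak
  gradient.\<close>
lemma translation_estimate:
  fixes u :: "real^'d \<Rightarrow> real"
  assumes D: "open D" "bounded D" and W: "open W"
    and seg: "\<And>x t. x \<in> W \<Longrightarrow> 0 \<le> t \<Longrightarrow> t \<le> 1 \<Longrightarrow> x + t *\<^sub>R h \<in> D"
    and u: "u \<in> L2 D" and g: "g \<in> L2 D" and ug: "has_weak_grad D u g"
  shows "(\<lambda>x. u (x + h)) \<in> L2 W"
    and "L2_inner W ((\<lambda>x. u (x + h)) - u) ((\<lambda>x. u (x + h)) - u) \<le> (norm h)\<^sup>2 * L2_inner D g g"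
proof -
  have Dm: "D \<in> lmeasurable" using D by (simp add: lmeasurable_open)
  then have Ds: "D \<in> sets lebesgue" by auto
  have WD: "W \<subseteq> D" using seg[of _ 0] by auto
  have bW: "bounded W" using WD D bounded_subset by blast
  have Wm: "W \<in> lmeasurable" using W bW by (simp add: lmeasurable_open)
  then have Ws: "W \<in> sets lebesgue" by auto
  have shift: "(\<lambda>x. x + b) ` W \<in> sets lebesgue" for b
    using open_translation[OF W, of b] by (simp add: add.commute image_def)
  have WhD: "(\<lambda>x. x + h) ` W \<subseteq> D" using seg[of _ 1] by auto
  have uW: "u \<in> L2 W" by (rule L2_subset[OF u WD Ws Ds])
  show uh: "(\<lambda>x. u (x + h)) \<in> L2 W"
    by (rule L2_scaling[OF scales_lebesgue_translation Ws shift L2_subset[OF u WhD shift Ds]])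
  have "L2_inner W ((\<lambda>x. u (x + h)) - u) ((\<lambda>x. u (x + h)) - u) \<le> (norm h * sqrt (L2_inner D g g))\<^sup>2"
  proof (rule L2_bound_by_test_functions[OF W bW L2.V_diff[OF uh uW]])
    show "0 \<le> norm h * sqrt (L2_inner D g g)" using L2.nonneg[OF g] by simp
    fix \<psi> assume \<psi>: "\<psi> \<in> test_functions W"
    have \<psi>W: "\<psi> \<in> L2 W" by (rule test_functions_L2[OF \<psi> Wm])
    define F where "F t = (LINT y|lebesgue_on D. u y * \<psi> (y - t *\<^sub>R h))" for t
    define F' where "F' t = - (LINT y|lebesgue_on D. u y * (\<Sum>i\<in>UNIV. h $ i * partial_deriv i \<psi> (y - t *\<^sub>R h)))" for t
    have der: "(F has_real_derivative F' t) (at t)" for t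
      unfolding F_def[abs_def] F'_def
      by (rule shifted_integral_has_derivative[OF \<psi> L2_imp_integrable[OF u Dm]])
    \<comment> \<open>The mean value theorem reduces the difference of two translates to a single
      intermediate translate. By \<open>seg\<close> this is a test function on \<open>D\<close>, and
      the weak gradient can be tested with it.\<close>
    obtain \<xi> where \<xi>: "0 < \<xi>" "\<xi> < 1" "F 1 - F 0 = F' \<xi>"
      using MVT2[of 0 1 F F'] der by auto
    define \<eta> where "\<eta> x = \<psi> (x + - (\<xi> *\<^sub>R h))" for x
    have \<eta>: "\<eta> \<in> test_functions D"
      unfolding \<eta>_def[abs_def] using seg \<xi> by (intro test_functions_shift[OF \<psi>]) auto
    have \<eta>D: "\<eta> \<in> L2 D" by (rule test_functions_L2[OF \<eta> Dm])
    have pd: "partial_deriv i \<eta> y = partial_deriv i \<psi> (y - \<xi> *\<^sub>R h)" for i y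
      unfolding \<eta>_def[abs_def] by (subst partial_deriv_shift) (auto intro: test_functions_differentiable[OF \<psi>])
    have "F' \<xi> = - L2_inner D (\<lambda>y. \<Sum>i\<in>UNIV. h $ i * partial_deriv i \<eta> y) u"
      by (simp add: F'_def L2_inner_def pd mult.commute)
    also have "\<dots> = - (\<Sum>i\<in>UNIV. h $ i * L2_inner D (partial_deriv i \<eta>) u)"
      using test_functions_L2[OF partial_deriv_test_function[OF \<eta>] Dm] u
      by (subst L2_inner_sum_left) auto
    also have "\<dots> = - (\<Sum>i\<in>UNIV. h $ i * - L2_inner D (\<lambda>x. g x $ i) \<eta>)"
      using has_weak_gradD[OF ug \<eta>] L2.sym[OF u test_functions_L2[OF partial_deriv_test_function[OF \<eta>] Dm]]
      by simp
    also have "\<dots> = (\<Sum>i\<in>UNIV. h $ i * L2_inner D (\<lambda>x. g x $ i) \<eta>)"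
      by (simp add: sum_negf)
    also have "\<dots> = L2_inner D (\<lambda>x. \<Sum>i\<in>UNIV. h $ i * g x $ i) \<eta>"
      using L2_nth[OF g] \<eta>D by (subst L2_inner_sum_left) auto
    also have "\<dots> = L2_inner D (\<lambda>x. h \<bullet> g x) \<eta>" by (simp add: inner_vec_def)
    finally have F'eq: "F' \<xi> = L2_inner D (\<lambda>x. h \<bullet> g x) \<eta>" .
    have \<eta>\<psi>: "L2_inner D \<eta> \<eta> = L2_inner W \<psi> \<psi>"
    proof -
      have "L2_inner D \<eta> \<eta> = (LINT x|lebesgue. (\<psi> (x + - (\<xi> *\<^sub>R h)))\<^sup>2)"
        unfolding L2_inner_def using test_functions_outside[OF \<eta>] Ds
        by (subst integral_lebesgue_on_eq_UNIV) (auto simp: \<eta>_def power2_eq_square)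
      also have "\<dots> = (LINT x|lebesgue. (\<psi> x)\<^sup>2)"
        using continuous_on_borel_lebesgue_on[OF test_functions_continuous[OF \<psi>], of UNIV]
        by (intro integral_lebesgue_shift) (simp add: lebesgue_on_UNIV_eq)
      also have "\<dots> = L2_inner W \<psi> \<psi>"
        unfolding L2_inner_def using test_functions_outside[OF \<psi>] Ws
        by (subst integral_lebesgue_on_eq_UNIV) (auto simp: power2_eq_square)
      finally show ?thesis .
    qed
    have "(F' \<xi>)\<^sup>2 \<le> ((norm h)\<^sup>2 * L2_inner D g g) * L2_inner W \<psi> \<psi>"
      unfolding F'eq using L2.Cauchy_Schwarz[OF L2_component(1)[OF g] \<eta>D, of h]
        mult_right_mono[OF L2_component(2)[OF g, of h] L2.nonneg[OF \<eta>D]] by (simp add: \<eta>\<psi>)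
    also have "\<dots> = (norm h * sqrt (L2_inner D g g) * sqrt (L2_inner W \<psi> \<psi>))\<^sup>2"
      using L2.nonneg[OF g] L2.nonneg[OF \<psi>W] by (simp add: power_mult_distrib)
    finally have "F' \<xi> \<le> norm h * sqrt (L2_inner D g g) * sqrt (L2_inner W \<psi> \<psi>)"
      using L2.nonneg[OF g] L2.nonneg[OF \<psi>W] by (intro power2_le_imp_le[of "F' \<xi>"]) auto
    moreover have "F 0 = L2_inner W u \<psi>"
    proof -
      have "F 0 = (LINT x|lebesgue. u x * \<psi> x)"
        unfolding F_def using test_functions_outside[OF \<psi>] WD Ds
        by (subst integral_lebesgue_on_eq_UNIV) auto
      also have "\<dots> = L2_inner W u \<psi>"
        unfolding L2_inner_def using test_functions_outside[OF \<psi>] Ws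
        by (subst integral_lebesgue_on_eq_UNIV) auto
      finally show ?thesis .
    qed
    moreover have "F 1 = L2_inner W (\<lambda>x. u (x + h)) \<psi>"
    proof -
      have out: "\<psi> (y - h) = 0" if "y \<notin> (\<lambda>x. x + h) ` W" for y
      proof (rule test_functions_outside[OF \<psi>])
        show "y - h \<notin> W"
        proof
          assume "y - h \<in> W"
          then have "(y - h) + h \<in> (\<lambda>x. x + h) ` W" by (rule imageI)
          then show False using that by simp
        qed
      qed
      have "F 1 = (LINT x|lebesgue. u x * \<psi> (x - h))"
        unfolding F_def using out WhD Ds
        by (subst integral_lebesgue_on_eq_UNIV) auto
      also have "\<dots> = L2_inner ((\<lambda>x. x + h) ` W) u (\<lambda>x. \<psi> (x - h))"
        unfolding L2_inner_def using out shift
        by (subst integral_lebesgue_on_eq_UNIV) auto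
      also have "\<dots> = L2_inner W (\<lambda>x. u (x + h)) \<psi>"
      proof -
        have "(\<lambda>x. \<psi> (x + - h)) \<in> L2 ((\<lambda>x. x + h) ` W)"
          using W bW test_functions_shift[OF \<psi>, of "- h" UNIV] bounded_translation[OF bW, of h]
          by (intro test_functions_L2[of _ UNIV] bounded_set_imp_lmeasurable shift) (auto simp: add.commute image_def)
        then show ?thesis
          using L2_inner_scaling[OF scales_lebesgue_translation Ws shift L2_subset[OF u WhD shift Ds], of "\<lambda>x. \<psi> (x - h)"]
          by simp
      qed
      finally show ?thesis .
    qed
    ultimately show "L2_inner W ((\<lambda>x. u (x + h)) - u) \<psi> \<le> norm h * sqrt (L2_inner D g g) * sqrt (L2_inner W \<psi> \<psi>)"
      using \<xi>(3) L2.diff[OF uh uW \<psi>W] by simp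
  qed
  then show "L2_inner W ((\<lambda>x. u (x + h)) - u) ((\<lambda>x. u (x + h)) - u) \<le> (norm h)\<^sup>2 * L2_inner D g g"
    using L2.nonneg[OF g] by (simp add: power_mult_distrib)
qed

section \<open>Poincare inequality on cubes\<close>

lemma has_weak_grad_subset:
  assumes ug: "has_weak_grad D u g" and ED: "E \<subseteq> D" "E \<in> sets lebesgue" "D \<in> sets lebesgue"
  shows "has_weak_grad E u g"
  unfolding has_weak_grad_def
proof (intro ballI allI)
  fix \<phi> i assume \<phi>: "\<phi> \<in> test_functions E"
  have \<phi>D: "\<phi> \<in> test_functions D" by (rule test_functions_mono[OF ED(1) \<phi>])
  have out: "\<phi> x = 0" "partial_deriv i \<phi> x = 0" if "x \<notin> E" for x
    using that by (auto intro: test_functions_outside[OF \<phi>]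
        test_functions_outside[OF partial_deriv_test_function[OF \<phi>]])
  have "(LINT x|lebesgue_on E. u x * partial_deriv i \<phi> x) = (LINT x|lebesgue_on D. u x * partial_deriv i \<phi> x)"
    using out ED by (subst (1 2) integral_lebesgue_on_eq_UNIV) auto
  moreover have "(LINT x|lebesgue_on E. g x $ i * \<phi> x) = (LINT x|lebesgue_on D. g x $ i * \<phi> x)"
    using out ED by (subst (1 2) integral_lebesgue_on_eq_UNIV) auto
  ultimately show "(LINT x|lebesgue_on E. u x * partial_deriv i \<phi> x) = - (LINT x|lebesgue_on E. g x $ i * \<phi> x)"
    using ug \<phi>D by (simp add: has_weak_grad_def)
qed

lemma has_weak_grad_cong_AE:
  assumes "has_weak_grad D u g" "AE x in lebesgue_on D. u x = u' x" "D \<in> lmeasurable"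
    "u \<in> L2 D" "u' \<in> L2 D"
  shows "has_weak_grad D u' g"
  unfolding has_weak_grad_iff
proof (intro ballI allI)
  fix \<phi> i assume \<phi>: "\<phi> \<in> test_functions D"
  note p = test_functions_L2[OF partial_deriv_test_function[OF \<phi>] assms(3), of i]
  have "L2_inner D u' (partial_deriv i \<phi>) = L2_inner D u (partial_deriv i \<phi>)"
    using assms by (intro L2_inner_cong_AE p) auto
  then show "L2_inner D u' (partial_deriv i \<phi>) = - L2_inner D (\<lambda>x. g x $ i) \<phi>"
    using has_weak_gradD[OF assms(1) \<phi>] by simp
qed

text \<open>The passage from Bochner integrals over a Lebesgue measurable set to nonnegative
  integrals against Borel measure, where Fubini's theorem is applied.\<close>

lemma nn_integral_lborel_indicator:
  fixes f :: "real^'d \<Rightarrow> real"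
  assumes "integrable (lebesgue_on Q) f" "\<And>x. 0 \<le> f x" "Q \<in> sets lebesgue"
  shows "(\<integral>\<^sup>+x. ennreal (f x) * indicator Q x \<partial>lborel) = ennreal (LINT x|lebesgue_on Q. f x)"
proof -
  have "(\<integral>\<^sup>+x. ennreal (f x) * indicator Q x \<partial>lborel) = (\<integral>\<^sup>+x. ennreal (f x) * indicator Q x \<partial>lebesgue)"
    by (rule nn_integral_completion[symmetric])
  also have "\<dots> = (\<integral>\<^sup>+x. ennreal (f x) \<partial>lebesgue_on Q)"
    using assms(3) by (simp add: nn_integral_restrict_space)
  also have "\<dots> = ennreal (LINT x|lebesgue_on Q. f x)"
    using assms by (intro nn_integral_eq_integral) auto
  finally show ?thesis .
qed

context
  fixes a b :: "real^'d" and \<delta> :: real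
  assumes \<delta>: "\<delta> > 0" and ab: "\<And>i. b $ i = a $ i + \<delta>"
begin

lemma cube_measurable: "box a b \<in> lmeasurable" "box a b \<in> sets lebesgue"
  using lmeasurable_open[OF bounded_box open_box] by auto

lemma cube_volume: "measure lebesgue (box a b) = \<delta> ^ CARD('d)"
proof -
  have "emeasure lborel (box a b) = ennreal (\<Prod>i\<in>Basis. (b - a) \<bullet> i)"
    using ab \<delta> by (subst emeasure_lborel_box) (auto simp: Basis_vec_def inner_axis)
  also have "(\<Prod>i\<in>Basis. (b - a) \<bullet> i) = (\<Prod>i\<in>(Basis :: (real^'d) set). \<delta>)"
    using ab by (intro prod.cong) (auto simp: Basis_vec_def inner_axis)
  also have "\<dots> = \<delta> ^ CARD('d)" by simp
  finally show ?thesis using \<delta> by (simp add: measure_def)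
qed

lemma L2_inner_const_cube:
  assumes "u \<in> L2 (box a b)"
  shows "L2_inner (box a b) (\<lambda>_. c) (\<lambda>_. c) = c\<^sup>2 * \<delta> ^ CARD('d)"
    and "L2_inner (box a b) (\<lambda>_. c) u = c * (LINT x|lebesgue_on (box a b). u x)"
  using cube_measurable cube_volume
  by (simp_all add: L2_inner_def measure_restrict_space space_restrict_space power2_eq_square)

text \<open>The double integral of \<open>(u x - u y)\<^sup>2\<close> over the cube is evaluated in
  two ways. Expanding the square gives the norm and the mean of \<open>u\<close>; integrating first
  for fixed difference h = y - x gives translation estimates. Borel measurability makes the
  integrand jointly measurable.\<close>

lemma Poincare_cube_borel:
  fixes u :: "real^'d \<Rightarrow> real"
  assumes u: "u \<in> L2 (box a b)" "g \<in> L2 (box a b)" "has_weak_grad (box a b) u g"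
    and borel[measurable]: "u \<in> borel_measurable borel"
  shows "L2_inner (box a b) u u \<le> (LINT x|lebesgue_on (box a b). u x)\<^sup>2 / \<delta> ^ CARD('d)
     + 2 ^ CARD('d) * (real CARD('d))\<^sup>2 * \<delta>\<^sup>2 * L2_inner (box a b) g g"
proof -
  define Q where "Q = box a b"
  define n where "n = CARD('d)"
  define I where "I = (LINT x|lebesgue_on Q. u x)"
  define S where "S = L2_inner Q u u"
  define V where "V = \<delta> ^ n"
  define G where "G = L2_inner Q g g"
  have V: "V > 0" using \<delta> by (simp add: V_def)
  have uQ: "u \<in> L2 Q" "g \<in> L2 Q" "has_weak_grad Q u g" using u by (auto simp: Q_def)
  have Qm: "Q \<in> lmeasurable" "Q \<in> sets lebesgue" using cube_measurable by (auto simp: Q_def)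
  have [measurable]: "Q \<in> sets borel" by (simp add: Q_def)
  have G: "G \<ge> 0" using L2.nonneg[OF uQ(2)] by (simp add: G_def)
  define F :: "real^'d \<Rightarrow> real^'d \<Rightarrow> ennreal"
    where "F x y = ennreal ((u x - u y)\<^sup>2) * indicator Q y * indicator Q x" for x y
  have "(\<integral>\<^sup>+x. \<integral>\<^sup>+y. F x y \<partial>lborel \<partial>lborel) = ennreal (2 * V * S - 2 * I\<^sup>2)"
  proof -
    have in1: "(\<integral>\<^sup>+y. F x y \<partial>lborel) = ennreal (V * (u x)\<^sup>2 - 2 * I * u x + S) * indicator Q x" for x
    proof -
      have c: "(\<lambda>_. u x) \<in> L2 Q" by (rule L2_const[OF Qm(1)])
      have i: "integrable (lebesgue_on Q) (\<lambda>y. (u x - u y)\<^sup>2)"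
        using L2_integrable[OF L2.V_diff[OF c uQ(1)]] by simp
      have "(\<integral>\<^sup>+y. F x y \<partial>lborel) = (\<integral>\<^sup>+y. ennreal ((u x - u y)\<^sup>2) * indicator Q y \<partial>lborel) * indicator Q x"
        unfolding F_def by (rule nn_integral_multc) measurable
      also have "(\<integral>\<^sup>+y. ennreal ((u x - u y)\<^sup>2) * indicator Q y \<partial>lborel) = ennreal (LINT y|lebesgue_on Q. (u x - u y)\<^sup>2)"
        by (rule nn_integral_lborel_indicator[OF i _ Qm(2)]) simp
      also have "(LINT y|lebesgue_on Q. (u x - u y)\<^sup>2) = L2_inner Q ((\<lambda>_. u x) - u) ((\<lambda>_. u x) - u)"
        by (simp add: L2_inner_def power2_eq_square)
      also have "\<dots> = V * (u x)\<^sup>2 - 2 * I * u x + S"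
        using L2.sq_diff[OF c uQ(1)] L2_inner_const_cube[OF u(1), of "u x"]
        by (simp add: Q_def[symmetric] V_def n_def I_def S_def algebra_simps)
      finally show ?thesis .
    qed
    have nonneg: "0 \<le> V * (u x)\<^sup>2 - 2 * I * u x + S" for x
    proof -
      have c: "(\<lambda>_. u x) \<in> L2 Q" by (rule L2_const[OF Qm(1)])
      show ?thesis
        using L2.nonneg[OF L2.V_diff[OF c uQ(1)]] L2.sq_diff[OF c uQ(1)] L2_inner_const_cube[OF u(1), of "u x"]
        by (simp add: Q_def[symmetric] V_def n_def I_def S_def algebra_simps)
    qed
    have i2: "integrable (lebesgue_on Q) (\<lambda>x. (u x)\<^sup>2)" using L2_integrable[OF uQ(1)] by simp
    have i1: "integrable (lebesgue_on Q) u" by (rule L2_imp_integrable[OF uQ(1) Qm(1)])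
    have i0: "integrable (lebesgue_on Q) (\<lambda>x. S)" by (rule L2_imp_integrable[OF L2_const[OF Qm(1)] Qm(1)])
    have i: "integrable (lebesgue_on Q) (\<lambda>x. V * (u x)\<^sup>2 - 2 * I * u x + S)"
      using i0 i1 i2 by (intro Bochner_Integration.integrable_add Bochner_Integration.integrable_diff
          integrable_mult_right) auto
    have "(\<integral>\<^sup>+x. \<integral>\<^sup>+y. F x y \<partial>lborel \<partial>lborel) = ennreal (LINT x|lebesgue_on Q. V * (u x)\<^sup>2 - 2 * I * u x + S)"
      unfolding in1 by (rule nn_integral_lborel_indicator[OF i nonneg Qm(2)])
    also have "(LINT x|lebesgue_on Q. V * (u x)\<^sup>2 - 2 * I * u x + S)
        = V * (LINT x|lebesgue_on Q. (u x)\<^sup>2) - 2 * I * (LINT x|lebesgue_on Q. u x) + (LINT x|lebesgue_on Q. S)"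
      using i0 i1 i2 by simp
    also have "(LINT x|lebesgue_on Q. S) = V * S"
      using L2_inner_const_cube(2)[OF L2_const[OF cube_measurable(1), of 1], of S] cube_volume cube_measurable
      by (simp add: L2_inner_def Q_def V_def n_def measure_restrict_space space_restrict_space)
    also have "(LINT x|lebesgue_on Q. (u x)\<^sup>2) = S"
      by (simp add: S_def L2_inner_def power2_eq_square)
    finally show ?thesis by (simp add: I_def power2_eq_square mult_ac)
  qed
  moreover have "(\<integral>\<^sup>+x. \<integral>\<^sup>+y. F x y \<partial>lborel \<partial>lborel) \<le> ennreal ((2 * \<delta>) ^ n * ((n * \<delta>)\<^sup>2 * G))"
  proof -
    \<comment> \<open>Differences of points of the cube lie in a cube of side 2 \<delta>, whose
      volume supplies the power of 2 in the constant; there the norm of h is at most n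
      \<delta>.\<close>
    let ?H = "box (- (\<chi> i. \<delta>)) (\<chi> i. \<delta>) :: (real^'d) set"
    have "(\<integral>\<^sup>+x. \<integral>\<^sup>+y. F x y \<partial>lborel \<partial>lborel) = (\<integral>\<^sup>+x. \<integral>\<^sup>+h. F x (h + x) \<partial>lborel \<partial>lborel)"
      unfolding F_def by (intro nn_integral_cong nn_integral_lborel_translate[symmetric]) measurable
    also have "\<dots> = (\<integral>\<^sup>+h. \<integral>\<^sup>+x. F x (h + x) \<partial>lborel \<partial>lborel)"
      unfolding F_def by (rule lborel_pair.Fubini') measurable
    also have "\<dots> \<le> (\<integral>\<^sup>+h. ennreal ((n * \<delta>)\<^sup>2 * G) * indicator ?H h \<partial>lborel)"
    proof (rule nn_integral_mono)
      fix h :: "real^'d"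
      define W where "W = {x. x \<in> Q \<and> x + h \<in> Q}"
      have Fh: "F x (h + x) = ennreal ((u (x + h) - u x)\<^sup>2) * indicator W x" for x
        by (auto simp: F_def W_def indicator_def power2_commute add.commute)
      show "(\<integral>\<^sup>+x. F x (h + x) \<partial>lborel) \<le> ennreal ((n * \<delta>)\<^sup>2 * G) * indicator ?H h"
      proof (cases "h \<in> ?H")
        case False
        have "W = {}"
        proof (rule ccontr)
          assume "W \<noteq> {}"
          then obtain x where x: "x \<in> Q" "x + h \<in> Q" by (auto simp: W_def)
          have "- \<delta> < h $ i \<and> h $ i < \<delta>" for i
          proof -
            have "a $ i < x $ i" "x $ i < a $ i + \<delta>" "a $ i < x $ i + h $ i" "x $ i + h $ i < a $ i + \<delta>"
              using x ab[of i] by (auto simp: Q_def mem_box_cart dest: spec[of _ i])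
            then show ?thesis by linarith
          qed
          then show False using False by (auto simp: mem_box_cart)
        qed
        then show ?thesis by (simp add: Fh)
      next
        case True
        have "W = Q \<inter> (\<lambda>x. x + h) -` Q" by (auto simp: W_def)
        moreover have "open ((\<lambda>x. x + h) -` Q)"
          by (rule open_vimage) (auto simp: Q_def intro: continuous_intros)
        ultimately have W: "open W" by (auto simp: Q_def)
        have seg: "x + t *\<^sub>R h \<in> Q" if "x \<in> W" "0 \<le> t" "t \<le> 1" for x t
        proof -
          have "(1 - t) *\<^sub>R x + t *\<^sub>R (x + h) \<in> Q"
            using that convex_box(1)[of a b] unfolding Q_def W_def by (intro convexD) auto
          moreover have "(1 - t) *\<^sub>R x + t *\<^sub>R (x + h) = x + t *\<^sub>R h" by (simp add: algebra_simps)
          ultimately show ?thesis by simp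
        qed
        have bQ: "open Q" "bounded Q" by (auto simp: Q_def)
        note T = translation_estimate[OF bQ W seg uQ]
        have Wm: "W \<in> sets lebesgue" using W by auto
        have uW: "u \<in> L2 W" using W_def by (intro L2_subset[OF uQ(1) _ Wm Qm(2)]) auto
        have i: "integrable (lebesgue_on W) (\<lambda>x. (u (x + h) - u x)\<^sup>2)"
          using L2_integrable[OF L2.V_diff[OF T(1) uW]] by simp
        have "(\<integral>\<^sup>+x. F x (h + x) \<partial>lborel) = ennreal (LINT x|lebesgue_on W. (u (x + h) - u x)\<^sup>2)"
          unfolding Fh by (rule nn_integral_lborel_indicator[OF i _ Wm]) simp
        also have "\<dots> \<le> ennreal ((norm h)\<^sup>2 * G)"
          using T(2) by (intro ennreal_leI) (simp add: L2_inner_def power2_eq_square G_def)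
        also have "\<dots> \<le> ennreal ((n * \<delta>)\<^sup>2 * G)"
        proof (intro ennreal_leI mult_right_mono power_mono G)
          have "norm h \<le> (\<Sum>i\<in>UNIV. \<bar>h $ i\<bar>)" by (rule norm_le_l1_cart)
          also have "\<dots> \<le> (\<Sum>i\<in>(UNIV::'d set). \<delta>)"
          proof (rule sum_mono)
            fix i
            have "- \<delta> < h $ i" "h $ i < \<delta>" using True by (auto simp: mem_box_cart dest: spec[of _ i])
            then show "\<bar>h $ i\<bar> \<le> \<delta>" by linarith
          qed
          finally show "norm h \<le> n * \<delta>" by (simp add: n_def)
        qed auto
        finally show ?thesis using True by simp
      qed
    qed
    also have "\<dots> = ennreal ((n * \<delta>)\<^sup>2 * G) * emeasure lborel ?H"
      by (rule nn_integral_cmult_indicator) simp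
    also have "emeasure lborel ?H = ennreal ((2 * \<delta>) ^ n)"
    proof -
      have "emeasure lborel ?H = ennreal (\<Prod>i\<in>Basis. ((\<chi> i. \<delta>) - (- (\<chi> i. \<delta>))) \<bullet> (i::real^'d))"
        using \<delta> by (subst emeasure_lborel_box) (auto simp: Basis_vec_def inner_axis)
      also have "(\<Prod>i\<in>Basis. ((\<chi> i. \<delta>) - (- (\<chi> i. \<delta>))) \<bullet> (i::real^'d)) = (\<Prod>i\<in>(Basis :: (real^'d) set). 2 * \<delta>)"
        by (intro prod.cong) (auto simp: Basis_vec_def inner_axis)
      finally show ?thesis by (simp add: n_def)
    qed
    finally show ?thesis using \<delta> G by (simp add: mult.commute flip: ennreal_mult)
  qed
  ultimately have "ennreal (2 * V * S - 2 * I\<^sup>2) \<le> ennreal ((2 * \<delta>) ^ n * ((n * \<delta>)\<^sup>2 * G))" by simp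
  then have "2 * V * S - 2 * I\<^sup>2 \<le> (2 * \<delta>) ^ n * ((n * \<delta>)\<^sup>2 * G)"
    by (subst (asm) ennreal_le_iff) (use \<delta> G in auto)
  \<comment> \<open>A factor 2 is given away, so that dividing both sides by 2 leaves the stated
    constant.\<close>
  also have "\<dots> \<le> 2 * ((2 * \<delta>) ^ n * ((n * \<delta>)\<^sup>2 * G))" using \<delta> G by simp
  finally have "V * S \<le> I\<^sup>2 + V * (2 ^ n * (real n)\<^sup>2 * \<delta>\<^sup>2 * G)"
    by (simp add: V_def power_mult_distrib algebra_simps)
  then have "V * S / V \<le> (I\<^sup>2 + V * (2 ^ n * (real n)\<^sup>2 * \<delta>\<^sup>2 * G)) / V"
    using V by (intro divide_right_mono) auto
  then have "S \<le> I\<^sup>2 / V + 2 ^ n * (real n)\<^sup>2 * \<delta>\<^sup>2 * G"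
    using V by (simp add: add_divide_distrib)
  then show ?thesis unfolding S_def I_def V_def G_def Q_def n_def .
qed

text \<open>Reduces to the Borel case: \<open>u\<close> agrees almost everywhere on the cube with a
  Borel function, and all terms are insensitive to null sets.\<close>

lemma Poincare_cube:
  fixes u :: "real^'d \<Rightarrow> real"
  assumes u: "u \<in> L2 (box a b)" "g \<in> L2 (box a b)" "has_weak_grad (box a b) u g"
  shows "L2_inner (box a b) u u \<le> (LINT x|lebesgue_on (box a b). u x)\<^sup>2 / \<delta> ^ CARD('d)
     + 2 ^ CARD('d) * (real CARD('d))\<^sup>2 * \<delta>\<^sup>2 * L2_inner (box a b) g g"
proof -
  let ?Q = "box a b"
  have "(\<lambda>x. indicator ?Q x *\<^sub>R u x) \<in> borel_measurable lebesgue"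
    using L2_measurable[OF u(1)] cube_measurable by (subst (asm) borel_measurable_restrict_space_iff) auto
  then obtain v where v: "v \<in> borel_measurable lborel" "AE x in lborel. indicator ?Q x *\<^sub>R u x = v x"
    using completion_ex_borel_measurable_real by blast
  have ae: "AE x in lebesgue_on ?Q. u x = v x"
    using AE_completion[OF v(2)] cube_measurable
    by (subst AE_restrict_space_iff) (auto elim!: eventually_mono)
  have vb: "v \<in> borel_measurable borel" using v(1) by simp
  have vm: "v \<in> borel_measurable (lebesgue_on ?Q)"
    by (intro measurable_restrict_space1 measurable_completion v(1))
  have "integrable (lebesgue_on ?Q) (\<lambda>x. (norm (v x))\<^sup>2)"
    using ae vm L2_measurable[OF u(1)]
    by (intro integrable_cong_AE_imp[OF L2_integrable[OF u(1)]]) (auto elim!: eventually_mono)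
  then have v2: "v \<in> L2 ?Q" using vm by (simp add: L2_def)
  have "L2_inner ?Q u u = L2_inner ?Q v v"
    by (rule L2_inner_cong_AE[OF ae ae u(1) v2 u(1) v2])
  moreover have "(LINT x|lebesgue_on ?Q. u x) = (LINT x|lebesgue_on ?Q. v x)"
    by (rule integral_cong_AE[OF L2_measurable[OF u(1)] vm ae])
  ultimately show ?thesis
    using Poincare_cube_borel[OF v2 u(2) has_weak_grad_cong_AE[OF u(3) ae cube_measurable(1) u(1) v2] vb]
    by simp
qed

end

section \<open>Local compactness of the Sobolev embedding\<close>

text \<open>A family may repeat a functional, while the set of its members counts it once. Scaling
  by the square root of \<open>card I\<close> makes up for the lost multiplicity.\<close>

lemma finitely_controlledI:
  fixes V :: "'v::real_vector set" and dummy :: "'i itself"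
  assumes "\<And>\<epsilon>. \<epsilon> > 0 \<Longrightarrow> \<exists>(I::'i set) l C. finite I
        \<and> (\<forall>i\<in>I. (\<forall>u\<in>V. (l i u)\<^sup>2 \<le> C * b u) \<and> (\<forall>u\<in>V. \<forall>v\<in>V. l i (u - v) = l i u - l i v))
        \<and> (\<forall>u\<in>V. q u \<le> \<epsilon> * h u + (\<Sum>i\<in>I. (l i u)\<^sup>2))"
  shows "finitely_controlled V h b q"
  unfolding finitely_controlled_def
proof (intro allI impI)
  fix \<epsilon> :: real assume "\<epsilon> > 0"
  then obtain I l C where I: "finite (I::'i set)"
    and l: "\<And>i u. i \<in> I \<Longrightarrow> u \<in> V \<Longrightarrow> (l i u)\<^sup>2 \<le> C * b u"
      "\<And>i u v. i \<in> I \<Longrightarrow> u \<in> V \<Longrightarrow> v \<in> V \<Longrightarrow> l i (u - v) = l i u - l i v"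
    and q: "\<And>u. u \<in> V \<Longrightarrow> q u \<le> \<epsilon> * h u + (\<Sum>i\<in>I. (l i u)\<^sup>2)"
    using assms[of \<epsilon>] by metis
  define s where "s = sqrt (card I)"
  define L where "L = (\<lambda>k u. s * k u) ` (l ` I)"
  have "finite L" using I by (simp add: L_def)
  moreover have "(k u)\<^sup>2 \<le> (card I * C) * b u" if k: "k \<in> L" and "u \<in> V" for k u
  proof -
    obtain i where i: "i \<in> I" "k = (\<lambda>u. s * l i u)" using k by (auto simp: L_def)
    have "(k u)\<^sup>2 = card I * (l i u)\<^sup>2" by (simp add: i(2) s_def power_mult_distrib)
    also have "\<dots> \<le> card I * (C * b u)" using l(1) i(1) that by (intro mult_left_mono) auto
    finally show ?thesis by simp
  qed
  moreover have "k (u - v) = k u - k v" if "k \<in> L" "u \<in> V" "v \<in> V" for k u v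
    using that l(2) by (auto simp: L_def right_diff_distrib)
  moreover have "q u \<le> \<epsilon> * h u + (\<Sum>k\<in>L. (k u)\<^sup>2)" if "u \<in> V" for u
  proof -
    have "(\<Sum>i\<in>I. (l i u)\<^sup>2) \<le> (\<Sum>k\<in>L. (k u)\<^sup>2)"
    proof (cases "I = {}")
      case False
      then have s: "s > 0" using I by (simp add: s_def card_gt_0_iff)
      have inj: "inj_on (\<lambda>k u. s * k u) (l ` I)" using s by (auto simp: inj_on_def fun_eq_iff)
      have "(\<Sum>i\<in>I. (l i u)\<^sup>2) \<le> (\<Sum>i\<in>I. \<Sum>k\<in>l ` I. (k u)\<^sup>2)"
        using I by (intro sum_mono member_le_sum[of "l _" "l ` I" "\<lambda>k. (k u)\<^sup>2"]) auto
      also have "\<dots> = (\<Sum>k\<in>l ` I. (s * k u)\<^sup>2)"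
        by (simp add: s_def power_mult_distrib sum_distrib_left)
      also have "\<dots> = (\<Sum>k\<in>L. (k u)\<^sup>2)"
        unfolding L_def by (subst sum.reindex[OF inj]) simp
      finally show ?thesis .
    qed (simp add: L_def)
    then show ?thesis using q[OF that] by linarith
  qed
  ultimately show "\<exists>L C. finite L
        \<and> (\<forall>l\<in>L. (\<forall>u\<in>V. (l u)\<^sup>2 \<le> C * b u) \<and> (\<forall>u\<in>V. \<forall>v\<in>V. l (u - v) = l u - l v))
        \<and> (\<forall>u\<in>V. q u \<le> \<epsilon> * h u + (\<Sum>l\<in>L. (l u)\<^sup>2))"
    by (intro exI[of _ L] exI[of _ "real (card I) * C"]) auto
qed

lemma finitely_controlledE:
  assumes "finitely_controlled V h b q" "\<epsilon> > 0"
  obtains L C where "finite L" "\<And>l u. l \<in> L \<Longrightarrow> u \<in> V \<Longrightarrow> (l u)\<^sup>2 \<le> C * b u"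
    "\<And>l u v. l \<in> L \<Longrightarrow> u \<in> V \<Longrightarrow> v \<in> V \<Longrightarrow> l (u - v) = l u - l v"
    "\<And>u. u \<in> V \<Longrightarrow> q u \<le> \<epsilon> * h u + (\<Sum>l\<in>L. (l u)\<^sup>2)"
  using assms unfolding finitely_controlled_def by metis

text \<open>Serves finite covers of a domain. Each piece receives a share of \<epsilon>, and pairs
  of a piece and a functional form the index set, so that a functional shared by several pieces is
  counted for each of them.\<close>

lemma finitely_controlled_sum:
  assumes J: "finite J" and q: "\<And>j. j \<in> J \<Longrightarrow> finitely_controlled V h b (q j)"
    and h: "\<And>u. u \<in> V \<Longrightarrow> 0 \<le> h u" and b: "\<And>u. u \<in> V \<Longrightarrow> 0 \<le> b u"
    and le: "\<And>u. u \<in> V \<Longrightarrow> p u \<le> (\<Sum>j\<in>J. q j u)"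
  shows "finitely_controlled V h b p"
proof (rule finitely_controlledI)
  fix \<epsilon> :: real assume "\<epsilon> > 0"
  let ?e = "\<epsilon> / (card J + 1)"
  have e: "?e > 0" using \<open>\<epsilon> > 0\<close> by simp
  have "\<forall>j\<in>J. \<exists>L C. finite L
        \<and> (\<forall>l\<in>L. (\<forall>u\<in>V. (l u)\<^sup>2 \<le> C * b u) \<and> (\<forall>u\<in>V. \<forall>v\<in>V. l (u - v) = l u - l v))
        \<and> (\<forall>u\<in>V. q j u \<le> ?e * h u + (\<Sum>l\<in>L. (l u)\<^sup>2))"
    using q e unfolding finitely_controlled_def by blast
  from bchoice[OF this] obtain L where "\<forall>j\<in>J. \<exists>C. finite (L j)
        \<and> (\<forall>l\<in>L j. (\<forall>u\<in>V. (l u)\<^sup>2 \<le> C * b u) \<and> (\<forall>u\<in>V. \<forall>v\<in>V. l (u - v) = l u - l v))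
        \<and> (\<forall>u\<in>V. q j u \<le> ?e * h u + (\<Sum>l\<in>L j. (l u)\<^sup>2))" by blast
  from bchoice[OF this] obtain C where LC: "\<forall>j\<in>J. finite (L j)
        \<and> (\<forall>l\<in>L j. (\<forall>u\<in>V. (l u)\<^sup>2 \<le> C j * b u) \<and> (\<forall>u\<in>V. \<forall>v\<in>V. l (u - v) = l u - l v))
        \<and> (\<forall>u\<in>V. q j u \<le> ?e * h u + (\<Sum>l\<in>L j. (l u)\<^sup>2))" by blast
  have L: "\<And>j. j \<in> J \<Longrightarrow> finite (L j)"
    "\<And>j l u. j \<in> J \<Longrightarrow> l \<in> L j \<Longrightarrow> u \<in> V \<Longrightarrow> (l u)\<^sup>2 \<le> C j * b u"
    "\<And>j l u v. j \<in> J \<Longrightarrow> l \<in> L j \<Longrightarrow> u \<in> V \<Longrightarrow> v \<in> V \<Longrightarrow> l (u - v) = l u - l v"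
    "\<And>j u. j \<in> J \<Longrightarrow> u \<in> V \<Longrightarrow> q j u \<le> ?e * h u + (\<Sum>l\<in>L j. (l u)\<^sup>2)"
    using LC by simp_all
  have C: "(snd i u)\<^sup>2 \<le> (\<Sum>j\<in>J. \<bar>C j\<bar>) * b u" if "i \<in> Sigma J L" "u \<in> V" for i u
  proof -
    have i: "fst i \<in> J" "snd i \<in> L (fst i)" using that by auto
    have "(snd i u)\<^sup>2 \<le> C (fst i) * b u" by (rule L(2)[OF i that(2)])
    also have "\<dots> \<le> \<bar>C (fst i)\<bar> * b u" using b that by (intro mult_right_mono) auto
    also have "\<dots> \<le> (\<Sum>j\<in>J. \<bar>C j\<bar>) * b u"
      using b[OF that(2)] i(1) J by (intro mult_right_mono member_le_sum) auto
    finally show ?thesis .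
  qed
  have "p u \<le> \<epsilon> * h u + (\<Sum>i\<in>Sigma J L. (snd i u)\<^sup>2)" if u: "u \<in> V" for u
  proof -
    have "p u \<le> (\<Sum>j\<in>J. ?e * h u + (\<Sum>l\<in>L j. (l u)\<^sup>2))"
      using le[OF u] sum_mono[of J "\<lambda>j. q j u"] L(4) u by (meson order_trans)
    also have "\<dots> = card J * (?e * h u) + (\<Sum>j\<in>J. \<Sum>l\<in>L j. (l u)\<^sup>2)" by (simp add: sum.distrib)
    also have "(\<Sum>j\<in>J. \<Sum>l\<in>L j. (l u)\<^sup>2) = (\<Sum>i\<in>Sigma J L. (snd i u)\<^sup>2)"
      using J L(1) by (subst sum.Sigma) (auto simp: case_prod_beta)
    also have "card J * (?e * h u) \<le> \<epsilon> * h u"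
      using \<open>\<epsilon> > 0\<close> h[OF u] by (simp add: field_simps)
    finally show ?thesis by simp
  qed
  then show "\<exists>(I::('a \<times> ('b \<Rightarrow> real)) set) l C. finite I
        \<and> (\<forall>i\<in>I. (\<forall>u\<in>V. (l i u)\<^sup>2 \<le> C * b u) \<and> (\<forall>u\<in>V. \<forall>v\<in>V. l i (u - v) = l i u - l i v))
        \<and> (\<forall>u\<in>V. p u \<le> \<epsilon> * h u + (\<Sum>i\<in>I. (l i u)\<^sup>2))"
    using C J L(1,3) by (intro exI[of _ "Sigma J L"] exI[of _ snd] exI[of _ "\<Sum>j\<in>J. \<bar>C j\<bar>"]) auto
qed

text \<open>The quantity \<open>q\<close> may depend on \<epsilon>. This occurs near the boundary,
  where the compact set reached by a translation depends on the length of the translation and thus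
  on \<epsilon>.\<close>

lemma finitely_controlled_approx:
  assumes "M > 0" and "\<And>\<epsilon>. \<epsilon> > 0 \<Longrightarrow> \<exists>q. finitely_controlled V h b q \<and> (\<forall>u\<in>V. p u \<le> \<epsilon> * h u + M * q u)"
  shows "finitely_controlled V h b p"
proof (rule finitely_controlledI)
  fix \<epsilon> :: real assume e: "\<epsilon> > 0"
  then obtain q where q: "finitely_controlled V h b q" "\<And>u. u \<in> V \<Longrightarrow> p u \<le> \<epsilon> / 2 * h u + M * q u"
    using assms(2)[of "\<epsilon> / 2"] by auto
  have "\<epsilon> / (2 * M) > 0" using e assms(1) by simp
  from finitely_controlledE[OF q(1) this] obtain L C where L: "finite L"
    "\<And>l u. l \<in> L \<Longrightarrow> u \<in> V \<Longrightarrow> (l u)\<^sup>2 \<le> C * b u"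
    "\<And>l u v. l \<in> L \<Longrightarrow> u \<in> V \<Longrightarrow> v \<in> V \<Longrightarrow> l (u - v) = l u - l v"
    "\<And>u. u \<in> V \<Longrightarrow> q u \<le> \<epsilon> / (2 * M) * h u + (\<Sum>l\<in>L. (l u)\<^sup>2)" by metis
  have 1: "(sqrt M * l u)\<^sup>2 \<le> (M * C) * b u" if "l \<in> L" "u \<in> V" for l u
    using mult_left_mono[OF L(2)[OF that], of M] assms(1) by (simp add: power_mult_distrib mult.assoc)
  have 3: "sqrt M * l (u - v) = sqrt M * l u - sqrt M * l v" if "l \<in> L" "u \<in> V" "v \<in> V" for l u v
    using L(3)[OF that] by (simp add: right_diff_distrib)
  have 2: "p u \<le> \<epsilon> * h u + (\<Sum>l\<in>L. (sqrt M * l u)\<^sup>2)" if "u \<in> V" for u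
  proof -
    have "M * q u \<le> M * (\<epsilon> / (2 * M) * h u + (\<Sum>l\<in>L. (l u)\<^sup>2))"
      using L(4)[OF that] assms(1) by (intro mult_left_mono) auto
    also have "\<dots> = \<epsilon> / 2 * h u + (\<Sum>l\<in>L. (sqrt M * l u)\<^sup>2)"
      using assms(1) by (simp add: distrib_left power_mult_distrib sum_distrib_left)
    finally show ?thesis using q(2)[OF that] by (simp add: field_simps)
  qed
  show "\<exists>(I::('a \<Rightarrow> real) set) l C. finite I
        \<and> (\<forall>i\<in>I. (\<forall>u\<in>V. (l i u)\<^sup>2 \<le> C * b u) \<and> (\<forall>u\<in>V. \<forall>v\<in>V. l i (u - v) = l i u - l i v))
        \<and> (\<forall>u\<in>V. p u \<le> \<epsilon> * h u + (\<Sum>i\<in>I. (l i u)\<^sup>2))"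
    using L(1) 1 2 3
    by (intro exI[of _ L] exI[of _ "\<lambda>l u. sqrt M * l u"] exI[of _ "M * C"]) auto
qed

text \<open>Comparing how often two families of sets cover a point covers two needs at once: a set
  covered by pieces, and disjoint pieces inside a set.\<close>

lemma L2_inner_le_sum:
  fixes u :: "real^'d \<Rightarrow> 'b::euclidean_space"
  assumes u: "u \<in> L2 D" and D: "D \<in> sets lebesgue" and "finite I" "finite J"
    and A: "\<And>i. i \<in> I \<Longrightarrow> A i \<in> sets lebesgue \<and> A i \<subseteq> D"
    and B: "\<And>j. j \<in> J \<Longrightarrow> B j \<in> sets lebesgue \<and> B j \<subseteq> D"
    and le: "AE x in lebesgue. (\<Sum>i\<in>I. indicator (A i) x) \<le> (\<Sum>j\<in>J. indicator (B j) x :: real)"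
  shows "(\<Sum>i\<in>I. L2_inner (A i) u u) \<le> (\<Sum>j\<in>J. L2_inner (B j) u u)"
proof -
  have eq: "L2_inner A u u = (LINT x|lebesgue. indicator A x *\<^sub>R (norm (u x))\<^sup>2)"
    and int: "integrable lebesgue (\<lambda>x. indicator A x *\<^sub>R (norm (u x))\<^sup>2)"
    if "A \<in> sets lebesgue \<and> A \<subseteq> D" for A
    using that L2_integrable[OF L2_subset[OF u _ _ D, of A]] unfolding L2_inner_eq_norm
    by (simp_all add: integral_restrict_space integrable_restrict_space)
  have "(\<Sum>i\<in>I. L2_inner (A i) u u) = (LINT x|lebesgue. (\<Sum>i\<in>I. indicator (A i) x *\<^sub>R (norm (u x))\<^sup>2))"
    using eq[OF A] int[OF A] by (subst Bochner_Integration.integral_sum) auto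
  also have "\<dots> \<le> (LINT x|lebesgue. (\<Sum>j\<in>J. indicator (B j) x *\<^sub>R (norm (u x))\<^sup>2))"
  proof (rule integral_mono_AE)
    show "integrable lebesgue (\<lambda>x. \<Sum>i\<in>I. indicator (A i) x *\<^sub>R (norm (u x))\<^sup>2)"
      using int[OF A] by (intro Bochner_Integration.integrable_sum) auto
    show "integrable lebesgue (\<lambda>x. \<Sum>j\<in>J. indicator (B j) x *\<^sub>R (norm (u x))\<^sup>2)"
      using int[OF B] by (intro Bochner_Integration.integrable_sum) auto
    show "AE x in lebesgue. (\<Sum>i\<in>I. indicator (A i) x *\<^sub>R (norm (u x))\<^sup>2)
        \<le> (\<Sum>j\<in>J. indicator (B j) x *\<^sub>R (norm (u x))\<^sup>2)"
      using le by eventually_elim (simp add: sum_distrib_right[symmetric] mult_right_mono)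
  qed
  also have "\<dots> = (\<Sum>j\<in>J. L2_inner (B j) u u)"
    using eq[OF B] int[OF B] by (subst Bochner_Integration.integral_sum) auto
  finally show ?thesis .
qed

definition H1_energy :: "(real^'d) set \<Rightarrow> (real^'d \<Rightarrow> real) \<Rightarrow> real" where
  "H1_energy D u = grad_inner D u u + L2_inner D u u"

lemma H1_energy_nonneg: "u \<in> H1 D \<Longrightarrow> 0 \<le> H1_energy D u"
  unfolding H1_energy_def grad_inner_def by (intro add_nonneg_nonneg L2.nonneg weak_grad_L2 H1_L2)

text \<open>The functionals are normalised means over the finitely many grid cells that meet
  \<open>K\<close>. On each cell the Poincare inequality leaves a multiple of
  \<open>\<delta>\<^sup>2\<close> times the gradient energy, and since the open cells are disjoint
  these errors add up to at most the energy on \<open>D\<close>.\<close>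

lemma interior_controlled:
  fixes D :: "(real^'d) set"
  assumes D: "open D" "bounded D" and K: "compact K" "K \<subseteq> D"
  shows "finitely_controlled (H1 D) (H1_energy D) (\<lambda>u. L2_inner D u u) (\<lambda>u. L2_inner K u u)"
proof (rule finitely_controlledI)
  fix \<epsilon> :: real assume e: "\<epsilon> > 0"
  let ?n = "real CARD('d)"
  have n: "?n \<ge> 1" by (simp add: Suc_leI)
  have Dm: "D \<in> lmeasurable" using D by (simp add: lmeasurable_open)
  then have Ds: "D \<in> sets lebesgue" by auto
  have Km: "K \<in> sets lebesgue" using K lmeasurable_compact by blast
  obtain \<eta> where \<eta>: "\<eta> > 0" "(\<Union>x\<in>K. ball x \<eta>) \<subseteq> D"
    using compact_subset_open_imp_ball_epsilon_subset[OF K(1) D(1) K(2)] by blast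
  define c where "c = 2 ^ CARD('d) * ?n\<^sup>2"
  have c: "c > 0" using n by (simp add: c_def)
  \<comment> \<open>The first bound keeps every cell that meets \<open>K\<close> inside
    \<open>D\<close>; the other two make \<open>c * \<delta>\<^sup>2\<close> at most
    \<epsilon>.\<close>
  define \<delta> where "\<delta> = min (\<eta> / (2 * ?n)) (min 1 (\<epsilon> / c))"
  have \<delta>: "\<delta> > 0" using \<eta> n e c by (simp add: \<delta>_def)
  have "?n * \<delta> \<le> ?n * (\<eta> / (2 * ?n))" by (intro mult_left_mono) (auto simp: \<delta>_def)
  also have "\<dots> < \<eta>" using n \<eta> by simp
  finally have \<delta>\<eta>: "?n * \<delta> < \<eta>" .
  have \<delta>\<epsilon>: "c * \<delta>\<^sup>2 \<le> \<epsilon>"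
  proof -
    have "\<delta>\<^sup>2 \<le> \<delta> * 1" unfolding power2_eq_square using \<delta> by (intro mult_left_mono) (auto simp: \<delta>_def)
    also have "\<dots> \<le> \<epsilon> / c" by (simp add: \<delta>_def)
    finally show ?thesis using c by (simp add: field_simps)
  qed
  define l :: "('d \<Rightarrow> int) \<Rightarrow> real^'d" where "l z = (\<chi> i. \<delta> * of_int (z i))" for z
  define r :: "('d \<Rightarrow> int) \<Rightarrow> real^'d" where "r z = (\<chi> i. \<delta> * of_int (z i) + \<delta>)" for z
  define cell :: "real^'d \<Rightarrow> 'd \<Rightarrow> int" where "cell x = (\<lambda>i. \<lfloor>x $ i / \<delta>\<rfloor>)" for x
  define Z where "Z = cell ` K"
  have cell: "x \<in> cbox (l (cell x)) (r (cell x))" for x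
  proof -
    have "\<delta> * of_int \<lfloor>x $ i / \<delta>\<rfloor> \<le> x $ i" "x $ i \<le> \<delta> * of_int \<lfloor>x $ i / \<delta>\<rfloor> + \<delta>" for i
    proof -
      have "of_int \<lfloor>x $ i / \<delta>\<rfloor> \<le> x $ i / \<delta>" "x $ i / \<delta> \<le> of_int \<lfloor>x $ i / \<delta>\<rfloor> + 1"
        by linarith+
      then have "\<delta> * of_int \<lfloor>x $ i / \<delta>\<rfloor> \<le> \<delta> * (x $ i / \<delta>)"
        "\<delta> * (x $ i / \<delta>) \<le> \<delta> * (of_int \<lfloor>x $ i / \<delta>\<rfloor> + 1)"
        using \<delta> by (intro mult_left_mono; simp)+
      then show "\<delta> * of_int \<lfloor>x $ i / \<delta>\<rfloor> \<le> x $ i" "x $ i \<le> \<delta> * of_int \<lfloor>x $ i / \<delta>\<rfloor> + \<delta>"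
        using \<delta> by (simp_all add: distrib_left)
    qed
    then show ?thesis by (simp add: mem_box_cart l_def r_def cell_def)
  qed
  have box_cell: "cell x = z" if "x \<in> box (l z) (r z)" for x z
  proof
    fix i
    have "\<delta> * of_int (z i) < x $ i" "x $ i < \<delta> * of_int (z i) + \<delta>"
      using that by (auto simp: mem_box_cart l_def r_def)
    then have "of_int (z i) \<le> x $ i / \<delta>" "x $ i / \<delta> < of_int (z i) + 1"
      using \<delta> by (simp_all add: field_simps)
    then show "cell x i = z i" unfolding cell_def by (rule floor_unique)
  qed
  have finZ: "finite Z"
  proof -
    obtain B where B: "\<And>x. x \<in> K \<Longrightarrow> norm x \<le> B" using K(1) compact_imp_bounded bounded_iff by metis
    have "Z \<subseteq> PiE UNIV (\<lambda>_. {\<lfloor>- B / \<delta>\<rfloor>..\<lfloor>B / \<delta>\<rfloor>})"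
    proof
      fix z assume "z \<in> Z"
      then obtain x where x: "x \<in> K" "z = cell x" by (auto simp: Z_def)
      have "- B \<le> x $ i \<and> x $ i \<le> B" for i
        using component_le_norm_cart[of x i] B[OF x(1)] by linarith
      then have "\<lfloor>- B / \<delta>\<rfloor> \<le> \<lfloor>x $ i / \<delta>\<rfloor> \<and> \<lfloor>x $ i / \<delta>\<rfloor> \<le> \<lfloor>B / \<delta>\<rfloor>" for i
        using \<delta> by (intro conjI floor_mono divide_right_mono) auto
      then show "z \<in> PiE UNIV (\<lambda>_. {\<lfloor>- B / \<delta>\<rfloor>..\<lfloor>B / \<delta>\<rfloor>})"
        by (auto simp: x(2) cell_def)
    qed
    then show ?thesis by (rule finite_subset) (auto intro: finite_PiE)
  qed
  have cD: "cbox (l z) (r z) \<subseteq> D" if zZ: "z \<in> Z" for z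
  proof
    obtain x where x: "x \<in> K" "z = cell x" using zZ unfolding Z_def by blast
    fix y assume y: "y \<in> cbox (l z) (r z)"
    have "norm (x - y) \<le> (\<Sum>i\<in>UNIV. \<bar>(x - y) $ i\<bar>)" by (rule norm_le_l1_cart)
    also have "\<dots> \<le> (\<Sum>i\<in>(UNIV::'d set). \<delta>)"
    proof (rule sum_mono)
      fix i
      have "l z $ i \<le> x $ i" "x $ i \<le> r z $ i" "l z $ i \<le> y $ i" "y $ i \<le> r z $ i"
        using y cell[of x] by (auto simp: mem_box_cart x(2))
      then show "\<bar>(x - y) $ i\<bar> \<le> \<delta>" by (simp add: l_def r_def)
    qed
    finally have "norm (x - y) < \<eta>" using \<delta>\<eta> by simp
    then have "y \<in> ball x \<eta>" by (simp add: dist_norm)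
    then show "y \<in> D" using \<eta>(2) x(1) by blast
  qed
  let ?Q = "\<lambda>z. box (l z) (r z)"
  have QD: "?Q z \<in> sets lebesgue \<and> ?Q z \<subseteq> D" if "z \<in> Z" for z
    using cD[OF that] box_subset_cbox by auto
  have rl: "r z $ i = l z $ i + \<delta>" for z i by (simp add: r_def l_def)
  \<comment> \<open>Open cubes miss their faces, so they cover \<open>K\<close> only up to a null
    set.\<close>
  have le1: "AE x in lebesgue. (\<Sum>i\<in>{()}. indicator K x) \<le> (\<Sum>z\<in>Z. indicator (?Q z) x :: real)"
  proof -
    have "(\<Union>z\<in>Z. cbox (l z) (r z) - ?Q z) \<in> null_sets lebesgue"
      using finZ negligible_frontier_interval by (intro null_sets.finite_UN) (auto simp: negligible_iff_null_sets)
    then have "AE x in lebesgue. x \<notin> (\<Union>z\<in>Z. cbox (l z) (r z) - ?Q z)" by (rule AE_not_in)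
    then show ?thesis
    proof eventually_elim
      case (elim x)
      show ?case
      proof (cases "x \<in> K")
        case True
        then have z: "cell x \<in> Z" by (simp add: Z_def)
        then have "x \<in> ?Q (cell x)" using elim cell[of x] by auto
        then have "(1::real) \<le> indicator (?Q (cell x)) x" by simp
        also have "\<dots> \<le> (\<Sum>z\<in>Z. indicator (?Q z) x)" using z finZ by (intro member_le_sum) auto
        finally show ?thesis using True by simp
      qed (simp add: sum_nonneg)
    qed
  qed
  have le2: "AE x in lebesgue. (\<Sum>z\<in>Z. indicator (?Q z) x) \<le> (\<Sum>i\<in>{()}. indicator D x :: real)"
  proof (rule AE_I2)
    fix x
    show "(\<Sum>z\<in>Z. indicator (?Q z) x) \<le> (\<Sum>i\<in>{()}. indicator D x :: real)"
    proof (cases "x \<in> D")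
      case True
      have "(\<Sum>z\<in>Z. indicator (?Q z) x :: real) \<le> (\<Sum>z\<in>Z. if z = cell x then 1 else 0)"
        using box_cell by (intro sum_mono) (auto simp: indicator_def)
      also have "\<dots> \<le> 1" using finZ by simp
      finally show ?thesis using True by simp
    next
      case False
      then have "x \<notin> ?Q z" if "z \<in> Z" for z using QD[OF that] by blast
      then have "(\<Sum>z\<in>Z. indicator (?Q z) x :: real) = 0" by (intro sum.neutral) simp
      then show ?thesis by simp
    qed
  qed
  let ?V = "\<delta> ^ CARD('d)"
  have V: "?V > 0" using \<delta> by simp
  \<comment> \<open>Dividing by the root of the volume makes the square of \<open>k z u\<close> the
    mean term of the Poincare inequality; by Cauchy--Schwarz it is at most the squared norm of
    u.\<close>
  define k where "k z u = (LINT x|lebesgue_on (?Q z). u x) / sqrt ?V" for z and u :: "real^'d \<Rightarrow> real"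
  have k1: "(k z u)\<^sup>2 \<le> 1 * L2_inner D u u" if z: "z \<in> Z" and u: "u \<in> H1 D" for z u
  proof -
    have uQ: "u \<in> L2 (?Q z)" using QD[OF z] by (intro L2_subset[OF H1_L2[OF u] _ _ Ds]) auto
    have "(L2_inner (?Q z) (\<lambda>_. 1) u)\<^sup>2 \<le> L2_inner (?Q z) (\<lambda>_. 1) (\<lambda>_. 1 :: real) * L2_inner (?Q z) u u"
      by (rule L2.Cauchy_Schwarz[OF L2_const[OF cube_measurable(1)[OF \<delta> rl]] uQ])
    then have "(LINT x|lebesgue_on (?Q z). u x)\<^sup>2 \<le> ?V * L2_inner (?Q z) u u"
      using L2_inner_const_cube[OF \<delta> rl uQ, of 1] by simp
    then have "(k z u)\<^sup>2 \<le> L2_inner (?Q z) u u"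
      using V by (simp add: k_def power_divide field_simps)
    also have "\<dots> \<le> L2_inner D u u" using QD[OF z] by (intro L2_inner_mono_set[OF H1_L2[OF u] _ _ Ds]) auto
    finally show ?thesis by simp
  qed
  have k2: "k z (u - v) = k z u - k z v" if z: "z \<in> Z" and u: "u \<in> H1 D" "v \<in> H1 D" for z u v
  proof -
    have "integrable (lebesgue_on (?Q z)) w" if "w \<in> H1 D" for w
      using QD[OF z] cube_measurable(1)[OF \<delta> rl]
      by (intro L2_imp_integrable L2_subset[OF H1_L2[OF that] _ _ Ds]) auto
    then show ?thesis using u by (simp add: k_def diff_divide_distrib)
  qed
  have "L2_inner K u u \<le> \<epsilon> * H1_energy D u + (\<Sum>z\<in>Z. (k z u)\<^sup>2)" if u: "u \<in> H1 D" for u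
  proof -
    let ?g = "weak_grad D u"
    have "L2_inner K u u \<le> (\<Sum>z\<in>Z. L2_inner (?Q z) u u)"
      using L2_inner_le_sum[OF H1_L2[OF u] Ds _ finZ, of "{()}" "\<lambda>_. K" ?Q] le1 QD Km K by simp
    also have "\<dots> \<le> (\<Sum>z\<in>Z. (k z u)\<^sup>2 + c * \<delta>\<^sup>2 * L2_inner (?Q z) ?g ?g)"
    proof (rule sum_mono)
      fix z assume z: "z \<in> Z"
      have "L2_inner (?Q z) u u \<le> (LINT x|lebesgue_on (?Q z). u x)\<^sup>2 / ?V + 2 ^ CARD('d) * ?n\<^sup>2 * \<delta>\<^sup>2 * L2_inner (?Q z) ?g ?g"
        using QD[OF z] by (intro Poincare_cube[OF \<delta> rl] L2_subset[OF H1_L2[OF u] _ _ Ds]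
            L2_subset[OF weak_grad_L2[OF u] _ _ Ds] has_weak_grad_subset[OF has_weak_grad_weak_grad[OF u] _ _ Ds]) auto
      then show "L2_inner (?Q z) u u \<le> (k z u)\<^sup>2 + c * \<delta>\<^sup>2 * L2_inner (?Q z) ?g ?g"
        using V by (simp add: k_def power_divide c_def)
    qed
    also have "\<dots> = (\<Sum>z\<in>Z. (k z u)\<^sup>2) + c * \<delta>\<^sup>2 * (\<Sum>z\<in>Z. L2_inner (?Q z) ?g ?g)"
      by (simp add: sum.distrib sum_distrib_left)
    also have "(\<Sum>z\<in>Z. L2_inner (?Q z) ?g ?g) \<le> L2_inner D ?g ?g"
      using L2_inner_le_sum[OF weak_grad_L2[OF u] Ds finZ, of "{()}" ?Q "\<lambda>_. D"] le2 QD Ds by simp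
    also have "c * \<delta>\<^sup>2 * L2_inner D ?g ?g \<le> \<epsilon> * H1_energy D u"
      using \<delta>\<epsilon> L2.nonneg[OF weak_grad_L2[OF u]] L2.nonneg[OF H1_L2[OF u]] e
      by (intro mult_mono) (auto simp: H1_energy_def grad_inner_def)
    finally show ?thesis using c by (simp add: mult_left_mono)
  qed
  then show "\<exists>(I::('d \<Rightarrow> int) set) l C. finite I
        \<and> (\<forall>i\<in>I. (\<forall>u\<in>H1 D. (l i u)\<^sup>2 \<le> C * L2_inner D u u) \<and> (\<forall>u\<in>H1 D. \<forall>v\<in>H1 D. l i (u - v) = l i u - l i v))
        \<and> (\<forall>u\<in>H1 D. L2_inner K u u \<le> \<epsilon> * H1_energy D u + (\<Sum>i\<in>I. (l i u)\<^sup>2))"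
    using finZ k1 k2 by (intro exI[of _ Z] exI[of _ k] exI[of _ 1]) auto
qed

section \<open>Compactness for the Dirichlet problem\<close>

text \<open>Composing the functionals with a map \<open>P\<close> that respects differences
  transports the estimate. It is applied to extension by zero and to linear changes of
  variables.\<close>

lemma finitely_controlled_pullback:
  assumes fc: "finitely_controlled V h b q"
    and P: "\<And>u. u \<in> W \<Longrightarrow> P u \<in> V" "\<And>u v. u \<in> W \<Longrightarrow> v \<in> W \<Longrightarrow> P (u - v) = P u - P v"
    and K: "K > 0" "\<And>u. u \<in> W \<Longrightarrow> h (P u) \<le> K * h' u" "\<And>u. u \<in> W \<Longrightarrow> b (P u) \<le> K * b' u"
      "\<And>u. u \<in> W \<Longrightarrow> q' u \<le> K * q (P u)" "\<And>u. u \<in> W \<Longrightarrow> 0 \<le> b' u" "\<And>u. u \<in> W \<Longrightarrow> 0 \<le> b (P u)"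
  shows "finitely_controlled W h' b' q'"
proof (rule finitely_controlledI)
  fix \<epsilon> :: real assume e: "\<epsilon> > 0"
  \<comment> \<open>The factor \<open>K\<close> is lost twice, in passing from \<open>q'\<close> to
    \<open>q\<close> and from \<open>h\<close> to \<open>h'\<close>.\<close>
  have "\<epsilon> / K\<^sup>2 > 0" using e K by simp
  from finitely_controlledE[OF fc this] obtain L C where L: "finite L"
    "\<And>l u. l \<in> L \<Longrightarrow> u \<in> V \<Longrightarrow> (l u)\<^sup>2 \<le> C * b u"
    "\<And>l u v. l \<in> L \<Longrightarrow> u \<in> V \<Longrightarrow> v \<in> V \<Longrightarrow> l (u - v) = l u - l v"
    "\<And>u. u \<in> V \<Longrightarrow> q u \<le> \<epsilon> / K\<^sup>2 * h u + (\<Sum>l\<in>L. (l u)\<^sup>2)" by metis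
  define k where "k l u = sqrt K * l (P u)" for l u
  have 1: "(k l u)\<^sup>2 \<le> (K * (\<bar>C\<bar> * K)) * b' u" if "l \<in> L" "u \<in> W" for l u
  proof -
    have "(l (P u))\<^sup>2 \<le> C * b (P u)" using L(2)[OF that(1) P(1)[OF that(2)]] .
    also have "\<dots> \<le> \<bar>C\<bar> * b (P u)" using K(6)[OF that(2)] by (intro mult_right_mono) auto
    also have "\<dots> \<le> \<bar>C\<bar> * (K * b' u)" using K(3)[OF that(2)] by (intro mult_left_mono) auto
    finally show ?thesis using K(1) by (simp add: k_def power_mult_distrib mult.assoc)
  qed
  have 2: "k l (u - v) = k l u - k l v" if "l \<in> L" "u \<in> W" "v \<in> W" for l u v
    using L(3)[OF that(1) P(1)[OF that(2)] P(1)[OF that(3)]] P(2)[OF that(2,3)]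
    by (simp add: k_def right_diff_distrib)
  have 3: "q' u \<le> \<epsilon> * h' u + (\<Sum>l\<in>L. (k l u)\<^sup>2)" if u: "u \<in> W" for u
  proof -
    have "q' u \<le> K * q (P u)" by (rule K(4)[OF u])
    also have "\<dots> \<le> K * (\<epsilon> / K\<^sup>2 * h (P u) + (\<Sum>l\<in>L. (l (P u))\<^sup>2))"
      using L(4)[OF P(1)[OF u]] K(1) by (intro mult_left_mono) auto
    also have "\<dots> = K * (\<epsilon> / K\<^sup>2) * h (P u) + (\<Sum>l\<in>L. (k l u)\<^sup>2)"
      using K(1) by (simp add: k_def power_mult_distrib distrib_left sum_distrib_left)
    also have "K * (\<epsilon> / K\<^sup>2) = \<epsilon> / K" by (simp add: power2_eq_square)
    also have "\<epsilon> / K * h (P u) \<le> \<epsilon> / K * (K * h' u)"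
      using K(2)[OF u] K(1) e by (intro mult_left_mono) auto
    also have "\<dots> = \<epsilon> * h' u" using K(1) by simp
    finally show ?thesis by simp
  qed
  show "\<exists>(I::('a \<Rightarrow> real) set) l C. finite I
        \<and> (\<forall>i\<in>I. (\<forall>u\<in>W. (l i u)\<^sup>2 \<le> C * b' u) \<and> (\<forall>u\<in>W. \<forall>v\<in>W. l i (u - v) = l i u - l i v))
        \<and> (\<forall>u\<in>W. q' u \<le> \<epsilon> * h' u + (\<Sum>i\<in>I. (l i u)\<^sup>2))"
    using L(1) 1 2 3
    by (intro exI[of _ L] exI[of _ k] exI[of _ "K * (\<bar>C\<bar> * K)"]) simp
qed

lemma H1_norm_eq: "H1_norm D u = sqrt (H1_energy D u)"
  unfolding H1_norm_def H1_energy_def grad_inner_def L2_inner_eq_norm by (simp add: add.commute)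

lemma semi_inner_H1_energy:
  assumes D: "open D" "bounded D"
  shows "semi_inner (H1 D) (\<lambda>u v. grad_inner D u v + L2_inner D u v)"
proof -
  interpret G: semi_inner "H1 D" "grad_inner D" by (rule semi_inner_grad[OF D])
  show ?thesis
    by standard (auto simp: G.subspace G.sym G.add G.scale L2.sym L2.add L2.scale H1_L2 distrib_left
        intro!: add_nonneg_nonneg[OF G.nonneg L2.nonneg[OF H1_L2]])
qed

lemma H1_0_iff:
  "u \<in> H1_0 D \<longleftrightarrow> u \<in> H1 D \<and> (\<forall>\<epsilon>>0. \<exists>\<phi>\<in>test_functions D. H1_energy D (u - \<phi>) < \<epsilon>)" (is "?L \<longleftrightarrow> ?R")
proof
  assume L: ?L
  have "\<exists>\<phi>\<in>test_functions D. H1_energy D (u - \<phi>) < \<epsilon>" if "\<epsilon> > 0" for \<epsilon>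
  proof -
    obtain \<phi> where "\<phi> \<in> test_functions D" "H1_norm D (\<lambda>x. u x - \<phi> x) < sqrt \<epsilon>"
      using L \<open>\<epsilon> > 0\<close> unfolding H1_0_def by (auto dest!: spec[of _ "sqrt \<epsilon>"])
    then show ?thesis by (auto simp: H1_norm_eq fun_diff_def)
  qed
  then show ?R using L by (simp add: H1_0_def)
next
  assume R: ?R
  have "\<exists>\<phi>\<in>test_functions D. H1_norm D (\<lambda>x. u x - \<phi> x) < \<epsilon>" if "\<epsilon> > 0" for \<epsilon>
  proof -
    obtain \<phi> where \<phi>: "\<phi> \<in> test_functions D" "H1_energy D (u - \<phi>) < \<epsilon>\<^sup>2"
      using R \<open>\<epsilon> > 0\<close> by (auto dest!: spec[of _ "\<epsilon>\<^sup>2"])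
    have "sqrt (H1_energy D (u - \<phi>)) < sqrt (\<epsilon>\<^sup>2)" using \<phi>(2) by (rule real_sqrt_less_mono)
    then show ?thesis using \<open>\<epsilon> > 0\<close> \<phi>(1)
      by (intro bexI[of _ \<phi>]) (auto simp: H1_norm_eq fun_diff_def)
  qed
  then show ?L using R by (simp add: H1_0_def)
qed

lemma H1_0_H1: "u \<in> H1_0 D \<Longrightarrow> u \<in> H1 D"
  by (simp add: H1_0_iff)

lemma test_functions_H1_0:
  assumes D: "open D" "bounded D" and \<phi>: "\<phi> \<in> test_functions D" shows "\<phi> \<in> H1_0 D"
proof -
  have Dm: "D \<in> lmeasurable" using D by (simp add: lmeasurable_open)
  interpret E: semi_inner "H1 D" "\<lambda>u v. grad_inner D u v + L2_inner D u v" by (rule semi_inner_H1_energy[OF D])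
  have "H1_energy D (\<phi> - \<phi>) = 0"
    using E.zero[OF E.V_zero] by (simp add: H1_energy_def)
  then show ?thesis using test_functions_H1[OF \<phi> Dm D(2)] \<phi> by (force simp: H1_0_iff)
qed

lemma H1_0_closed:
  assumes D: "open D" "bounded D" and u: "u \<in> H1 D"
    and v: "\<And>e. e > 0 \<Longrightarrow> \<exists>v\<in>H1_0 D. H1_energy D (u - v) < e"
  shows "u \<in> H1_0 D"
proof -
  have Dm: "D \<in> lmeasurable" using D by (simp add: lmeasurable_open)
  interpret E: semi_inner "H1 D" "\<lambda>u v. grad_inner D u v + L2_inner D u v" by (rule semi_inner_H1_energy[OF D])
  have "\<exists>\<phi>\<in>test_functions D. H1_energy D (u - \<phi>) < e" if "e > 0" for e
  proof -
    obtain v where v: "v \<in> H1_0 D" "H1_energy D (u - v) < e / 4" using v[of "e / 4"] \<open>e > 0\<close> by auto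
    then obtain \<phi> where \<phi>: "\<phi> \<in> test_functions D" "H1_energy D (v - \<phi>) < e / 4"
      using \<open>e > 0\<close> by (auto simp: H1_0_iff dest!: spec[of _ "e / 4"])
    have "H1_energy D ((u - v) + (v - \<phi>)) \<le> 2 * H1_energy D (u - v) + 2 * H1_energy D (v - \<phi>)"
      using E.sq_add_le[of "u - v" "v - \<phi>"] u H1_0_H1[OF v(1)] test_functions_H1[OF \<phi>(1) Dm D(2)]
      by (simp add: H1_energy_def E.V_diff)
    then show ?thesis using v \<phi> by (intro bexI[of _ \<phi>]) auto
  qed
  then show ?thesis using u by (simp add: H1_0_iff)
qed

lemma subspace_H1_0:
  assumes D: "open D" "bounded D" shows "subspace (H1_0 D)"
  unfolding subspace_def
proof (intro conjI ballI allI)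
  have Dm: "D \<in> lmeasurable" using D by (simp add: lmeasurable_open)
  interpret E: semi_inner "H1 D" "\<lambda>u v. grad_inner D u v + L2_inner D u v" by (rule semi_inner_H1_energy[OF D])
  note S = subspace_test_functions[of D]
  have tH: "\<phi> \<in> H1 D" if "\<phi> \<in> test_functions D" for \<phi> by (rule test_functions_H1[OF that Dm D(2)])
  show "0 \<in> H1_0 D" by (rule test_functions_H1_0[OF D subspace_0[OF S]])
  fix u v assume u: "u \<in> H1_0 D" and v: "v \<in> H1_0 D"
  show "u + v \<in> H1_0 D"
  proof (rule H1_0_closed[OF D])
    show "u + v \<in> H1 D" by (intro E.V_add H1_0_H1 u v)
    fix e :: real assume "e > 0"
    then obtain \<phi> \<psi> where p: "\<phi> \<in> test_functions D" "H1_energy D (u - \<phi>) < e / 4"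
      "\<psi> \<in> test_functions D" "H1_energy D (v - \<psi>) < e / 4"
      using u v by (auto simp: H1_0_iff dest!: spec[of _ "e / 4"])
    have "H1_energy D ((u - \<phi>) + (v - \<psi>)) \<le> 2 * H1_energy D (u - \<phi>) + 2 * H1_energy D (v - \<psi>)"
      using E.sq_add_le[of "u - \<phi>" "v - \<psi>"] H1_0_H1[OF u] H1_0_H1[OF v] tH p
      by (simp add: H1_energy_def E.V_diff)
    moreover have "(u - \<phi>) + (v - \<psi>) = (u + v) - (\<phi> + \<psi>)" by simp
    ultimately have "H1_energy D ((u + v) - (\<phi> + \<psi>)) < e" using p by simp
    then show "\<exists>w\<in>H1_0 D. H1_energy D (u + v - w) < e"
      using test_functions_H1_0[OF D subspace_add[OF S p(1,3)]] by blast
  qed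
next
  have Dm: "D \<in> lmeasurable" using D by (simp add: lmeasurable_open)
  interpret E: semi_inner "H1 D" "\<lambda>u v. grad_inner D u v + L2_inner D u v" by (rule semi_inner_H1_energy[OF D])
  fix c u assume u: "u \<in> H1_0 D"
  show "c *\<^sub>R u \<in> H1_0 D"
  proof (rule H1_0_closed[OF D])
    show "c *\<^sub>R u \<in> H1 D" by (intro E.V_scale H1_0_H1 u)
    fix e :: real assume e: "e > 0"
    have c: "c\<^sup>2 + 1 > 0" by (simp add: add_nonneg_pos)
    then obtain \<phi> where p: "\<phi> \<in> test_functions D" "H1_energy D (u - \<phi>) < e / (c\<^sup>2 + 1)"
      using u e by (auto simp: H1_0_iff dest!: spec[of _ "e / (c\<^sup>2 + 1)"])
    have V: "u - \<phi> \<in> H1 D" by (intro E.V_diff H1_0_H1 u test_functions_H1[OF p(1) Dm D(2)])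
    have "H1_energy D (c *\<^sub>R u - c *\<^sub>R \<phi>) = c\<^sup>2 * H1_energy D (u - \<phi>)"
      using E.sq_scale[OF V, of c] by (simp add: H1_energy_def scaleR_diff_right)
    also have "\<dots> \<le> c\<^sup>2 * (e / (c\<^sup>2 + 1))" using p by (intro mult_left_mono) auto
    also have "\<dots> < e" using e c by (simp add: pos_divide_less_eq algebra_simps)
    finally show "\<exists>w\<in>H1_0 D. H1_energy D (c *\<^sub>R u - w) < e"
      using test_functions_H1_0[OF D subspace_scale[OF subspace_test_functions p(1), of c]] by blast
  qed
qed

section \<open>Extension by zero\<close>

definition zero_ext :: "(real^'d) set \<Rightarrow> (real^'d \<Rightarrow> 'b::real_vector) \<Rightarrow> real^'d \<Rightarrow> 'b" where
  "zero_ext D f x = (if x \<in> D then f x else 0)"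

lemma
  fixes f :: "real^'d \<Rightarrow> 'b::euclidean_space"
  assumes f: "f \<in> L2 D" and DB: "D \<subseteq> B" "D \<in> sets lebesgue" "B \<in> sets lebesgue"
  shows zero_ext_L2: "zero_ext D f \<in> L2 B"
    and L2_inner_zero_ext: "L2_inner B (zero_ext D f) g = L2_inner D f g"
proof -
  have eq: "indicator B x *\<^sub>R zero_ext D f x = indicator D x *\<^sub>R f x" for x
    using DB(1) by (auto simp: zero_ext_def indicator_def)
  have m: "zero_ext D f \<in> borel_measurable (lebesgue_on B)"
    using L2_measurable[OF f] DB by (simp add: borel_measurable_restrict_space_iff eq)
  have "integrable (lebesgue_on B) (\<lambda>x. (norm (zero_ext D f x))\<^sup>2)"
  proof -
    have "indicator B x *\<^sub>R (norm (zero_ext D f x))\<^sup>2 = indicator D x *\<^sub>R (norm (f x))\<^sup>2" for x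
      using DB(1) by (auto simp: zero_ext_def indicator_def)
    then show ?thesis
      using L2_integrable[OF f] DB by (simp add: integrable_restrict_space del: real_scaleR_def)
  qed
  then show "zero_ext D f \<in> L2 B" using m by (simp add: L2_def)
  have "indicator B x *\<^sub>R (zero_ext D f x \<bullet> g x) = indicator D x *\<^sub>R (f x \<bullet> g x)" for x
    using DB(1) by (auto simp: zero_ext_def indicator_def)
  then show "L2_inner B (zero_ext D f) g = L2_inner D f g"
    unfolding L2_inner_def using DB by (simp add: integral_restrict_space del: real_scaleR_def)
qed

lemma L2_inner_zero_ext_zero_ext:
  fixes f :: "real^'d \<Rightarrow> 'b::euclidean_space"
  assumes "f \<in> L2 D" "D \<subseteq> B" "D \<in> sets lebesgue" "B \<in> sets lebesgue"
  shows "L2_inner B (zero_ext D f) (zero_ext D f) = L2_inner D f f"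
  unfolding L2_inner_zero_ext[OF assms] by (rule L2_inner_cong) (auto simp: zero_ext_def)

text \<open>For test functions on \<open>D\<close> this is integration by parts on \<open>B\<close>,
  and the identity passes to limits in energy. The Dirichlet condition is decisive here: the
  extension of a general element of \<open>H1 D\<close> may jump across the boundary.\<close>

lemma zero_ext_weak_grad:
  assumes D: "open D" "bounded D" and B: "open B" "bounded B" and DB: "D \<subseteq> B" and u: "u \<in> H1_0 D"
  shows "has_weak_grad B (zero_ext D u) (zero_ext D (weak_grad D u))"
  unfolding has_weak_grad_iff
proof (intro ballI allI)
  fix \<psi> i assume \<psi>: "\<psi> \<in> test_functions B"
  have Dm: "D \<in> lmeasurable" and Bm: "B \<in> lmeasurable" using D B by (auto simp: lmeasurable_open)
  then have Ds: "D \<in> sets lebesgue" and Bs: "B \<in> sets lebesgue" by auto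
  have uH: "u \<in> H1 D" by (rule H1_0_H1[OF u])
  interpret E: semi_inner "H1 D" "\<lambda>u v. grad_inner D u v + L2_inner D u v" by (rule semi_inner_H1_energy[OF D])
  let ?g = "weak_grad D u"
  have "\<forall>n. \<exists>\<phi>\<in>test_functions D. H1_energy D (u - \<phi>) < 1 / Suc n" using u by (simp add: H1_0_iff)
  then obtain \<phi> where \<phi>: "\<And>n. \<phi> n \<in> test_functions D" "\<And>n. H1_energy D (u - \<phi> n) < 1 / Suc n" by metis
  have \<phi>2: "\<phi> n \<in> L2 D" for n by (rule test_functions_L2[OF \<phi>(1) Dm])
  note g2 = weak_grad_L2[OF uH] and u2 = H1_L2[OF uH]
  have cg: "classical_grad (\<phi> n) \<in> L2 D" for n by (rule classical_grad_L2[OF \<phi>(1) Dm])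
  have energy: "H1_energy D (u - \<phi> n) = L2_inner D (?g - classical_grad (\<phi> n)) (?g - classical_grad (\<phi> n)) + L2_inner D (u - \<phi> n) (u - \<phi> n)" for n
  proof -
    have "has_weak_grad D (u + (-1) *\<^sub>R \<phi> n) (?g + (-1) *\<^sub>R classical_grad (\<phi> n))"
      by (intro has_weak_grad_add has_weak_grad_scale Dm u2 g2 L2.V_scale \<phi>2 cg
          has_weak_grad_weak_grad uH has_weak_grad_test_function[OF \<phi>(1)] D)
    then have w: "has_weak_grad D (u - \<phi> n) (?g - classical_grad (\<phi> n))" by simp
    show ?thesis
      unfolding H1_energy_def using grad_inner_eq[OF D _ _ w _ _ w] u2 g2 \<phi>2 cg by (simp add: L2.V_diff)
  qed
  have sq: "(\<lambda>n. 1 / real (Suc n)) \<longlonglongrightarrow> 0" using LIMSEQ_inverse_real_of_nat by (simp add: inverse_eq_divide)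
  have lim1: "(\<lambda>n. L2_inner D (\<phi> n - u) (\<phi> n - u)) \<longlonglongrightarrow> 0"
  proof (rule tendsto_sandwich[OF _ _ tendsto_const sq])
    show "\<forall>\<^sub>F n in sequentially. 0 \<le> L2_inner D (\<phi> n - u) (\<phi> n - u)"
      by (intro always_eventually allI L2.nonneg L2.V_diff \<phi>2 u2)
    have "L2_inner D (\<phi> n - u) (\<phi> n - u) \<le> 1 / real (Suc n)" for n
      using \<phi>(2)[of n] energy[of n] L2.nonneg[OF L2.V_diff[OF g2 cg], of n]
        L2.sq_diff[OF \<phi>2 u2, of n] L2.sq_diff[OF u2 \<phi>2, of n] L2.sym[OF u2 \<phi>2, of n] by linarith
    then show "\<forall>\<^sub>F n in sequentially. L2_inner D (\<phi> n - u) (\<phi> n - u) \<le> 1 / real (Suc n)" by simp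
  qed
  have lim2: "(\<lambda>n. L2_inner D (classical_grad (\<phi> n) - ?g) (classical_grad (\<phi> n) - ?g)) \<longlonglongrightarrow> 0"
  proof (rule tendsto_sandwich[OF _ _ tendsto_const sq])
    show "\<forall>\<^sub>F n in sequentially. 0 \<le> L2_inner D (classical_grad (\<phi> n) - ?g) (classical_grad (\<phi> n) - ?g)"
      by (intro always_eventually allI L2.nonneg L2.V_diff cg g2)
    have "L2_inner D (classical_grad (\<phi> n) - ?g) (classical_grad (\<phi> n) - ?g) \<le> 1 / real (Suc n)" for n
      using \<phi>(2)[of n] energy[of n] L2.nonneg[OF L2.V_diff[OF u2 \<phi>2], of n]
        L2.sq_diff[OF cg g2, of n] L2.sq_diff[OF g2 cg, of n] L2.sym[OF g2 cg, of n] by linarith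
    then show "\<forall>\<^sub>F n in sequentially. L2_inner D (classical_grad (\<phi> n) - ?g) (classical_grad (\<phi> n) - ?g) \<le> 1 / real (Suc n)"
      by simp
  qed
  have p\<psi>: "partial_deriv i \<psi> \<in> L2 D" "\<psi> \<in> L2 D"
    by (rule test_functions_L2[OF partial_deriv_test_function[OF \<psi>] Dm])
      (rule test_functions_L2[OF \<psi> Dm])
  \<comment> \<open>Pairing with this vector field selects the i-th component, so that convergence
    of the whole gradient can be used directly.\<close>
  define e where "e = (\<lambda>x::real^'a. \<psi> x *\<^sub>R (axis i 1 :: real^'a))"
  have e2: "e \<in> L2 D"
  proof (rule L2_vecI)
    fix j
    have "(\<lambda>x. e x $ j) = (axis i 1 $ j) *\<^sub>R \<psi>" by (simp add: e_def fun_eq_iff mult.commute)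
    then show "(\<lambda>x. e x $ j) \<in> L2 D" using L2.V_scale[OF p\<psi>(2)] by metis
  qed
  have comp: "L2_inner D g e = L2_inner D (\<lambda>x. g x $ i) \<psi>" for g
    by (simp add: L2_inner_def e_def inner_axis mult.commute)
  have ibp: "L2_inner D (\<phi> n) (partial_deriv i \<psi>) = - L2_inner D (classical_grad (\<phi> n)) e" for n
  proof -
    have "L2_inner B (\<phi> n) (partial_deriv i \<psi>) = - L2_inner B (partial_deriv i (\<phi> n)) \<psi>"
      by (rule integration_by_parts_test_functions[OF \<phi>(1) \<psi> Bm B(2)])
    moreover have "L2_inner B f h = L2_inner D f h" if "\<And>x. x \<notin> D \<Longrightarrow> f x = 0" for f h :: "real^'a \<Rightarrow> real"
      unfolding L2_inner_def using that DB Ds Bs by (subst (1 2) integral_lebesgue_on_eq_UNIV) auto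
    ultimately show ?thesis
      using test_functions_outside[OF \<phi>(1)] test_functions_outside[OF partial_deriv_test_function[OF \<phi>(1)]]
      by (simp add: comp classical_grad_def)
  qed
  have "L2_inner D u (partial_deriv i \<psi>) = - L2_inner D ?g e"
  proof (rule LIMSEQ_unique)
    show "(\<lambda>n. L2_inner D (\<phi> n) (partial_deriv i \<psi>)) \<longlonglongrightarrow> L2_inner D u (partial_deriv i \<psi>)"
      by (rule L2.tendsto_inner[OF \<phi>2 u2 p\<psi>(1) lim1])
    show "(\<lambda>n. L2_inner D (\<phi> n) (partial_deriv i \<psi>)) \<longlonglongrightarrow> - L2_inner D ?g e"
      unfolding ibp by (intro tendsto_minus L2.tendsto_inner[OF cg g2 e2 lim2])
  qed
  then have "L2_inner D u (partial_deriv i \<psi>) = - L2_inner D (\<lambda>x. ?g x $ i) \<psi>" by (simp add: comp)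
  moreover have "(\<lambda>x. zero_ext D ?g x $ i) = zero_ext D (\<lambda>x. ?g x $ i)" by (auto simp: zero_ext_def)
  ultimately show "L2_inner B (zero_ext D u) (partial_deriv i \<psi>) = - L2_inner B (\<lambda>x. zero_ext D ?g x $ i) \<psi>"
    by (simp add: L2_inner_zero_ext u2 L2_nth[OF g2] DB Ds Bs)
qed

definition compactly_embedded :: "(real^'d) set \<Rightarrow> (real^'d \<Rightarrow> real) set \<Rightarrow> bool" where
  "compactly_embedded D V \<longleftrightarrow>
     finitely_controlled V (H1_energy D) (\<lambda>u. L2_inner D u u) (\<lambda>u. L2_inner D u u)"

text \<open>Extended by zero to a ball around the closure of \<open>D\<close>, the functions fall
  under the interior estimate, with the closure as compact set. The extension preserves both parts
  of the energy.\<close>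

lemma compactly_embedded_H1_0:
  assumes D: "open D" "bounded D" shows "compactly_embedded D (H1_0 D)"
proof -
  obtain R where R: "closure D \<subseteq> ball 0 R"
    using bounded_subset_ballD[OF bounded_closure[OF D(2)], of 0] by blast
  let ?B = "ball 0 R :: (real^'a) set" and ?K = "closure D"
  have B: "open ?B" "bounded ?B" by auto
  have DB: "D \<subseteq> ?B" using R closure_subset by blast
  have Dm: "D \<in> lmeasurable" and Bm: "?B \<in> lmeasurable" using D by (auto simp: lmeasurable_open)
  then have Ds: "D \<in> sets lebesgue" and Bs: "?B \<in> sets lebesgue" by auto
  have K: "compact ?K" using D by (simp add: compact_closure)
  have Ks: "?K \<in> sets lebesgue" using lmeasurable_compact[OF K] by blast
  have fc: "finitely_controlled (H1 ?B) (H1_energy ?B) (\<lambda>u. L2_inner ?B u u) (\<lambda>u. L2_inner ?K u u)"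
    by (rule interior_controlled[OF B K R])
  show ?thesis
    unfolding compactly_embedded_def
  proof (rule finitely_controlled_pullback[OF fc, where P="zero_ext D" and K=1])
    fix u assume u: "u \<in> H1_0 D"
    have uH: "u \<in> H1 D" by (rule H1_0_H1[OF u])
    note u2 = H1_L2[OF uH] and g2 = weak_grad_L2[OF uH]
    note Z = zero_ext_L2[OF u2 DB Ds Bs] zero_ext_L2[OF g2 DB Ds Bs] zero_ext_weak_grad[OF D B DB u]
    show zH: "zero_ext D u \<in> H1 ?B" by (rule H1I[OF Z])
    have b: "L2_inner ?B (zero_ext D u) (zero_ext D u) = L2_inner D u u"
      by (rule L2_inner_zero_ext_zero_ext[OF u2 DB Ds Bs])
    then show "L2_inner ?B (zero_ext D u) (zero_ext D u) \<le> 1 * L2_inner D u u" by simp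
    have "grad_inner ?B (zero_ext D u) (zero_ext D u) = grad_inner D u u"
      using grad_inner_eq[OF B Z Z] L2_inner_zero_ext_zero_ext[OF g2 DB Ds Bs] by (simp add: grad_inner_def)
    then show "H1_energy ?B (zero_ext D u) \<le> 1 * H1_energy D u" using b by (simp add: H1_energy_def)
    have "L2_inner D u u = L2_inner D (zero_ext D u) (zero_ext D u)"
      by (rule L2_inner_cong) (auto simp: zero_ext_def)
    also have "\<dots> \<le> L2_inner ?K (zero_ext D u) (zero_ext D u)"
      by (rule L2_inner_mono_set[OF zero_ext_L2[OF u2 closure_subset Ds Ks] closure_subset Ds Ks])
    finally show "L2_inner D u u \<le> 1 * L2_inner ?K (zero_ext D u) (zero_ext D u)" by simp
    show "0 \<le> L2_inner D u u" by (rule L2.nonneg[OF u2])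
    show "0 \<le> L2_inner ?B (zero_ext D u) (zero_ext D u)" by (rule L2.nonneg[OF Z(1)])
    fix v
    show "zero_ext D (u - v) = zero_ext D u - zero_ext D v" by (auto simp: zero_ext_def fun_eq_iff)
  qed simp
qed

section \<open>Compactness for the Neumann problem\<close>

text \<open>Near a boundary point, translating by \<open>t e\<close> into the domain moves a piece of the domain that
  touches the boundary to a compact subset of the domain.\<close>
lemma lipschitz_boundary_translate:
  fixes D :: "(real^'d) set"
  assumes D: "open D" "bounded D" and lip: "lipschitz_boundary D" and p: "p \<in> frontier D"
  shows "\<exists>r>0. \<exists>e. norm e = 1 \<and> (\<forall>t. 0 < t \<longrightarrow> t < r \<longrightarrow>
     (\<exists>K. compact K \<and> K \<subseteq> D \<and> (\<forall>x\<in>D \<inter> ball p r. x + t *\<^sub>R e \<in> K)) \<and>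
     (\<forall>x\<in>D \<inter> ball p r. \<forall>s. 0 \<le> s \<longrightarrow> s \<le> 1 \<longrightarrow> x + s *\<^sub>R (t *\<^sub>R e) \<in> D))"
proof -
  obtain R e \<gamma> L where R: "R > 0" "norm e = 1" "L-lipschitz_on {y. y \<bullet> e = 0} \<gamma>"
    and eq: "D \<inter> ball p R = {x \<in> ball p R. \<gamma> (x - (x \<bullet> e) *\<^sub>R e) < x \<bullet> e}"
    using lip p unfolding lipschitz_boundary_def by blast
  have ee: "e \<bullet> e = 1" using R(2) by (simp add: norm_eq_1)
  define P where "P x = x - (x \<bullet> e) *\<^sub>R e" for x
  have P0: "P x \<bullet> e = 0" for x by (simp add: P_def inner_diff_left ee)
  have Pt: "P (x + t *\<^sub>R e) = P x" for x t by (simp add: P_def inner_add_left ee algebra_simps)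
  have et: "(x + t *\<^sub>R e) \<bullet> e = x \<bullet> e + t" for x t by (simp add: inner_add_left ee)
  have cont: "continuous_on UNIV (\<lambda>x. \<gamma> (P x))"
  proof (rule continuous_on_compose2[OF lipschitz_on_continuous_on[OF R(3)]])
    show "continuous_on UNIV P" unfolding P_def by (intro continuous_intros)
  qed (auto simp: P0)
  have inD: "x \<in> D \<longleftrightarrow> \<gamma> (P x) < x \<bullet> e" if "x \<in> ball p R" for x
    using eq that unfolding P_def by blast
  \<comment> \<open>A point within R/3 of \<open>p\<close>, moved by less than R/3, stays within
    2R/3, where the graph description of \<open>D\<close> is valid.\<close>
  let ?r = "R / 3"
  have "(\<exists>K. compact K \<and> K \<subseteq> D \<and> (\<forall>x\<in>D \<inter> ball p ?r. x + t *\<^sub>R e \<in> K)) \<and>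
     (\<forall>x\<in>D \<inter> ball p ?r. \<forall>s. 0 \<le> s \<longrightarrow> s \<le> 1 \<longrightarrow> x + s *\<^sub>R (t *\<^sub>R e) \<in> D)" if t: "0 < t" "t < ?r" for t
  proof
    \<comment> \<open>Height at least \<open>t\<close> above the graph is a closed condition, and
      positivity of \<open>t\<close> keeps these points inside \<open>D\<close>.\<close>
    define K where "K = {x \<in> cball p (2 * R / 3). \<gamma> (P x) + t \<le> x \<bullet> e}"
    have "K = cball p (2 * R / 3) \<inter> {x. \<gamma> (P x) + t \<le> x \<bullet> e}" by (auto simp: K_def)
    moreover have "closed {x. \<gamma> (P x) + t \<le> x \<bullet> e}"
      by (intro closed_Collect_le continuous_intros cont)
    ultimately have "compact K" by (simp add: compact_Int_closed)
    moreover have "K \<subseteq> D"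
    proof
      fix x assume x: "x \<in> K"
      then have "x \<in> ball p R" using R(1) by (auto simp: K_def)
      then show "x \<in> D" using x t by (subst inD) (auto simp: K_def)
    qed
    moreover have "x + t *\<^sub>R e \<in> K" if x: "x \<in> D \<inter> ball p ?r" for x
    proof -
      have "dist p (x + t *\<^sub>R e) \<le> dist p x + t"
        using dist_triangle[of p "x + t *\<^sub>R e" x] R(2) t by (simp add: dist_norm)
      also have "\<dots> \<le> 2 * R / 3" using x t by simp
      finally have 1: "x + t *\<^sub>R e \<in> cball p (2 * R / 3)" by simp
      have "x \<in> ball p R" using x R(1) by auto
      then have "\<gamma> (P x) < x \<bullet> e" using inD x by blast
      then show ?thesis using 1 by (simp add: K_def Pt et)
    qed
    ultimately show "\<exists>K. compact K \<and> K \<subseteq> D \<and> (\<forall>x\<in>D \<inter> ball p ?r. x + t *\<^sub>R e \<in> K)" by blast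
    show "\<forall>x\<in>D \<inter> ball p ?r. \<forall>s. 0 \<le> s \<longrightarrow> s \<le> 1 \<longrightarrow> x + s *\<^sub>R (t *\<^sub>R e) \<in> D"
    proof (intro ballI allI impI)
      fix x s :: _ assume x: "x \<in> D \<inter> ball p ?r" and s: "0 \<le> (s::real)" "s \<le> 1"
      have st: "0 \<le> s * t" "s * t \<le> t" using s t by (auto simp: mult_left_le_one_le)
      have "dist p (x + (s * t) *\<^sub>R e) \<le> dist p x + s * t"
        using dist_triangle[of p "x + (s * t) *\<^sub>R e" x] R(2) st by (simp add: dist_norm)
      also have "\<dots> < R"
      proof -
        have "dist p x < R / 3" using x by simp
        then show ?thesis using t st by linarith
      qed
      finally have 1: "x + (s * t) *\<^sub>R e \<in> ball p R" by simp
      have "x \<in> ball p R" using x R(1) by auto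
      then have "\<gamma> (P x) < x \<bullet> e" using inD x by blast
      then show "x + s *\<^sub>R (t *\<^sub>R e) \<in> D" using inD[OF 1] st by (simp add: Pt et)
    qed
  qed
  then show ?thesis using R by (intro exI[of _ ?r] conjI exI[of _ e]) auto
qed

text \<open>On \<open>W\<close> the function is compared with its translate. The difference costs
  the squared length of the translation times the gradient energy, and the translate sees only
  values on a compact subset of \<open>D\<close>, where the interior estimate applies.\<close>

lemma boundary_controlled:
  fixes D :: "(real^'d) set"
  assumes D: "open D" "bounded D" and W: "open W" "W \<subseteq> D" and r: "r > 0" and e: "norm e = 1"
    and K: "\<And>t. 0 < t \<Longrightarrow> t < r \<Longrightarrow> \<exists>K. compact K \<and> K \<subseteq> D \<and> (\<forall>x\<in>W. x + t *\<^sub>R e \<in> K)"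
    and seg: "\<And>t x s. 0 < t \<Longrightarrow> t < r \<Longrightarrow> x \<in> W \<Longrightarrow> 0 \<le> s \<Longrightarrow> s \<le> 1 \<Longrightarrow> x + s *\<^sub>R (t *\<^sub>R e) \<in> D"
  shows "finitely_controlled (H1 D) (H1_energy D) (\<lambda>u. L2_inner D u u) (\<lambda>u. L2_inner W u u)"
proof (rule finitely_controlled_approx[of 2])
  fix \<epsilon> :: real assume \<epsilon>: "\<epsilon> > 0"
  have Dm: "D \<in> lmeasurable" using D by (simp add: lmeasurable_open)
  then have Ds: "D \<in> sets lebesgue" by auto
  have Ws: "W \<in> sets lebesgue" using W by auto
  \<comment> \<open>The bounds keep the translation admissible and make \<open>2 * t\<^sup>2\<close>
    at most \<epsilon>.\<close>
  define t where "t = min (r / 2) (min 1 (\<epsilon> / 2))"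
  have t: "0 < t" "t < r" "t \<le> 1" "t \<le> \<epsilon> / 2" using r \<epsilon> by (auto simp: t_def)
  have t2: "2 * t\<^sup>2 \<le> \<epsilon>"
  proof -
    have "t\<^sup>2 \<le> t * 1" unfolding power2_eq_square using t by (intro mult_left_mono) auto
    then show ?thesis using t by simp
  qed
  let ?h = "t *\<^sub>R e"
  obtain K where K: "compact K" "K \<subseteq> D" "\<And>x. x \<in> W \<Longrightarrow> x + ?h \<in> K" using K[OF t(1,2)] by blast
  have Ks: "K \<in> sets lebesgue" using lmeasurable_compact[OF K(1)] by blast
  have shift: "(\<lambda>x. x + ?h) ` W \<in> sets lebesgue"
    using open_translation[OF W(1), of ?h] by (simp add: add.commute image_def)
  have "L2_inner W u u \<le> \<epsilon> * H1_energy D u + 2 * L2_inner K u u" if u: "u \<in> H1 D" for u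
  proof -
    note u2 = H1_L2[OF u] and g2 = weak_grad_L2[OF u]
    note T = translation_estimate[OF D W(1) seg[OF t(1,2)] u2 g2 has_weak_grad_weak_grad[OF u]]
    have uW: "u \<in> L2 W" by (rule L2_subset[OF u2 W(2) Ws Ds])
    let ?v = "\<lambda>x. u (x + ?h)"
    have "u = ?v - (?v - u)" by (simp add: fun_eq_iff)
    then have "L2_inner W u u \<le> 2 * L2_inner W ?v ?v + 2 * L2_inner W (?v - u) (?v - u)"
      using L2.sq_diff_le[OF T(1) L2.V_diff[OF T(1) uW]] by simp
    also have "L2_inner W (?v - u) (?v - u) \<le> t\<^sup>2 * grad_inner D u u"
      using T(2) e by (simp add: grad_inner_def)
    also have "L2_inner W ?v ?v \<le> L2_inner K u u"
    proof -
      have sub: "(\<lambda>x. x + ?h) ` W \<subseteq> K" using K(3) by auto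
      have uK: "u \<in> L2 K" by (rule L2_subset[OF u2 K(2) Ks Ds])
      have us: "u \<in> L2 ((\<lambda>x. x + ?h) ` W)" by (rule L2_subset[OF uK sub shift Ks])
      have "L2_inner W ?v ?v = L2_inner ((\<lambda>x. x + ?h) ` W) u u"
        using L2_inner_scaling[OF scales_lebesgue_translation Ws shift us us] by simp
      also have "\<dots> \<le> L2_inner K u u" by (rule L2_inner_mono_set[OF uK sub shift Ks])
      finally show ?thesis .
    qed
    also have "2 * (t\<^sup>2 * grad_inner D u u) \<le> \<epsilon> * H1_energy D u"
    proof -
      have "2 * t\<^sup>2 * grad_inner D u u \<le> \<epsilon> * H1_energy D u"
        using t2 \<epsilon> L2.nonneg[OF g2] L2.nonneg[OF u2]
        by (intro mult_mono) (auto simp: H1_energy_def grad_inner_def)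
      then show ?thesis by simp
    qed
    finally show ?thesis by simp
  qed
  then show "\<exists>q. finitely_controlled (H1 D) (H1_energy D) (\<lambda>u. L2_inner D u u) q \<and>
      (\<forall>u\<in>H1 D. L2_inner W u u \<le> \<epsilon> * H1_energy D u + 2 * q u)"
    using interior_controlled[OF D K(1,2)] by blast
qed simp

text \<open>Finitely many balls from the translation argument cover the compact boundary; the rest
  of the closure is a compact subset of the open set \<open>D\<close>.\<close>

lemma compactly_embedded_H1:
  fixes D :: "(real^'d) set"
  assumes D: "open D" "bounded D" and lip: "lipschitz_boundary D"
  shows "compactly_embedded D (H1 D)"
proof -
  have Dm: "D \<in> lmeasurable" using D by (simp add: lmeasurable_open)
  then have Ds: "D \<in> sets lebesgue" by auto
  have cF: "compact (frontier D)" using D(2) by (simp add: compact_frontier_bounded)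
  have "\<forall>p\<in>frontier D. \<exists>r>0. finitely_controlled (H1 D) (H1_energy D) (\<lambda>u. L2_inner D u u) (\<lambda>u. L2_inner (D \<inter> ball p r) u u)"
  proof
    fix p assume p: "p \<in> frontier D"
    from lipschitz_boundary_translate[OF D lip p] obtain r e where r: "r > 0" "norm e = 1"
      and H: "\<forall>t. 0 < t \<longrightarrow> t < r \<longrightarrow>
        (\<exists>K. compact K \<and> K \<subseteq> D \<and> (\<forall>x\<in>D \<inter> ball p r. x + t *\<^sub>R e \<in> K)) \<and>
        (\<forall>x\<in>D \<inter> ball p r. \<forall>s. 0 \<le> s \<longrightarrow> s \<le> 1 \<longrightarrow> x + s *\<^sub>R (t *\<^sub>R e) \<in> D)"
      by (elim exE conjE)
    have K: "\<exists>K. compact K \<and> K \<subseteq> D \<and> (\<forall>x\<in>D \<inter> ball p r. x + t *\<^sub>R e \<in> K)" if "0 < t" "t < r" for t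
      using H that by simp
    have seg: "x + s *\<^sub>R (t *\<^sub>R e) \<in> D" if "0 < t" "t < r" "x \<in> D \<inter> ball p r" "0 \<le> s" "s \<le> 1" for t x s
      using H that by simp
    have "finitely_controlled (H1 D) (H1_energy D) (\<lambda>u. L2_inner D u u) (\<lambda>u. L2_inner (D \<inter> ball p r) u u)"
      by (rule boundary_controlled[OF D _ _ r K seg]) (use D in auto)
    then show "\<exists>r>0. finitely_controlled (H1 D) (H1_energy D) (\<lambda>u. L2_inner D u u) (\<lambda>u. L2_inner (D \<inter> ball p r) u u)"
      using r(1) by blast
  qed
  from bchoice[OF this] obtain r where r: "\<And>p. p \<in> frontier D \<Longrightarrow> r p > 0"
    "\<And>p. p \<in> frontier D \<Longrightarrow> finitely_controlled (H1 D) (H1_energy D) (\<lambda>u. L2_inner D u u) (\<lambda>u. L2_inner (D \<inter> ball p (r p)) u u)"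
    by blast
  obtain P where P: "P \<subseteq> frontier D" "finite P" "frontier D \<subseteq> (\<Union>p\<in>P. ball p (r p))"
    using compactE_image[OF cF, of "frontier D" "\<lambda>p. ball p (r p)"] r(1) by force
  define K where "K = closure D - (\<Union>p\<in>P. ball p (r p))"
  have cK: "compact K"
    unfolding K_def using D(2) by (intro compact_diff) (auto simp: compact_closure)
  have KD: "K \<subseteq> D"
    using P(3) D(1) unfolding K_def frontier_def by (auto simp: interior_open)
  have Ks: "K \<in> sets lebesgue" using lmeasurable_compact[OF cK] by blast
  \<comment> \<open>\<open>None\<close> stands for the compact interior piece, \<open>Some p\<close>
    for the boundary piece at p.\<close>
  define A where "A j = (case j of None \<Rightarrow> K | Some p \<Rightarrow> D \<inter> ball p (r p))" for j
  let ?J = "insert None (Some ` P)"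
  have finJ: "finite ?J" using P(2) by simp
  have AD: "A j \<in> sets lebesgue \<and> A j \<subseteq> D" if "j \<in> ?J" for j
  proof -
    have "D \<inter> ball p (r p) \<in> sets lebesgue" for p by (intro sets.Int Ds) simp
    then show ?thesis using that Ks KD by (auto simp: A_def)
  qed
  have le: "AE x in lebesgue. (\<Sum>i\<in>{()}. indicator D x) \<le> (\<Sum>j\<in>?J. indicator (A j) x :: real)"
  proof (rule AE_I2)
    fix x
    show "(\<Sum>i\<in>{()}. indicator D x) \<le> (\<Sum>j\<in>?J. indicator (A j) x :: real)"
    proof (cases "x \<in> D")
      case True
      have "\<exists>j\<in>?J. x \<in> A j"
      proof (cases "x \<in> K")
        case False
        then obtain p where "p \<in> P" "x \<in> ball p (r p)" using True closure_subset unfolding K_def by blast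
        then show ?thesis using True by (intro bexI[of _ "Some p"]) (auto simp: A_def)
      qed (auto simp: A_def)
      then obtain j where j: "j \<in> ?J" "x \<in> A j" by blast
      have "(1::real) = indicator (A j) x" using j by simp
      also have "\<dots> \<le> (\<Sum>j\<in>?J. indicator (A j) x)" using j(1) finJ by (intro member_le_sum) auto
      finally show ?thesis using True by simp
    qed (simp add: sum_nonneg)
  qed
  show ?thesis
    unfolding compactly_embedded_def
  proof (rule finitely_controlled_sum[OF finJ, where q="\<lambda>j u. L2_inner (A j) u u"])
    fix j assume "j \<in> ?J"
    then show "finitely_controlled (H1 D) (H1_energy D) (\<lambda>u. L2_inner D u u) (\<lambda>u. L2_inner (A j) u u)"
      using interior_controlled[OF D cK KD] r(2) P(1) by (auto simp: A_def)
  next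
    fix u assume u: "u \<in> H1 D"
    show "0 \<le> H1_energy D u" by (rule H1_energy_nonneg[OF u])
    show "0 \<le> L2_inner D u u" by (rule L2.nonneg[OF H1_L2[OF u]])
    show "L2_inner D u u \<le> (\<Sum>j\<in>?J. L2_inner (A j) u u)"
      using L2_inner_le_sum[OF H1_L2[OF u] Ds _ finJ, of "{()}" "\<lambda>_. D" A] le AD Ds by simp
  qed
qed

section \<open>Completeness\<close>

lemma has_weak_grad_diff:
  assumes "D \<in> lmeasurable" and "u \<in> L2 D" "g \<in> L2 D" "v \<in> L2 D" "h \<in> L2 D"
    and "has_weak_grad D u g" "has_weak_grad D v h"
  shows "has_weak_grad D (u - v) (g - h)"
  using has_weak_grad_add[OF assms(1,2,3) L2.V_scale[OF assms(4)] L2.V_scale[OF assms(5)] assms(6)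
      has_weak_grad_scale[OF assms(1,4,5,7), of "-1"]] by simp

lemma H1_energy_eq:
  assumes "open D" "bounded D" "u \<in> L2 D" "g \<in> L2 D" "has_weak_grad D u g"
  shows "H1_energy D u = L2_inner D g g + L2_inner D u u"
  unfolding H1_energy_def using grad_inner_eq[OF assms assms(3-5)] by simp

text \<open>Functions and weak gradients converge separately in the square mean, and the identity
  defining the weak gradient passes to the limit for each fixed test function.\<close>

lemma H1_complete:
  assumes D: "open D" "bounded D" and X: "\<And>n. X n \<in> H1 D"
    and Cauchy: "\<And>e. e > 0 \<Longrightarrow> \<exists>N. \<forall>m\<ge>N. \<forall>n\<ge>N. H1_energy D (X m - X n) < e"
  shows "\<exists>u\<in>H1 D. (\<lambda>n. H1_energy D (X n - u)) \<longlonglongrightarrow> 0"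
proof -
  have Dm: "D \<in> lmeasurable" using D by (simp add: lmeasurable_open)
  define G where "G n = weak_grad D (X n)" for n
  have X2: "X n \<in> L2 D" and G2: "G n \<in> L2 D" and XG: "has_weak_grad D (X n) (G n)" for n
    using H1_L2[OF X] weak_grad_works[OF X] by (auto simp: G_def)
  have energy: "H1_energy D (X m - X n) = L2_inner D (G m - G n) (G m - G n) + L2_inner D (X m - X n) (X m - X n)" for m n
    by (intro H1_energy_eq D L2.V_diff X2 G2 has_weak_grad_diff Dm XG)
  have le: "L2_inner D (X m - X n) (X m - X n) \<le> H1_energy D (X m - X n)"
    "L2_inner D (G m - G n) (G m - G n) \<le> H1_energy D (X m - X n)" for m n
    unfolding energy using L2.nonneg[OF L2.V_diff[OF X2 X2]] L2.nonneg[OF L2.V_diff[OF G2 G2]] by auto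
  obtain u where u: "u \<in> L2 D" "(\<lambda>n. L2_inner D (X n - u) (X n - u)) \<longlonglongrightarrow> 0"
    using L2_complete[of X D, OF X2] Cauchy le(1) by (meson le_less_trans)
  obtain g where g: "g \<in> L2 D" "(\<lambda>n. L2_inner D (G n - g) (G n - g)) \<longlonglongrightarrow> 0"
    using L2_complete[of G D, OF G2] Cauchy le(2) by (meson le_less_trans)
  have ug: "has_weak_grad D u g"
    unfolding has_weak_grad_iff
  proof (intro ballI allI)
    fix \<phi> i assume \<phi>: "\<phi> \<in> test_functions D"
    note p = test_functions_L2[OF \<phi> Dm] test_functions_L2[OF partial_deriv_test_function[OF \<phi>] Dm, of i]
    define e where "e = (\<lambda>x::real^'a. \<phi> x *\<^sub>R (axis i 1 :: real^'a))"
    have e2: "e \<in> L2 D"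
    proof (rule L2_vecI)
      fix j
      have "(\<lambda>x. e x $ j) = (axis i 1 $ j) *\<^sub>R \<phi>" by (simp add: e_def fun_eq_iff mult.commute)
      then show "(\<lambda>x. e x $ j) \<in> L2 D" using L2.V_scale[OF p(1)] by metis
    qed
    have comp: "L2_inner D h e = L2_inner D (\<lambda>x. h x $ i) \<phi>" for h
      by (simp add: L2_inner_def e_def inner_axis mult.commute)
    have eq: "L2_inner D (X n) (partial_deriv i \<phi>) = - L2_inner D (G n) e" for n
      using has_weak_gradD[OF XG \<phi>] by (simp add: comp)
    have "L2_inner D u (partial_deriv i \<phi>) = - L2_inner D g e"
    proof (rule LIMSEQ_unique)
      show "(\<lambda>n. L2_inner D (X n) (partial_deriv i \<phi>)) \<longlonglongrightarrow> L2_inner D u (partial_deriv i \<phi>)"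
        by (rule L2.tendsto_inner[OF X2 u(1) p(2) u(2)])
      show "(\<lambda>n. L2_inner D (X n) (partial_deriv i \<phi>)) \<longlonglongrightarrow> - L2_inner D g e"
        unfolding eq by (intro tendsto_minus L2.tendsto_inner[OF G2 g(1) e2 g(2)])
    qed
    then show "L2_inner D u (partial_deriv i \<phi>) = - L2_inner D (\<lambda>x. g x $ i) \<phi>" by (simp add: comp)
  qed
  have "H1_energy D (X n - u) = L2_inner D (G n - g) (G n - g) + L2_inner D (X n - u) (X n - u)" for n
    by (intro H1_energy_eq D L2.V_diff X2 G2 u(1) g(1) has_weak_grad_diff Dm XG ug)
  moreover have "(\<lambda>n. L2_inner D (G n - g) (G n - g) + L2_inner D (X n - u) (X n - u)) \<longlonglongrightarrow> 0 + 0"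
    by (intro tendsto_add u(2) g(2))
  ultimately have "(\<lambda>n. H1_energy D (X n - u)) \<longlonglongrightarrow> 0" by simp
  then show ?thesis using H1I[OF u(1) g(1) ug] by blast
qed

text \<open>What the two boundary conditions have in common. Closedness in energy yields
  completeness of the spectral pair, and the test functions make it infinite dimensional.\<close>

definition form_domain :: "(real^'d) set \<Rightarrow> (real^'d \<Rightarrow> real) set \<Rightarrow> bool" where
  "form_domain D V \<longleftrightarrow> subspace V \<and> V \<subseteq> H1 D \<and> test_functions D \<subseteq> V \<and>
     (\<forall>u\<in>H1 D. (\<forall>e>0. \<exists>v\<in>V. H1_energy D (u - v) < e) \<longrightarrow> u \<in> V)"

lemma form_domain_H1:
  assumes "open D" "bounded D" shows "form_domain D (H1 D)"
  unfolding form_domain_def using assms subspace_H1[of D] test_functions_H1[of _ D D]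
  by (auto simp: lmeasurable_open)

lemma form_domain_H1_0:
  assumes D: "open D" "bounded D" shows "form_domain D (H1_0 D)"
  unfolding form_domain_def
  using subspace_H1_0[OF D] H1_0_H1 test_functions_H1_0[OF D] H1_0_closed[OF D] by blast

text \<open>Bumps on disjoint balls, placed along a segment, are orthogonal and only need to be
  normalised.\<close>

lemma exists_orthonormal_test_functions:
  fixes D :: "(real^'d) set" and N :: nat
  assumes D: "open D" "bounded D" "D \<noteq> {}"
  shows "\<exists>f. (\<forall>i<N. f i \<in> test_functions D) \<and>
    (\<forall>i<N. \<forall>j<N. L2_inner D (f i) (f j) = (if i = j then 1 else 0))"
proof -
  have Dm: "D \<in> lmeasurable" using D by (simp add: lmeasurable_open)
  obtain p R where R: "R > 0" "cball p R \<subseteq> D" using D open_contains_cball by blast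
  obtain k :: 'd where True by simp
  define e :: "real^'d" where "e = axis k 1"
  have e: "norm e = 1" by (simp add: e_def)
  \<comment> \<open>Centres are 2 \<rho> apart, so all \<open>N\<close> balls stay within (2N + 1)
    \<rho> = R of \<open>p\<close>.\<close>
  define \<rho> where "\<rho> = R / (2 * N + 1)"
  have \<rho>: "\<rho> > 0" using R by (simp add: \<rho>_def)
  define c where "c i = p + (2 * \<rho> * real i) *\<^sub>R e" for i
  have sub: "cball (c i) \<rho> \<subseteq> D" if "i < N" for i
  proof
    fix x assume x: "x \<in> cball (c i) \<rho>"
    have "dist p x \<le> dist p (c i) + dist (c i) x" by (rule dist_triangle)
    also have "dist p (c i) = 2 * \<rho> * real i" using \<rho> e by (simp add: c_def dist_norm)
    also have "2 * \<rho> * real i + dist (c i) x \<le> \<rho> * (2 * N + 1)"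
    proof -
      have "2 * \<rho> * real i \<le> 2 * \<rho> * real N" using that \<rho> by (intro mult_left_mono) auto
      then show ?thesis using x by (simp add: algebra_simps)
    qed
    also have "\<dots> = R" by (simp add: \<rho>_def)
    finally show "x \<in> D" using R by auto
  qed
  define b where "b i = ball_bump (c i) \<rho>" for i
  have bt: "b i \<in> test_functions D" if "i < N" for i
    unfolding b_def by (rule ball_bump_test[OF \<rho> sub[OF that]])
  have b2: "b i \<in> L2 D" if "i < N" for i by (rule test_functions_L2[OF bt[OF that] Dm])
  have disj: "L2_inner D (b i) (b j) = 0" if "i \<noteq> j" for i j
  proof -
    have "b i x * b j x = 0" for x
    proof (rule ccontr)
      assume "b i x * b j x \<noteq> 0"
      then have "0 < b i x" "0 < b j x"
        using ball_bump_nonneg[of "c i" \<rho> x] ball_bump_nonneg[of "c j" \<rho> x] by (auto simp: b_def)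
      then have "dist (c i) x < \<rho>" "dist (c j) x < \<rho>"
        using ball_bump_pos_iff[OF \<rho>, of "c i" x] ball_bump_pos_iff[OF \<rho>, of "c j" x]
        by (auto simp: b_def)
      then have "dist (c i) (c j) < 2 * \<rho>" using dist_triangle2[of "c i" "c j" x] by simp
      moreover have "dist (c i) (c j) = 2 * \<rho> * \<bar>real i - real j\<bar>"
      proof -
        have "c i - c j = (2 * \<rho> * (real i - real j)) *\<^sub>R e" by (simp add: c_def algebra_simps)
        then show ?thesis using \<rho> e by (simp add: dist_norm abs_mult)
      qed
      moreover have "\<bar>real i - real j\<bar> \<ge> 1" using that by linarith
      ultimately show False using \<rho> by simp
    qed
    then have "(\<lambda>x. b i x * b j x) = (\<lambda>_. 0)" by (intro ext)
    then show ?thesis by (simp add: L2_inner_def)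
  qed
  have pos: "L2_inner D (b i) (b i) > 0" if "i < N" for i
  proof (rule ccontr)
    assume "\<not> ?thesis"
    then have "L2_inner D (b i) (b i) = 0" using L2.nonneg[OF b2[OF that]] by simp
    then have "AE x in lebesgue_on D. b i x = 0" using L2_inner_self_eq_0_iff[OF b2[OF that]] by simp
    then have "AE x in lebesgue. x \<in> D \<longrightarrow> b i x = 0"
      using Dm by (simp add: AE_restrict_space_iff fmeasurableD)
    moreover have "x \<notin> ball (c i) \<rho>" if "x \<in> D \<longrightarrow> b i x = 0" for x
    proof
      assume x: "x \<in> ball (c i) \<rho>"
      then have "x \<in> D" using sub[OF \<open>i < N\<close>] ball_subset_cball by blast
      moreover have "b i x > 0" using ball_bump_pos_iff[OF \<rho>, of "c i" x] x by (simp add: b_def)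
      ultimately show False using that by simp
    qed
    ultimately have "AE x in lebesgue. x \<notin> ball (c i) \<rho>" by (auto elim: eventually_mono)
    then have "ball (c i) \<rho> \<in> null_sets lebesgue" by (subst AE_iff_null_sets) auto
    then have "negligible (ball (c i) \<rho>)" by (simp add: negligible_iff_null_sets)
    then show False using open_not_negligible[of "ball (c i) \<rho>"] \<rho> by auto
  qed
  define f where "f i = (1 / sqrt (L2_inner D (b i) (b i))) *\<^sub>R b i" for i
  have "f i \<in> test_functions D" if "i < N" for i
    unfolding f_def by (rule subspace_scale[OF subspace_test_functions bt[OF that]])
  moreover have "L2_inner D (f i) (f j) = (if i = j then 1 else 0)" if "i < N" "j < N" for i j
  proof (cases "i = j")
    case True
    then show ?thesis using pos[OF that(1)] b2[OF that(1)] by (simp add: f_def L2.sq_scale power_divide)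
  next
    case False
    then show ?thesis using disj[OF False] b2 that by (simp add: f_def L2.scale L2.scale_right L2.V_scale)
  qed
  ultimately show ?thesis by blast
qed

lemma spectral_pair_form_domain:
  assumes D: "open D" "bounded D" "D \<noteq> {}" and V: "form_domain D V" and comp: "compactly_embedded D V"
  shows "spectral_pair V (grad_inner D) (L2_inner D)"
proof -
  have VH: "V \<subseteq> H1 D" and subV: "subspace V" using V by (auto simp: form_domain_def)
  have V2: "V \<subseteq> L2 D" using VH H1_L2 by blast
  interpret H: semi_inner "H1 D" "grad_inner D" by (rule semi_inner_grad[OF D(1,2)])
  interpret A: semi_inner V "grad_inner D"
    by standard (use VH in \<open>auto simp: subV H.sym H.add H.scale H.nonneg subset_iff\<close>)
  interpret B: semi_inner V "L2_inner D"
    by standard (use V2 in \<open>auto simp: subV L2.sym L2.add L2.scale L2.nonneg subset_iff\<close>)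
  show ?thesis
  proof
    fix X :: "nat \<Rightarrow> real^'a \<Rightarrow> real" assume X: "\<And>n. X n \<in> V" and C: "\<And>e. e > 0 \<Longrightarrow> \<exists>N. \<forall>m\<ge>N. \<forall>n\<ge>N.
      grad_inner D (X m - X n) (X m - X n) + L2_inner D (X m - X n) (X m - X n) < e"
    have XH: "X n \<in> H1 D" for n using X VH by blast
    obtain u where u: "u \<in> H1 D" "(\<lambda>n. H1_energy D (X n - u)) \<longlonglongrightarrow> 0"
      using H1_complete[OF D(1,2), of X, OF XH] C unfolding H1_energy_def by blast
    have "u \<in> V"
    proof -
      have "\<exists>v\<in>V. H1_energy D (u - v) < e" if e: "e > 0" for e
      proof -
        obtain n where n: "H1_energy D (X n - u) < e"
          using order_tendstoD(2)[OF u(2) e] by (auto simp: eventually_sequentially)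
        interpret E: semi_inner "H1 D" "\<lambda>u v. grad_inner D u v + L2_inner D u v"
          by (rule semi_inner_H1_energy[OF D(1,2)])
        have "H1_energy D (u - X n) = H1_energy D (X n - u)"
          using E.sq_diff[OF u(1) XH] E.sq_diff[OF XH u(1)] E.sym[OF u(1) XH] unfolding H1_energy_def by simp
        then show ?thesis using n X by (intro bexI[of _ "X n"]) auto
      qed
      then show ?thesis using V u(1) unfolding form_domain_def by blast
    qed
    then show "\<exists>u\<in>V. (\<lambda>n. grad_inner D (X n - u) (X n - u) + L2_inner D (X n - u) (X n - u)) \<longlonglongrightarrow> 0"
      using u(2) unfolding H1_energy_def by blast
  next
    show "finitely_controlled V (\<lambda>u. grad_inner D u u + L2_inner D u u) (\<lambda>u. L2_inner D u u) (\<lambda>u. L2_inner D u u)"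
      using comp unfolding compactly_embedded_def H1_energy_def[abs_def] .
  next
    fix N :: nat
    obtain f where f: "\<forall>i<N. f i \<in> test_functions D"
      "\<forall>i<N. \<forall>j<N. L2_inner D (f i) (f j) = (if i = j then 1 else 0)"
      using exists_orthonormal_test_functions[OF D] by blast
    moreover have "test_functions D \<subseteq> V" using V by (simp add: form_domain_def)
    ultimately show "\<exists>f. B.orthonormal N f" unfolding B.orthonormal_def by blast
  qed
qed

section \<open>Linear changes of variables\<close>

lemma matrix_inv_mult:
  fixes T :: "real^'d^'d" assumes "invertible T"
  shows "T ** matrix_inv T = mat 1" "matrix_inv T ** T = mat 1"
  using assms someI_ex[of "\<lambda>A'. T ** A' = mat 1 \<and> A' ** T = mat 1"]
  unfolding invertible_def matrix_inv_def by auto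

text \<open>The inverse is a parameter characterised by both products, so that explicit inverses can
  be inserted and the roles of \<open>T\<close> and \<open>S\<close> exchanged. The constant
  \<open>c\<close> stands for the absolute value of the determinant of \<open>T\<close>.\<close>

locale linear_change =
  fixes T S :: "real^'d^'d" and D :: "(real^'d) set" and c :: real
  assumes D: "open D" "bounded D"
    and TS: "T ** S = mat 1" and ST: "S ** T = mat 1"
    and scale: "scales_lebesgue ((*v) T) c"
begin

abbreviation "TD \<equiv> (*v) T ` D"

lemma T_S [simp]: "T *v (S *v x) = x" and S_T [simp]: "S *v (T *v x) = x"
  using TS ST by (simp_all add: matrix_vector_mul_assoc)

lemma c_pos: "c > 0" using scale by (simp add: scales_lebesgue_def)

lemma S_TD: "(*v) S ` TD = D"
  by (auto simp: image_image)

lemma TD: "open TD" "bounded TD"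
proof -
  have "TD = (*v) S -` D"
  proof
    show "(*v) S -` D \<subseteq> TD"
    proof
      fix y assume "y \<in> (*v) S -` D"
      then have "T *v (S *v y) \<in> TD" by blast
      then show "y \<in> TD" by simp
    qed
  qed auto
  moreover have "continuous_on UNIV ((*v) S)"
    by (intro linear_continuous_on matrix_vector_mul_bounded_linear)
  ultimately show "open TD" using D(1) by (simp add: open_vimage)
  show "bounded TD" by (intro bounded_linear_image D(2) matrix_vector_mul_bounded_linear)
qed

lemma meas: "D \<in> lmeasurable" "TD \<in> lmeasurable" "D \<in> sets lebesgue" "TD \<in> sets lebesgue"
  using D TD lmeasurable_open by auto

definition pull :: "(real^'d \<Rightarrow> 'b) \<Rightarrow> real^'d \<Rightarrow> 'b" where
  "pull u y = u (S *v y)"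

lemma pull_diff: "pull (u - v) = pull u - pull v" for u v :: "real^'d \<Rightarrow> real"
  by (simp add: pull_def fun_eq_iff)

lemma pull_L2:
  fixes u :: "real^'d \<Rightarrow> 'b::euclidean_space"
  assumes u: "u \<in> L2 D" shows "pull u \<in> L2 TD"
proof -
  have "linear ((*v) S)" "bij ((*v) S)"
    by (auto intro!: bijI' exI[of _ "T *v _"] simp: matrix_vector_mul_linear) (metis T_S)
  then obtain c' where "scales_lebesgue ((*v) S) c'" using scales_lebesgue_linear by blast
  then show ?thesis
    using L2_scaling[of "(*v) S" c' TD u] meas u unfolding S_TD pull_def[abs_def] by simp
qed

lemma L2_inner_TD:
  fixes f g :: "real^'d \<Rightarrow> 'b::euclidean_space"
  assumes "f \<in> L2 TD" "g \<in> L2 TD"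
  shows "L2_inner TD f g = c * L2_inner D (\<lambda>x. f (T *v x)) (\<lambda>x. g (T *v x))"
  using L2_inner_scaling[OF scale meas(3,4) assms] .

lemma L2_inner_pull:
  fixes u v :: "real^'d \<Rightarrow> 'b::euclidean_space"
  assumes "u \<in> L2 D" "v \<in> L2 D"
  shows "L2_inner TD (pull u) (pull v) = c * L2_inner D u v"
  using L2_inner_TD[OF pull_L2[OF assms(1)] pull_L2[OF assms(2)]] by (simp add: pull_def)

lemma matrix_L2:
  fixes g :: "real^'d \<Rightarrow> real^'d" and A :: "real^'d^'d"
  assumes "g \<in> L2 D" shows "(\<lambda>x. A *v g x) \<in> L2 D"
proof (rule L2_vecI)
  fix i
  show "(\<lambda>x. (A *v g x) $ i) \<in> L2 D"
    using L2_component(1)[OF assms, of "A $ i"] by (simp add: matrix_vector_mul_component)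
qed

text \<open>The chain rule for composition with \<open>S\<close>.\<close>

definition pull_grad :: "(real^'d \<Rightarrow> real^'d) \<Rightarrow> real^'d \<Rightarrow> real^'d" where
  "pull_grad g = pull (\<lambda>x. transpose S *v g x)"

lemma pull_grad_L2: "g \<in> L2 D \<Longrightarrow> pull_grad g \<in> L2 TD"
  unfolding pull_grad_def by (intro pull_L2 matrix_L2)

lemma test_functions_compose_T:
  assumes "\<phi> \<in> test_functions TD" shows "(\<lambda>x. \<phi> (T *v x)) \<in> test_functions D"
proof -
  obtain K where K: "compact K" "K \<subseteq> TD" "\<And>x. x \<notin> K \<Longrightarrow> \<phi> x = 0" "\<And>k. C_times k \<phi>"
    by (rule test_functionsE[OF assms]) blast
  show ?thesis
  proof (rule test_functionsI[of _ "(*v) S ` K"])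
    show "C_times k (\<lambda>x. \<phi> (T *v x))" for k
      using C_times_affine[OF K(4), of k T 0] by simp
    show "compact ((*v) S ` K)"
      using K(1) by (intro compact_continuous_image linear_continuous_on matrix_vector_mul_bounded_linear)
    show "(*v) S ` K \<subseteq> D" using K(2) S_TD by blast
    show "\<phi> (T *v x) = 0" if "x \<notin> (*v) S ` K" for x
      using K(3)[of "T *v x"] that by (metis S_T image_eqI)
  qed
qed

text \<open>A test function on the image, composed with \<open>T\<close>, is one on
  \<open>D\<close>. Its own partial derivatives are recovered from those of the composition because
  \<open>T ** S = mat 1\<close>, and the factor \<open>c\<close> from the change of variables
  appears on both sides.\<close>

lemma has_weak_grad_pull:
  assumes u: "u \<in> L2 D" and g: "g \<in> L2 D" and ug: "has_weak_grad D u g"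
  shows "has_weak_grad TD (pull u) (pull_grad g)"
  unfolding has_weak_grad_iff
proof (intro ballI allI)
  fix \<phi> k assume \<phi>: "\<phi> \<in> test_functions TD"
  define \<psi> where "\<psi> x = \<phi> (T *v x)" for x
  have \<psi>: "\<psi> \<in> test_functions D" unfolding \<psi>_def[abs_def] by (rule test_functions_compose_T[OF \<phi>])
  have pd: "partial_deriv i \<psi> x = (\<Sum>j\<in>UNIV. T $ j $ i * partial_deriv j \<phi> (T *v x))" for i x
    using partial_deriv_affine(2)[of \<phi> T x 0 i] test_functions_differentiable[OF \<phi>]
    by (simp add: \<psi>_def[abs_def])
  have chain: "partial_deriv k \<phi> (T *v x) = (\<Sum>i\<in>UNIV. S $ i $ k * partial_deriv i \<psi> x)" for x
  proof -
    have "(\<Sum>i\<in>UNIV. S $ i $ k * partial_deriv i \<psi> x)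
        = (\<Sum>j\<in>UNIV. \<Sum>i\<in>UNIV. T $ j $ i * S $ i $ k * partial_deriv j \<phi> (T *v x))"
      by (simp add: pd sum_distrib_left mult_ac) (rule sum.swap)
    also have "\<dots> = (\<Sum>j\<in>UNIV. (T ** S) $ j $ k * partial_deriv j \<phi> (T *v x))"
      by (simp add: matrix_matrix_mult_def sum_distrib_right)
    also have "\<dots> = (\<Sum>j\<in>UNIV. if j = k then partial_deriv k \<phi> (T *v x) else 0)"
      unfolding TS by (intro sum.cong) (auto simp: mat_def)
    finally show ?thesis by simp
  qed
  have \<psi>2: "\<psi> \<in> L2 D" "partial_deriv i \<psi> \<in> L2 D" for i
    by (rule test_functions_L2[OF \<psi> meas(1)] test_functions_L2[OF partial_deriv_test_function[OF \<psi>] meas(1)])+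
  have gi: "(\<lambda>x. g x $ i) \<in> L2 D" for i by (rule L2_nth[OF g])
  have "L2_inner TD (pull u) (partial_deriv k \<phi>) = c * L2_inner D u (\<lambda>x. partial_deriv k \<phi> (T *v x))"
    using L2_inner_TD[OF pull_L2[OF u] test_functions_L2[OF partial_deriv_test_function[OF \<phi>] meas(2)]]
    by (simp add: pull_def)
  also have "(\<lambda>x. partial_deriv k \<phi> (T *v x)) = (\<lambda>x. \<Sum>i\<in>UNIV. S $ i $ k * partial_deriv i \<psi> x)"
    by (simp add: chain)
  also have "L2_inner D u \<dots> = (\<Sum>i\<in>UNIV. S $ i $ k * L2_inner D (partial_deriv i \<psi>) u)"
    using L2_inner_sum_left[of UNIV "\<lambda>i. partial_deriv i \<psi>" D u "\<lambda>i. S $ i $ k"] \<psi>2(2) u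
    by (simp add: L2_inner_def mult.commute)
  also have "\<dots> = - (\<Sum>i\<in>UNIV. S $ i $ k * L2_inner D (\<lambda>x. g x $ i) \<psi>)"
    using has_weak_gradD[OF ug \<psi>] L2.sym[OF \<psi>2(2) u] by (simp add: sum_negf)
  also have "(\<Sum>i\<in>UNIV. S $ i $ k * L2_inner D (\<lambda>x. g x $ i) \<psi>)
      = L2_inner D (\<lambda>x. \<Sum>i\<in>UNIV. S $ i $ k * g x $ i) \<psi>"
    using gi \<psi>2(1) by (subst L2_inner_sum_left) auto
  also have "c * - \<dots> = - (c * L2_inner D (\<lambda>x. \<Sum>i\<in>UNIV. S $ i $ k * g x $ i) \<psi>)" by simp
  also have "c * L2_inner D (\<lambda>x. \<Sum>i\<in>UNIV. S $ i $ k * g x $ i) \<psi> = L2_inner TD (\<lambda>x. pull_grad g x $ k) \<phi>"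
  proof -
    have "(transpose S *v w) $ k = (\<Sum>i\<in>UNIV. S $ i $ k * w $ i)" for w
      by (simp add: matrix_vector_mult_def transpose_def del: transpose_matrix_vector)
    then have "pull_grad g (T *v x) $ k = (\<Sum>i\<in>UNIV. S $ i $ k * g x $ i)" for x
      by (simp add: pull_grad_def pull_def del: transpose_matrix_vector)
    then show ?thesis
      using L2_inner_TD[OF L2_nth[OF pull_grad_L2[OF g]] test_functions_L2[OF \<phi> meas(2)], of k]
      by (simp add: \<psi>_def[abs_def])
  qed
  finally show "L2_inner TD (pull u) (partial_deriv k \<phi>) = - L2_inner TD (\<lambda>x. pull_grad g x $ k) \<phi>" .
qed

lemma
  assumes u: "u \<in> H1 D"
  shows pull_H1: "pull u \<in> H1 TD"
    and grad_inner_pull: "grad_inner TD (pull u) (pull u)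
      = c * L2_inner D (\<lambda>x. transpose S *v weak_grad D u x) (\<lambda>x. transpose S *v weak_grad D u x)"
proof -
  note U = H1_L2[OF u] weak_grad_works[OF u]
  note P = pull_L2[OF U(1)] pull_grad_L2[OF U(2)] has_weak_grad_pull[OF U]
  show "pull u \<in> H1 TD" by (rule H1I[OF P])
  show "grad_inner TD (pull u) (pull u)
      = c * L2_inner D (\<lambda>x. transpose S *v weak_grad D u x) (\<lambda>x. transpose S *v weak_grad D u x)"
    unfolding grad_inner_eq[OF TD P P] unfolding pull_grad_def
    by (rule L2_inner_pull[OF matrix_L2[OF U(2)] matrix_L2[OF U(2)]])
qed

lemma matrix_L2_inner_le:
  fixes A :: "real^'d^'d"
  shows "\<exists>B>0. \<forall>g\<in>L2 D. L2_inner D (\<lambda>x. A *v g x) (\<lambda>x. A *v g x) \<le> B * L2_inner D g g"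
proof -
  obtain B where B: "B > 0" "\<And>x. norm (A *v x) \<le> B * norm x"
    using linear_bounded_pos[OF matrix_vector_mul_linear[of A]] by blast
  have "L2_inner D (\<lambda>x. A *v g x) (\<lambda>x. A *v g x) \<le> B\<^sup>2 * L2_inner D g g" if g: "g \<in> L2 D" for g
  proof -
    have "(norm (A *v g x))\<^sup>2 \<le> B\<^sup>2 * (norm (g x))\<^sup>2" for x
      using power_mono[OF B(2)[of "g x"], of 2] by (simp add: power_mult_distrib)
    then have "(LINT x|lebesgue_on D. (norm (A *v g x))\<^sup>2) \<le> (LINT x|lebesgue_on D. B\<^sup>2 * (norm (g x))\<^sup>2)"
      using L2_integrable[OF g] L2_integrable[OF matrix_L2[OF g, of A]] by (intro integral_mono) auto
    then show ?thesis by (simp add: L2_inner_eq_norm)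
  qed
  then show ?thesis using B(1) by (intro exI[of _ "B\<^sup>2"]) auto
qed

lemma H1_energy_pull_le: "\<exists>K>0. \<forall>u\<in>H1 D. H1_energy TD (pull u) \<le> K * H1_energy D u"
proof -
  obtain B where B: "B > 0" "\<And>g. g \<in> L2 D \<Longrightarrow>
      L2_inner D (\<lambda>x. transpose S *v g x) (\<lambda>x. transpose S *v g x) \<le> B * L2_inner D g g"
    using matrix_L2_inner_le[of "transpose S"] by blast
  have "H1_energy TD (pull u) \<le> (c * (B + 1)) * H1_energy D u" if u: "u \<in> H1 D" for u
  proof -
    note U = H1_L2[OF u] weak_grad_works[OF u]
    have "H1_energy TD (pull u) \<le> c * (B * grad_inner D u u) + c * L2_inner D u u"
      unfolding H1_energy_def grad_inner_pull[OF u] L2_inner_pull[OF U(1) U(1)]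
      using mult_left_mono[OF B(2)[OF U(2)], of c] c_pos by (simp add: grad_inner_def)
    also have "\<dots> \<le> (c * (B + 1)) * H1_energy D u"
      using c_pos B(1) L2.nonneg[OF U(1)] L2.nonneg[OF U(2)]
      by (simp add: H1_energy_def grad_inner_def algebra_simps)
    finally show ?thesis .
  qed
  then show ?thesis using c_pos B(1) by (intro exI[of _ "c * (B + 1)"]) auto
qed

lemma inverse_change: "\<exists>c'. linear_change S T TD c'"
proof -
  have "linear ((*v) S)" "bij ((*v) S)"
    by (auto intro!: bijI' exI[of _ "T *v _"] simp: matrix_vector_mul_linear) (metis T_S)
  then obtain c' where "scales_lebesgue ((*v) S) c'" using scales_lebesgue_linear by blast
  then show ?thesis using TD TS ST by (auto simp: linear_change_def)
qed

lemma test_functions_pull: "\<phi> \<in> test_functions D \<Longrightarrow> pull \<phi> \<in> test_functions TD"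
proof -
  assume \<phi>: "\<phi> \<in> test_functions D"
  obtain c' where "linear_change S T TD c'" using inverse_change by blast
  from linear_change.test_functions_compose_T[OF this, of \<phi>] show ?thesis
    using \<phi> by (simp add: S_TD pull_def[abs_def])
qed

text \<open>\<open>pull\<close> maps test functions to test functions and is bounded in energy, so
  it respects the closure.\<close>

lemma pull_H1_0:
  assumes u: "u \<in> H1_0 D" shows "pull u \<in> H1_0 TD"
proof -
  obtain K where K: "K > 0" "\<And>u. u \<in> H1 D \<Longrightarrow> H1_energy TD (pull u) \<le> K * H1_energy D u"
    using H1_energy_pull_le by blast
  have "\<exists>\<phi>\<in>test_functions TD. H1_energy TD (pull u - \<phi>) < e" if e: "e > 0" for e
  proof -
    obtain \<phi> where \<phi>: "\<phi> \<in> test_functions D" "H1_energy D (u - \<phi>) < e / K"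
      using u e K(1) by (auto simp: H1_0_iff dest!: spec[of _ "e / K"])
    have "u - \<phi> \<in> H1 D"
      by (rule subspace_diff[OF subspace_H1[OF meas(1)] H1_0_H1[OF u] test_functions_H1[OF \<phi>(1) meas(1) D(2)]])
    then have "H1_energy TD (pull u - pull \<phi>) \<le> K * H1_energy D (u - \<phi>)"
      using K(2) by (simp add: pull_diff[symmetric])
    also have "\<dots> < e" using \<phi>(2) K(1) by (simp add: field_simps)
    finally show ?thesis using test_functions_pull[OF \<phi>(1)] by blast
  qed
  then show ?thesis using pull_H1[OF H1_0_H1[OF u]] by (simp add: H1_0_iff)
qed

text \<open>Compactness is inherited through the inverse change of variables, which distorts energy
  and norm by bounded factors only. For the Neumann problem this replaces a boundary argument on the
  image.\<close>

lemma compactly_embedded_TD: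
  assumes comp: "compactly_embedded D V" and V': "V' \<subseteq> H1 TD"
    and push: "\<And>u. u \<in> V' \<Longrightarrow> (\<lambda>x. u (T *v x)) \<in> V"
  shows "compactly_embedded TD V'"
proof -
  obtain c' where "linear_change S T TD c'" using inverse_change by blast
  then interpret I: linear_change S T TD c' .
  have Ipull: "I.pull u = (\<lambda>x. u (T *v x))" for u :: "real^'d \<Rightarrow> real" by (simp add: I.pull_def fun_eq_iff)
  obtain K where K: "K > 0" "\<And>u. u \<in> H1 TD \<Longrightarrow> H1_energy D (I.pull u) \<le> K * H1_energy TD u"
    using I.H1_energy_pull_le unfolding S_TD by blast
  have b: "L2_inner D (I.pull u) (I.pull u) = c' * L2_inner TD u u" if "u \<in> L2 TD" for u :: "real^'d \<Rightarrow> real"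
    using I.L2_inner_pull[OF that that] unfolding S_TD .
  define M where "M = max K (max c' (1 / c'))"
  have M: "M > 0" "K \<le> M" "c' \<le> M" "1 / c' \<le> M" using K(1) by (auto simp: M_def)
  show ?thesis
    unfolding compactly_embedded_def
  proof (rule finitely_controlled_pullback[OF comp[unfolded compactly_embedded_def], where P=I.pull and K=M])
    fix u assume u: "u \<in> V'"
    have uH: "u \<in> H1 TD" using u V' by blast
    note u2 = H1_L2[OF uH]
    show "I.pull u \<in> V" unfolding Ipull by (rule push[OF u])
    have "H1_energy D (I.pull u) \<le> K * H1_energy TD u" by (rule K(2)[OF uH])
    also have "\<dots> \<le> M * H1_energy TD u" by (intro mult_right_mono M H1_energy_nonneg uH)
    finally show "H1_energy D (I.pull u) \<le> M * H1_energy TD u" .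
    show "L2_inner D (I.pull u) (I.pull u) \<le> M * L2_inner TD u u"
      unfolding b[OF u2] by (intro mult_right_mono M L2.nonneg u2)
    have "L2_inner TD u u = 1 / c' * L2_inner D (I.pull u) (I.pull u)"
      unfolding b[OF u2] using I.c_pos by simp
    also have "\<dots> \<le> M * L2_inner D (I.pull u) (I.pull u)"
      using I.pull_L2[OF u2] unfolding S_TD by (intro mult_right_mono M L2.nonneg)
    finally show "L2_inner TD u u \<le> M * L2_inner D (I.pull u) (I.pull u)" .
    show "0 \<le> L2_inner TD u u" by (rule L2.nonneg[OF u2])
    show "0 \<le> L2_inner D (I.pull u) (I.pull u)" using I.pull_L2[OF u2] unfolding S_TD by (rule L2.nonneg)
    fix v
    show "I.pull (u - v) = I.pull u - I.pull v" by (rule I.pull_diff)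
  qed (rule M(1))
qed

text \<open>The trial functions for \<open>T(D)\<close> are the transplanted eigenfunctions of \<open>D\<close>.\<close>
lemma sum_eigval_le:
  assumes spD: "spectral_pair V (grad_inner D) (L2_inner D)" and V: "V \<subseteq> H1 D"
    and spT: "spectral_pair V' (grad_inner TD) (L2_inner TD)"
    and pull: "\<And>u. u \<in> V \<Longrightarrow> pull u \<in> V'"
  defines "g \<equiv> \<lambda>j. weak_grad D (spectral_pair.eigenbasis V (grad_inner D) (L2_inner D) j)"
  shows "(\<Sum>k<n. spectral_pair.eigval V' (grad_inner TD) (L2_inner TD) k)
    \<le> (\<Sum>j<n. L2_inner D (\<lambda>x. transpose S *v g j x) (\<lambda>x. transpose S *v g j x))"
proof -
  interpret P: spectral_pair V "grad_inner D" "L2_inner D" by (rule spD)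
  interpret Q: spectral_pair V' "grad_inner TD" "L2_inner TD" by (rule spT)
  \<comment> \<open>\<open>pull\<close> multiplies inner products by \<open>c\<close>, which this
    factor undoes.\<close>
  define v where "v j = (1 / sqrt c) *\<^sub>R pull (P.eigenbasis j)" for j
  have eH: "P.eigenbasis j \<in> H1 D" for j using P.eigenbasis_V V by blast
  have pV: "pull (P.eigenbasis j) \<in> V'" for j by (rule pull[OF P.eigenbasis_V])
  have "Q.B.orthonormal n v"
    unfolding Q.B.orthonormal_def
  proof (intro conjI allI impI)
    fix i j
    show "v i \<in> V'" unfolding v_def by (intro Q.B.V_scale pV)
    have "L2_inner TD (v i) (v j) = (1 / sqrt c) * ((1 / sqrt c) * L2_inner TD (pull (P.eigenbasis i)) (pull (P.eigenbasis j)))"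
      unfolding v_def using pV by (simp add: Q.B.scale Q.B.scale_right Q.B.V_scale)
    also have "\<dots> = L2_inner D (P.eigenbasis i) (P.eigenbasis j)"
      unfolding L2_inner_pull[OF H1_L2[OF eH] H1_L2[OF eH]] using c_pos by (simp add: field_simps)
    finally show "L2_inner TD (v i) (v j) = (if i = j then 1 else 0)" by (simp add: P.eigenbasis_inner)
  qed
  from Q.Ky_Fan[OF this] have "(\<Sum>k<n. Q.eigval k) \<le> (\<Sum>j<n. grad_inner TD (v j) (v j))" .
  moreover have "grad_inner TD (v j) (v j) = L2_inner D (\<lambda>x. transpose S *v g j x) (\<lambda>x. transpose S *v g j x)" for j
    unfolding v_def Q.A.sq_scale[OF pV] grad_inner_pull[OF eH] g_def using c_pos
    by (simp add: power_divide del: transpose_matrix_vector)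
  ultimately show ?thesis by (simp only:)
qed

end

lemma linear_change_exists:
  fixes T :: "real^'d^'d"
  assumes "invertible T" "open D" "bounded D"
  shows "\<exists>c. linear_change T (matrix_inv T) D c"
proof -
  note m = matrix_inv_mult[OF assms(1)]
  have "T *v (matrix_inv T *v x) = x" "matrix_inv T *v (T *v x) = x" for x
    using m by (simp_all add: matrix_vector_mul_assoc)
  then have "bij ((*v) T)" by (metis bijI')
  then obtain c where "scales_lebesgue ((*v) T) c"
    using scales_lebesgue_linear[OF matrix_vector_mul_linear[of T]] by blast
  then show ?thesis using assms m by (auto simp: linear_change_def)
qed

section \<open>Identification of the eigenvalue sequences\<close>

text \<open>Fewer homogeneous equations than unknowns. Linear dependence is a property of sets of
  vectors, so repeated rows are treated separately.\<close>

lemma exists_nontrivial_kernel: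
  fixes c :: "nat \<Rightarrow> nat \<Rightarrow> real"
  assumes "m' < m"
  shows "\<exists>d. (\<exists>i<m. d i \<noteq> 0) \<and> (\<forall>j<m'. (\<Sum>i<m. d i * c i j) = 0)"
proof -
  define v :: "nat \<Rightarrow> nat \<Rightarrow> real" where "v i = (\<lambda>j. if j < m' then c i j else 0)" for i
  define e :: "nat \<Rightarrow> nat \<Rightarrow> real" where "e k = (\<lambda>j. if j = k then 1 else 0)" for k
  show ?thesis
  proof (cases "inj_on v {..<m}")
    case False
    then obtain i k where ik: "i < m" "k < m" "i \<noteq> k" "v i = v k" by (auto simp: inj_on_def)
    define d where "d l = (if l = i then 1 else if l = k then - 1 else 0 :: real)" for l
    have "(\<Sum>l<m. d l * c l j) = 0" if "j < m'" for j
    proof -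
      have "(\<Sum>l<m. d l * c l j) = (\<Sum>l\<in>{i, k}. d l * c l j)"
        using ik by (intro sum.mono_neutral_right) (auto simp: d_def)
      also have "\<dots> = c i j - c k j" using ik by (simp add: d_def)
      also have "\<dots> = 0" using fun_cong[OF ik(4), of j] that by (simp add: v_def)
      finally show ?thesis .
    qed
    moreover have "d i \<noteq> 0" by (simp add: d_def)
    ultimately show ?thesis using ik(1) by blast
  next
    case True
    have "v i \<in> span (e ` {..<m'})" for i
    proof -
      have "v i = (\<Sum>k<m'. c i k *\<^sub>R e k)"
      proof
        fix j
        have "(\<Sum>k<m'. c i k *\<^sub>R e k) j = (\<Sum>k<m'. if k = j then c i j else 0)"
          unfolding sum_fun_apply by (intro sum.cong) (auto simp: e_def)
        then show "v i j = (\<Sum>k<m'. c i k *\<^sub>R e k) j" by (simp add: v_def)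
      qed
      also have "\<dots> \<in> span (e ` {..<m'})" by (intro span_sum span_scale span_base) auto
      finally show ?thesis .
    qed
    then have sub: "v ` {..<m} \<subseteq> span (e ` {..<m'})" by auto
    have "dependent (v ` {..<m})"
    proof (rule ccontr)
      assume "\<not> dependent (v ` {..<m})"
      then have "card (v ` {..<m}) \<le> card (e ` {..<m'})"
        using independent_span_bound[of "e ` {..<m'}" "v ` {..<m}"] sub by simp
      then have "m \<le> card (e ` {..<m'})" using card_image[OF True] by simp
      also have "\<dots> \<le> m'" using card_image_le[of "{..<m'}" e] by simp
      finally show False using assms by simp
    qed
    then obtain a where a: "\<exists>w\<in>v ` {..<m}. a w \<noteq> 0" "(\<Sum>w\<in>v ` {..<m}. a w *\<^sub>R w) = 0"
      by (subst (asm) dependent_finite) auto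
    define d where "d i = a (v i)" for i
    have "(\<Sum>i<m. d i *\<^sub>R v i) = 0"
      using a(2) by (subst (asm) sum.reindex[OF True]) (simp add: d_def comp_def)
    then have z: "(\<Sum>i<m. d i * v i j) = 0" for j
      using sum_fun_apply[of "\<lambda>i. d i *\<^sub>R v i" "{..<m}" j] by simp
    have "(\<Sum>i<m. d i * c i j) = 0" if "j < m'" for j
      using z[of j] that by (simp add: v_def)
    moreover have "\<exists>i<m. d i \<noteq> 0" using a(1) by (auto simp: d_def)
    ultimately show ?thesis by blast
  qed
qed

text \<open>More than \<open>m'\<close> elements, expressed through \<open>m'\<close> spanning
  functions, satisfy a nontrivial relation almost everywhere.\<close>

lemma has_dim_ae_le:
  assumes "has_dim_ae D E m" "has_dim_ae D E m'" shows "m \<le> m'"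
proof (rule ccontr)
  assume "\<not> m \<le> m'"
  then have lt: "m' < m" by simp
  obtain f where f: "\<And>i. i < m \<Longrightarrow> f i \<in> E"
    and ind: "\<And>c. (AE x in lebesgue_on D. (\<Sum>i<m. c i * f i x) = 0) \<Longrightarrow> \<forall>i<m. c i = (0::real)"
    using assms(1) unfolding has_dim_ae_def by blast
  obtain f' where sp: "\<And>u. u \<in> E \<Longrightarrow> \<exists>c. AE x in lebesgue_on D. u x = (\<Sum>j<m'. c j * f' j x)"
    using assms(2) unfolding has_dim_ae_def by blast
  have "\<forall>i\<in>{..<m}. \<exists>c. AE x in lebesgue_on D. f i x = (\<Sum>j<m'. c j * f' j x)"
    using sp f by blast
  from bchoice[OF this] obtain c where c: "\<forall>i\<in>{..<m}. AE x in lebesgue_on D. f i x = (\<Sum>j<m'. c i j * f' j x)"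
    by blast
  obtain d where d: "\<exists>i<m. d i \<noteq> 0" "\<And>j. j < m' \<Longrightarrow> (\<Sum>i<m. d i * c i j) = 0"
    using exists_nontrivial_kernel[OF lt, of c] by blast
  have "AE x in lebesgue_on D. \<forall>i\<in>{..<m}. f i x = (\<Sum>j<m'. c i j * f' j x)"
    using c by (intro AE_finite_allI) auto
  then have "AE x in lebesgue_on D. (\<Sum>i<m. d i * f i x) = 0"
  proof eventually_elim
    case (elim x)
    have "(\<Sum>i<m. d i * f i x) = (\<Sum>i<m. \<Sum>j<m'. d i * c i j * f' j x)"
      using elim by (intro sum.cong) (auto simp: sum_distrib_left mult.assoc)
    also have "\<dots> = (\<Sum>j<m'. \<Sum>i<m. d i * c i j * f' j x)" by (rule sum.swap)
    also have "\<dots> = (\<Sum>j<m'. (\<Sum>i<m. d i * c i j) * f' j x)" by (simp add: sum_distrib_right)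
    also have "\<dots> = 0" using d(2) by simp
    finally show ?case .
  qed
  then show False using ind d(1) by blast
qed

text \<open>If \<open>s k\<close> were smaller than \<open>s' k\<close>, the value
  \<open>s k\<close> would occur strictly more often in \<open>s\<close> than in \<open>s'\<close>:
  by monotonicity \<open>s'\<close> can take it only before \<open>k\<close>, where the sequences
  agree. Both counts are the dimension of the same eigenspace.\<close>

lemma eigenvalue_sequence_le:
  fixes s s' :: "nat \<Rightarrow> real"
  assumes "eigenvalue_sequence D V s" "eigenvalue_sequence D V s'" and eq: "\<And>i. i < k \<Longrightarrow> s i = s' i"
  shows "s' k \<le> s k"
proof (rule ccontr)
  assume "\<not> ?thesis"
  then have lt: "s k < s' k" by simp
  have mono: "mono s" "mono s'" and fin: "finite {i. s i = s k}"
    and dim: "has_dim_ae D (eigenspace D V (s k)) (card {i. s i = s k})"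
      "has_dim_ae D (eigenspace D V (s k)) (card {i. s' i = s k})"
    using assms(1,2) by (auto simp: eigenvalue_sequence_def)
  have "{i. s' i = s k} \<subset> {i. s i = s k}"
  proof
    show "{i. s' i = s k} \<subseteq> {i. s i = s k}"
    proof
      fix i assume i: "i \<in> {i. s' i = s k}"
      have "i < k"
      proof (rule ccontr)
        assume "\<not> i < k"
        then have "s' k \<le> s' i" using monoD[OF mono(2)] by simp
        then show False using i lt by simp
      qed
      then show "i \<in> {i. s i = s k}" using eq i by simp
    qed
    have "k \<in> {i. s i = s k}" "k \<notin> {i. s' i = s k}" using lt by auto
    then show "{i. s' i = s k} \<noteq> {i. s i = s k}" by blast
  qed
  then have "card {i. s' i = s k} < card {i. s i = s k}" by (rule psubset_card_mono[OF fin])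
  then show False using has_dim_ae_le[OF dim] by simp
qed

lemma eigenvalue_sequence_unique:
  assumes "eigenvalue_sequence D V s" "eigenvalue_sequence D V s'" shows "s = s'"
proof
  fix k show "s k = s' k"
  proof (induction k rule: less_induct)
    case (less k)
    show ?case
    proof (rule antisym)
      show "s' k \<le> s k" by (rule eigenvalue_sequence_le[OF assms less.IH])
      show "s k \<le> s' k" by (rule eigenvalue_sequence_le[OF assms(2,1) less.IH[symmetric]])
    qed
  qed
qed

text \<open>The members of the eigenbasis with eigenvalue t are independent by orthonormality and
  span the eigenspace by \<open>eigenspace_expansion\<close>. The values found by minimisation
  therefore have the required multiplicities, and uniqueness resolves the description.\<close>

lemma the_eigenvalue_sequence:
  assumes "spectral_pair V (grad_inner D) (L2_inner D)" and V: "V \<subseteq> H1 D"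
  shows "(THE s. eigenvalue_sequence D V s) = spectral_pair.eigval V (grad_inner D) (L2_inner D)"
proof -
  interpret P: spectral_pair V "grad_inner D" "L2_inner D" by fact
  have V2: "u \<in> V \<Longrightarrow> u \<in> L2 D" for u using V H1_L2 by blast
  have E: "eigenspace D V t = {u \<in> V. \<forall>v\<in>V. grad_inner D u v = t * L2_inner D u v}" for t
    by (simp add: eigenspace_def grad_inner_def L2_inner_def)
  have "has_dim_ae D (eigenspace D V t) (card {k. P.eigval k = t})" for t
  proof -
    let ?K = "{k. P.eigval k = t}" and ?m = "card {k. P.eigval k = t}"
    have fin: "finite ?K" by (rule finite_subset[OF _ P.finite_eigval[of t]]) auto
    obtain h where h: "bij_betw h {..<?m} ?K"
      using ex_bij_betw_nat_finite[OF fin] by (auto simp: lessThan_atLeast0)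
    define f where "f i = P.eigenbasis (h i)" for i
    have fV: "f i \<in> V" for i by (simp add: f_def P.eigenbasis_V)
    have inj: "h i = h j \<longleftrightarrow> i = j" if "i < ?m" "j < ?m" for i j
      using h that by (auto simp: bij_betw_def inj_on_def)
    have hK: "P.eigval (h i) = t" if "i < ?m" for i
      using bij_betwE[OF h] that by auto
    show ?thesis
      unfolding has_dim_ae_def
    proof (intro exI[of _ f] conjI allI impI ballI)
      fix i assume i: "i < ?m"
      show "f i \<in> eigenspace D V t"
        unfolding E f_def using P.eigenbasis_V P.eigenbasis_eq hK[OF i] by auto
    next
      fix c :: "nat \<Rightarrow> real" and j
      assume ae: "AE x in lebesgue_on D. (\<Sum>i<?m. c i * f i x) = 0" and j: "j < ?m"
      define w where "w = (\<Sum>i<?m. c i *\<^sub>R f i)"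
      have wV: "w \<in> V" unfolding w_def by (intro P.B.V_sum P.B.V_scale fV)
      have "AE x in lebesgue_on D. w x = 0" using ae by (simp add: w_def sum_fun_apply)
      then have "L2_inner D w w = 0" using L2_inner_self_eq_0_iff[OF V2[OF wV]] by simp
      then have "L2_inner D w (f j) = 0" by (rule P.B.null_left[OF wV fV])
      also have "L2_inner D w (f j) = (\<Sum>i<?m. c i * L2_inner D (f i) (f j))"
        unfolding w_def by (intro P.B.sum_scale_left) (auto simp: fV)
      also have "\<dots> = (\<Sum>i<?m. if i = j then c j else 0)"
        using j by (intro sum.cong) (auto simp: f_def P.eigenbasis_inner inj)
      finally show "c j = 0" using j by simp
    next
      fix u assume "u \<in> eigenspace D V t"
      then have u: "u \<in> V" "\<And>v. v \<in> V \<Longrightarrow> grad_inner D u v = t * L2_inner D u v" by (auto simp: E)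
      define r where "r = u - (\<Sum>k\<in>?K. L2_inner D u (P.eigenbasis k) *\<^sub>R P.eigenbasis k)"
      have r: "r \<in> V" "L2_inner D r r = 0"
        unfolding r_def using P.eigenspace_expansion[OF u] by blast+
      then have "AE x in lebesgue_on D. r x = 0" using L2_inner_self_eq_0_iff[OF V2[OF r(1)]] by simp
      moreover have "r x = u x - (\<Sum>i<?m. L2_inner D u (f i) * f i x)" for x
      proof -
        have "(\<Sum>i<?m. L2_inner D u (f i) * f i x) = (\<Sum>k\<in>?K. L2_inner D u (P.eigenbasis k) * P.eigenbasis k x)"
          unfolding f_def by (rule sum.reindex_bij_betw[OF h])
        then show ?thesis by (simp add: r_def sum_fun_apply)
      qed
      ultimately have "AE x in lebesgue_on D. u x = (\<Sum>i<?m. L2_inner D u (f i) * f i x)" by simp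
      then show "\<exists>c. AE x in lebesgue_on D. u x = (\<Sum>i<?m. c i * f i x)"
        by (rule exI[of _ "\<lambda>i. L2_inner D u (f i)"])
    qed
  qed
  moreover have "finite {k. P.eigval k = t}" for t
    by (rule finite_subset[OF _ P.finite_eigval[of t]]) auto
  ultimately have "eigenvalue_sequence D V P.eigval"
    by (simp add: eigenvalue_sequence_def P.eigval_mono)
  then show ?thesis using eigenvalue_sequence_unique by blast
qed

section \<open>Averaging over an irreducible group\<close>

lemma orthogonal_matrix_mult_transpose:
  fixes U :: "real^'d^'d"
  assumes "orthogonal_matrix U" shows "U ** transpose U = mat 1" "transpose U ** U = mat 1"
  using assms by (auto simp: orthogonal_matrix_def)

lemma matrix_inner_eq_trace:
  fixes A B :: "real^'d^'d" shows "A \<bullet> B = trace (transpose A ** B)"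
proof -
  have "A \<bullet> B = (\<Sum>i\<in>UNIV. \<Sum>j\<in>UNIV. A $ i $ j * B $ i $ j)" by (simp add: inner_vec_def)
  also have "\<dots> = (\<Sum>j\<in>UNIV. \<Sum>i\<in>UNIV. A $ i $ j * B $ i $ j)" by (rule sum.swap)
  finally show ?thesis by (simp add: trace_def matrix_matrix_mult_def transpose_def)
qed

section \<open>Conjugation of matrices and its invariants\<close>

definition conjugate :: "real^'d^'d \<Rightarrow> real^'d^'d \<Rightarrow> real^'d^'d" where
  "conjugate U M = U ** M ** transpose U"

lemma linear_conjugate: "linear (conjugate U)"
  by (rule linearI) (simp_all add: conjugate_def matrix_matrix_mult_def vec_eq_iff sum.distrib
      sum_distrib_left sum_distrib_right algebra_simps)

lemma linear_trace: "linear (trace :: real^'d^'d \<Rightarrow> real)"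
  by (rule linearI) (simp_all add: trace_def sum.distrib sum_distrib_left)

lemma norm_conjugate:
  assumes "orthogonal_matrix U" shows "norm (conjugate U M) = norm M"
proof -
  note U = orthogonal_matrix_mult_transpose[OF assms]
  have "transpose (conjugate U M) ** conjugate U M = U ** (transpose M ** ((transpose U ** U) ** (M ** transpose U)))"
    by (simp add: conjugate_def matrix_transpose_mul matrix_mul_assoc)
  also have "\<dots> = U ** (transpose M ** (M ** transpose U))" by (simp add: U)
  finally have "conjugate U M \<bullet> conjugate U M = trace (U ** (transpose M ** (M ** transpose U)))"
    by (simp add: matrix_inner_eq_trace)
  also have "\<dots> = trace ((transpose M ** (M ** transpose U)) ** U)" by (rule trace_mul_sym)
  also have "(transpose M ** (M ** transpose U)) ** U = transpose M ** (M ** (transpose U ** U))"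
    by (simp add: matrix_mul_assoc)
  finally have "conjugate U M \<bullet> conjugate U M = M \<bullet> M" by (simp add: U matrix_inner_eq_trace)
  then show ?thesis by (simp add: norm_eq_sqrt_inner)
qed

lemma trace_conjugate:
  assumes "orthogonal_matrix U" shows "trace (conjugate U M) = trace M"
proof -
  note U = orthogonal_matrix_mult_transpose[OF assms]
  have "trace (conjugate U M) = trace (transpose U ** (U ** M))"
    unfolding conjugate_def by (rule trace_mul_sym)
  then show ?thesis by (simp add: matrix_mul_assoc U)
qed

text \<open>A symmetric matrix commuting with an irreducible group is scalar: its top eigenvectors, i.e.
  the maximisers of the quadratic form on the unit sphere, span the whole space.\<close>
lemma symmetric_commuting_scalar:
  fixes Q :: "real^'d^'d"
  assumes sym: "transpose Q = Q" and irr: "irreducible_group G"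
    and comm: "\<And>U. U \<in> G \<Longrightarrow> Q ** U = U ** Q"
  shows "\<exists>p. Q = p *\<^sub>R mat 1"
proof -
  have sQ: "(Q *v x) \<bullet> y = (Q *v y) \<bullet> x" for x y
    by (metis dot_lmul_matrix inner_commute sym transpose_matrix_vector)
  have "continuous_on (sphere 0 1) (\<lambda>x. (Q *v x) \<bullet> x)"
    by (intro continuous_intros linear_continuous_on matrix_vector_mul_bounded_linear)
  then have "\<exists>x\<in>sphere 0 1. \<forall>y\<in>sphere 0 1. (Q *v y) \<bullet> y \<le> (Q *v x) \<bullet> x"
    by (intro continuous_attains_sup) auto
  then obtain x where x: "x \<in> sphere 0 1" "\<And>y. y \<in> sphere 0 1 \<Longrightarrow> (Q *v y) \<bullet> y \<le> (Q *v x) \<bullet> x"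
    by blast
  define p where "p = (Q *v x) \<bullet> x"
  have le: "(Q *v y) \<bullet> y \<le> p * (y \<bullet> y)" for y
  proof (cases "y = 0")
    case False
    let ?z = "(1 / norm y) *\<^sub>R y"
    have "?z \<in> sphere 0 1" using False by simp
    then have "(Q *v ?z) \<bullet> ?z \<le> p" unfolding p_def by (rule x(2))
    moreover have "(Q *v ?z) \<bullet> ?z = (Q *v y) \<bullet> y / (norm y)\<^sup>2"
      by (simp add: matrix_vector_mult_scaleR power2_eq_square)
    ultimately have "(Q *v y) \<bullet> y / (norm y)\<^sup>2 \<le> p" by (simp only:)
    then show ?thesis using False by (simp add: pos_divide_le_eq power2_norm_eq_inner)
  qed simp
  \<comment> \<open>The form of p I - Q is nonnegative because p is the maximum, and the maximiser x
    is a null vector, hence an eigenvector.\<close>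
  define q where "q = (\<lambda>y z. p * (y \<bullet> z) - (Q *v y) \<bullet> z)"
  interpret q: semi_inner UNIV q
  proof
    fix y z w :: "real^'d" and c
    show "q y z = q z y" unfolding q_def using sQ[of y z] inner_commute[of y z] by simp
    show "q (y + z) w = q y w + q z w"
      by (simp add: q_def inner_add_left matrix_vector_right_distrib algebra_simps)
    show "q (c *\<^sub>R y) z = c * q y z"
      by (simp add: q_def matrix_vector_mult_scaleR algebra_simps)
    show "0 \<le> q y y" using le[of y] by (simp add: q_def)
  qed simp
  have "x \<bullet> x = 1" using x(1) by (simp add: norm_eq_1)
  then have "q x x = 0" by (simp add: q_def p_def)
  then have qx: "q x z = 0" for z using q.null_left[of x z] by simp
  have Qx: "Q *v x = p *\<^sub>R x"
  proof -
    have "(p *\<^sub>R x - Q *v x) \<bullet> z = 0" for z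
      using qx[of z] by (simp add: q_def inner_diff_left)
    then have "p *\<^sub>R x - Q *v x = 0" by (metis inner_eq_zero_iff)
    then show ?thesis by simp
  qed
  define E where "E = {y. Q *v y = p *\<^sub>R y}"
  have "subspace E"
    unfolding E_def subspace_def
    by (simp add: matrix_vector_right_distrib matrix_vector_mult_scaleR scaleR_add_right)
  moreover have "{U *v x |U. U \<in> G} \<subseteq> E"
  proof
    fix y assume "y \<in> {U *v x |U. U \<in> G}"
    then obtain U where U: "U \<in> G" "y = U *v x" by blast
    have "Q *v y = (Q ** U) *v x" by (simp add: U(2) matrix_vector_mul_assoc)
    also have "\<dots> = U *v (Q *v x)" by (simp add: comm[OF U(1)] matrix_vector_mul_assoc)
    finally show "y \<in> E" by (simp add: E_def Qx U(2) matrix_vector_mult_scaleR)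
  qed
  ultimately have "span {U *v x |U. U \<in> G} \<subseteq> E" by (simp add: span_minimal)
  moreover have "x \<noteq> 0" using x(1) by auto
  ultimately have "E = UNIV" using irr unfolding irreducible_group_def by blast
  then have "Q *v y = (p *\<^sub>R mat 1) *v y" for y
    by (auto simp: E_def scaleR_matrix_vector_assoc[symmetric])
  then have "Q = p *\<^sub>R mat 1" by (simp add: matrix_eq)
  then show ?thesis by blast
qed

text \<open>The element of least norm in the closed convex hull of the orbit of \<open>M\<close> is fixed by the group.
  This replaces an average with respect to Haar measure.\<close>
lemma scalar_in_closed_convex_hull_of_orbit:
  fixes M :: "real^'d^'d"
  assumes orth: "\<And>U. U \<in> G \<Longrightarrow> orthogonal_matrix U"
    and one: "mat 1 \<in> G" and mult: "\<And>U V. U \<in> G \<Longrightarrow> V \<in> G \<Longrightarrow> U ** V \<in> G"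
    and irr: "irreducible_group G" and sym: "transpose M = M"
  shows "(trace M / CARD('d)) *\<^sub>R mat 1 \<in> closure (convex hull ((\<lambda>U. conjugate U M) ` G))"
proof -
  let ?O = "(\<lambda>U. conjugate U M) ` G"
  define C where "C = closure (convex hull ?O)"
  have C: "convex C" "closed C" unfolding C_def by (auto intro: convex_closure)
  have OC: "?O \<subseteq> C" unfolding C_def by (meson closure_subset hull_subset subset_trans)
  have ne: "C \<noteq> {}" using OC one by blast
  have min: "C \<subseteq> S" if "?O \<subseteq> S" "convex S" "closed S" for S
    unfolding C_def using that by (intro closure_minimal hull_minimal) auto
  define Q where "Q = closest_point C 0"
  have Q: "Q \<in> C" "\<And>R. R \<in> C \<Longrightarrow> dist 0 Q \<le> dist 0 R"
    using closest_point_exists[OF C(2) ne, of 0] by (auto simp: Q_def)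
  \<comment> \<open>Conjugation by \<open>U\<close> maps the hull into itself and preserves the
    norm, while the point of least norm in a closed convex set is unique.\<close>
  have inv: "conjugate U Q = Q" if U: "U \<in> G" for U
  proof (rule any_closest_point_unique[OF C _ Q(1), of _ 0])
    have "C \<subseteq> conjugate U -` C"
    proof (rule min)
      show "?O \<subseteq> conjugate U -` C"
      proof
        fix R assume "R \<in> ?O"
        then obtain V where V: "V \<in> G" "R = conjugate V M" by blast
        have "conjugate U R = conjugate (U ** V) M"
          by (simp add: V(2) conjugate_def matrix_transpose_mul matrix_mul_assoc)
        also have "\<dots> \<in> C" using OC mult[OF U V(1)] by blast
        finally show "R \<in> conjugate U -` C" by simp
      qed
      show "convex (conjugate U -` C)" by (rule convex_linear_vimage[OF linear_conjugate C(1)])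
      show "closed (conjugate U -` C)"
        by (intro continuous_closed_vimage[OF C(2)] linear_continuous_at)
          (simp add: linear_conv_bounded_linear[symmetric] linear_conjugate)
    qed
    then show "conjugate U Q \<in> C" using Q(1) by blast
    show "\<forall>R\<in>C. dist 0 (conjugate U Q) \<le> dist 0 R"
      using Q(2) norm_conjugate[OF orth[OF U]] by simp
    show "\<forall>R\<in>C. dist 0 Q \<le> dist 0 R" using Q(2) by blast
  qed
  have comm: "Q ** U = U ** Q" if U: "U \<in> G" for U
  proof -
    have "U ** Q ** (transpose U ** U) = Q ** U"
      using arg_cong[OF inv[OF U], of "\<lambda>R. R ** U"] by (simp add: conjugate_def matrix_mul_assoc)
    then show ?thesis by (simp add: orthogonal_matrix_mult_transpose[OF orth[OF U]])
  qed
  \<comment> \<open>Symmetry and the value of the trace are closed linear or affine conditions, so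
    they pass from the orbit to its closed convex hull. The first makes \<open>Q\<close> scalar, the
    second determines the scalar.\<close>
  have lt: "linear (\<lambda>R::real^'d^'d. transpose R - R)"
    by (rule linearI) (simp_all add: transpose_def vec_eq_iff algebra_simps)
  have "C \<subseteq> (\<lambda>R. transpose R - R) -` {0}"
  proof (rule min)
    show "?O \<subseteq> (\<lambda>R. transpose R - R) -` {0}"
      by (auto simp: conjugate_def matrix_transpose_mul matrix_mul_assoc sym)
    show "convex ((\<lambda>R::real^'d^'d. transpose R - R) -` {0})" by (rule convex_linear_vimage[OF lt]) simp
    show "closed ((\<lambda>R::real^'d^'d. transpose R - R) -` {0})"
      by (intro continuous_closed_vimage linear_continuous_at)
        (simp_all add: linear_conv_bounded_linear[symmetric] lt)
  qed
  then have "transpose Q = Q" using Q(1) by auto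
  from symmetric_commuting_scalar[OF this irr comm] obtain p where p: "Q = p *\<^sub>R mat 1" by blast
  have "C \<subseteq> trace -` {trace M}"
  proof (rule min)
    show "?O \<subseteq> trace -` {trace M}" using trace_conjugate[OF orth] by auto
    show "convex (trace -` {trace M} :: (real^'d^'d) set)" by (rule convex_linear_vimage[OF linear_trace]) simp
    show "closed (trace -` {trace M} :: (real^'d^'d) set)"
      by (intro continuous_closed_vimage linear_continuous_at)
        (simp_all add: linear_conv_bounded_linear[symmetric] linear_trace)
  qed
  then have "trace Q = trace M" using Q(1) by auto
  then have "p * CARD('d) = trace M" by (simp add: p trace_def mat_def mult.commute)
  then have "p = trace M / CARD('d)" by (simp add: field_simps)
  then show ?thesis using Q(1) p by (simp add: C_def)
qed

section \<open>The main inequality\<close>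

lemma linear_trace_conjugate: "linear (\<lambda>R. trace (conjugate A R))"
  using linear_compose[OF linear_conjugate linear_trace] by (simp add: comp_def)

text \<open>Exhibits the transformed energy as a linear function of the matrix of inner products of
  components; this linearity is what lets a bound pass to convex hulls.\<close>

lemma L2_inner_matrix:
  fixes h :: "real^'d \<Rightarrow> real^'d" and A :: "real^'d^'d"
  assumes h: "h \<in> L2 D"
  shows "L2_inner D (\<lambda>x. A *v h x) (\<lambda>x. A *v h x)
    = trace (conjugate A (\<chi> a b. L2_inner D (\<lambda>x. h x $ a) (\<lambda>x. h x $ b)))"
proof -
  have hi: "(\<lambda>x. h x $ a) \<in> L2 D" for a by (rule L2_nth[OF h])
  define f where "f i = (\<lambda>x. \<Sum>a\<in>UNIV. A $ i $ a * h x $ a)" for i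
  have Af: "(\<lambda>x. (A *v h x) $ i) = f i" for i by (simp add: f_def matrix_vector_mult_def)
  have f2: "f i \<in> L2 D" for i
  proof -
    have "f i = (\<Sum>a\<in>UNIV. A $ i $ a *\<^sub>R (\<lambda>x. h x $ a))"
      by (simp add: f_def fun_eq_iff sum_fun_apply)
    then show ?thesis using hi by (simp only:) (intro L2.V_sum L2.V_scale)
  qed
  have AL: "(\<lambda>x. A *v h x) \<in> L2 D" by (rule L2_vecI) (simp only: Af f2)
  have ff: "L2_inner D (f i) v = (\<Sum>a\<in>UNIV. A $ i $ a * L2_inner D (\<lambda>x. h x $ a) v)" if "v \<in> L2 D" for i v
    unfolding f_def using hi that by (intro L2_inner_sum_left) auto
  have "L2_inner D (f i) (f i)
      = (\<Sum>b\<in>UNIV. (\<Sum>a\<in>UNIV. A $ i $ a * L2_inner D (\<lambda>x. h x $ a) (\<lambda>x. h x $ b)) * A $ i $ b)" for i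
    unfolding ff[OF f2] L2.sym[OF hi f2] ff[OF hi] by (simp only: mult.commute)
  then show ?thesis
    unfolding L2_vector_inner_eq_sum[OF AL AL] Af
    by (simp add: trace_def conjugate_def matrix_matrix_mult_def transpose_def)
qed

lemma sum_L2_inner_matrix:
  fixes g :: "nat \<Rightarrow> real^'d \<Rightarrow> real^'d" and A :: "real^'d^'d"
  assumes "\<And>j. g j \<in> L2 D"
  shows "(\<Sum>j<n. L2_inner D (\<lambda>x. A *v g j x) (\<lambda>x. A *v g j x))
    = trace (conjugate A (\<chi> a b. \<Sum>j<n. L2_inner D (\<lambda>x. g j x $ a) (\<lambda>x. g j x $ b)))"
proof -
  have "(\<chi> a b. \<Sum>j<n. L2_inner D (\<lambda>x. g j x $ a) (\<lambda>x. g j x $ b))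
      = (\<Sum>j<n. (\<chi> a b. L2_inner D (\<lambda>x. g j x $ a) (\<lambda>x. g j x $ b)))"
    by (simp add: vec_eq_iff)
  then show ?thesis
    by (simp only: L2_inner_matrix[OF assms] linear_sum[OF linear_trace_conjugate])
qed

lemma HS_norm_sq: "(HS_norm A)\<^sup>2 = A \<bullet> A"
  unfolding HS_norm_def by (simp add: inner_vec_def power2_eq_square sum_nonneg)

lemma HS_norm_scaled_orthogonal:
  fixes U :: "real^'d^'d"
  assumes "orthogonal_matrix U" shows "(HS_norm (c *\<^sub>R U))\<^sup>2 = c\<^sup>2 * CARD('d)"
proof -
  have "U \<bullet> U = CARD('d)"
    by (simp add: matrix_inner_eq_trace orthogonal_matrix_mult_transpose[OF assms] trace_I)
  then show ?thesis
    by (simp only: HS_norm_sq inner_scaleR_left inner_scaleR_right) (simp add: power2_eq_square)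
qed

lemma matrix_inv_unique:
  fixes T S :: "real^'d^'d"
  assumes "T ** S = mat 1" "S ** T = mat 1" shows "matrix_inv T = S"
proof -
  have "invertible T" using assms by (auto simp: invertible_def)
  then have "S ** (T ** matrix_inv T) = S" by (simp add: matrix_inv_mult)
  then show ?thesis by (simp add: matrix_mul_assoc assms)
qed

text \<open>The two properties through which a boundary condition enters the comparison, so that the
  Dirichlet and the Neumann problem are treated together.\<close>

locale boundary_condition =
  fixes F :: "(real^'d) set \<Rightarrow> (real^'d \<Rightarrow> real) set"
  assumes form_domain: "\<And>D. open D \<Longrightarrow> bounded D \<Longrightarrow> form_domain D (F D)"
    and compose: "\<And>D T S c u. linear_change T S D c \<Longrightarrow> u \<in> F D \<Longrightarrow> (\<lambda>y. u (S *v y)) \<in> F ((*v) T ` D)"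
begin

definition eigval :: "(real^'d) set \<Rightarrow> nat \<Rightarrow> real" where
  "eigval D = spectral_pair.eigval (F D) (grad_inner D) (L2_inner D)"

text \<open>Asks for compactness itself instead of regularity of the boundary, because compactness
  is what linear images are shown to inherit.\<close>

definition admissible :: "(real^'d) set \<Rightarrow> bool" where
  "admissible D \<longleftrightarrow> open D \<and> bounded D \<and> D \<noteq> {} \<and> compactly_embedded D (F D)"

lemma F_H1: "open D \<Longrightarrow> bounded D \<Longrightarrow> F D \<subseteq> H1 D"
  using form_domain by (simp add: form_domain_def)

lemma spectral: "admissible D \<Longrightarrow> spectral_pair (F D) (grad_inner D) (L2_inner D)"
  unfolding admissible_def by (intro spectral_pair_form_domain form_domain) auto

lemma the_sequence: "admissible D \<Longrightarrow> (THE s. eigenvalue_sequence D (F D) s) = eigval D"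
  unfolding eigval_def by (intro the_eigenvalue_sequence spectral F_H1) (auto simp: admissible_def)

lemma admissible_image:
  assumes adm: "admissible D" and T: "linear_change T S D c" shows "admissible ((*v) T ` D)"
proof -
  interpret linear_change T S D c by fact
  obtain c' where I: "linear_change S T TD c'" using inverse_change by blast
  have "compactly_embedded TD (F TD)"
  proof (rule compactly_embedded_TD)
    show "compactly_embedded D (F D)" using adm by (simp add: admissible_def)
    show "F TD \<subseteq> H1 TD" by (rule F_H1[OF TD])
    show "(\<lambda>x. u (T *v x)) \<in> F D" if "u \<in> F TD" for u
      using compose[OF I that] unfolding S_TD .
  qed
  then show ?thesis using adm TD by (simp add: admissible_def)
qed

context
  fixes D :: "(real^'d) set" and n :: nat
  assumes D: "admissible D"
begin

definition eiggrad :: "nat \<Rightarrow> real^'d \<Rightarrow> real^'d" where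
  "eiggrad j = weak_grad D (spectral_pair.eigenbasis (F D) (grad_inner D) (L2_inner D) j)"

definition moment :: "real^'d^'d" where
  "moment = (\<chi> a b. \<Sum>j<n. L2_inner D (\<lambda>x. eiggrad j x $ a) (\<lambda>x. eiggrad j x $ b))"

lemma eiggrad_L2: "eiggrad j \<in> L2 D"
proof -
  interpret P: spectral_pair "F D" "grad_inner D" "L2_inner D" by (rule spectral[OF D])
  have "P.eigenbasis j \<in> H1 D" using P.eigenbasis_V F_H1[of D] D by (auto simp: admissible_def)
  then show ?thesis unfolding eiggrad_def by (rule weak_grad_L2)
qed

lemma moment_symmetric: "transpose moment = moment"
  by (simp add: moment_def transpose_def vec_eq_iff L2.sym[OF L2_nth[OF eiggrad_L2] L2_nth[OF eiggrad_L2]])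

lemma trace_moment: "trace moment = (\<Sum>k<n. eigval D k)"
proof -
  interpret P: spectral_pair "F D" "grad_inner D" "L2_inner D" by (rule spectral[OF D])
  have "trace moment = (\<Sum>j<n. L2_inner D (eiggrad j) (eiggrad j))"
    by (simp add: trace_def moment_def L2_vector_inner_eq_sum[OF eiggrad_L2 eiggrad_L2]
        sum.swap[of _ UNIV "{..<n}"])
  then show ?thesis by (simp add: eiggrad_def eigval_def P.eigval_def grad_inner_def)
qed

lemma sum_eigval_image_le:
  assumes T: "linear_change T S D c"
  shows "(\<Sum>k<n. eigval ((*v) T ` D) k) \<le> trace (conjugate (transpose S) moment)"
proof -
  note adm = D
  interpret linear_change T S D c by fact
  have "(\<Sum>k<n. eigval TD k)
      \<le> (\<Sum>j<n. L2_inner D (\<lambda>x. transpose S *v eiggrad j x) (\<lambda>x. transpose S *v eiggrad j x))"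
    unfolding eigval_def eiggrad_def
    by (rule sum_eigval_le[OF spectral[OF adm] F_H1[OF D] spectral[OF admissible_image[OF adm T]]])
      (use compose[OF T] in \<open>simp add: pull_def[abs_def]\<close>)
  also have "\<dots> = trace (conjugate (transpose S) moment)"
    unfolding moment_def by (rule sum_L2_inner_matrix[OF eiggrad_L2])
  finally show ?thesis .
qed

end

lemma sum_eigval_le_HS_norm:
  assumes D: "admissible D" and irr: "irreducible_group (symmetry_group D)" and T: "invertible T"
  shows "(\<Sum>k<n. eigval ((*v) T ` D) k)
    \<le> 1 / real CARD('d) * (HS_norm (matrix_inv T))\<^sup>2 * (\<Sum>k<n. eigval D k)"
proof -
  have DD: "open D" "bounded D" using D by (auto simp: admissible_def)
  define S where "S = matrix_inv T"
  note TS = matrix_inv_mult[OF T, folded S_def]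
  let ?M = "moment D n" and ?G = "symmetry_group D"
  define \<Lambda> where "\<Lambda> = (\<Sum>k<n. eigval ((*v) T ` D) k)"
  \<comment> \<open>A closed half-space, since the trace is linear in \<open>R\<close>: once it
    contains the orbit it contains the closed convex hull.\<close>
  define H where "H = {R. \<Lambda> \<le> trace (conjugate (transpose S) R)}"
  have orth: "orthogonal_matrix U" and UD: "(*v) U ` D = D" if "U \<in> ?G" for U
    using that by (auto simp: symmetry_group_def)
  have one: "mat 1 \<in> ?G" by (simp add: symmetry_group_def orthogonal_matrix_id)
  have mult: "U ** V \<in> ?G" if "U \<in> ?G" "V \<in> ?G" for U V
  proof -
    have "(*v) (U ** V) ` D = (*v) U ` ((*v) V ` D)" by (simp add: image_image matrix_vector_mul_assoc)
    then show ?thesis using that by (simp add: symmetry_group_def orthogonal_matrix_mul)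
  qed
  note lin = linear_trace_conjugate[of "transpose S"]
  have H: "H = (\<lambda>R. trace (conjugate (transpose S) R)) -` {\<Lambda>..}" by (auto simp: H_def)
  have "closure (convex hull ((\<lambda>U. conjugate U ?M) ` ?G)) \<subseteq> H"
  proof (intro closure_minimal hull_minimal)
    show "convex H" unfolding H by (rule convex_linear_vimage[OF lin]) simp
    show "closed H" unfolding H
      by (intro continuous_closed_vimage linear_continuous_at)
        (simp_all add: linear_conv_bounded_linear[symmetric] lin)
    show "(\<lambda>U. conjugate U ?M) ` ?G \<subseteq> H"
    proof
      fix R assume "R \<in> (\<lambda>U. conjugate U ?M) ` ?G"
      then obtain U where U: "U \<in> ?G" "R = conjugate U ?M" by blast
      note UU = orthogonal_matrix_mult_transpose[OF orth[OF U(1)]]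
      have 1: "(T ** U) ** (transpose U ** S) = mat 1"
      proof -
        have "(T ** U) ** (transpose U ** S) = T ** (U ** transpose U) ** S" by (simp add: matrix_mul_assoc)
        then show ?thesis by (simp add: UU TS)
      qed
      have 2: "(transpose U ** S) ** (T ** U) = mat 1"
      proof -
        have "(transpose U ** S) ** (T ** U) = transpose U ** (S ** T) ** U" by (simp add: matrix_mul_assoc)
        then show ?thesis by (simp add: UU TS)
      qed
      have "invertible (T ** U)" using 1 2 by (auto simp: invertible_def)
      then obtain c where "linear_change (T ** U) (matrix_inv (T ** U)) D c"
        using linear_change_exists DD by blast
      then have lc: "linear_change (T ** U) (transpose U ** S) D c"
        by (simp add: matrix_inv_unique[OF 1 2])
      \<comment> \<open>A symmetry does not change the image, so the trial functions for
        \<open>T ** U\<close> bound the very sum \<Lambda>.\<close>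
      have "(*v) (T ** U) ` D = (*v) T ` ((*v) U ` D)" by (simp add: image_image matrix_vector_mul_assoc)
      then have img: "(*v) (T ** U) ` D = (*v) T ` D" by (simp add: UD[OF U(1)])
      have "conjugate (transpose (transpose U ** S)) ?M = conjugate (transpose S) R"
        by (simp add: U(2) conjugate_def matrix_transpose_mul matrix_mul_assoc)
      then show "R \<in> H" using sum_eigval_image_le[OF D lc, of n] by (simp add: H_def \<Lambda>_def img)
    qed
  qed
  then have "(trace ?M / CARD('d)) *\<^sub>R mat 1 \<in> H"
    using scalar_in_closed_convex_hull_of_orbit[OF orth one mult irr moment_symmetric[OF D]] by blast
  then have "\<Lambda> \<le> trace (conjugate (transpose S) ((trace ?M / CARD('d)) *\<^sub>R mat 1))" by (simp add: H_def)
  also have "\<dots> = trace ?M / CARD('d) * trace (conjugate (transpose S) (mat 1))"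
    using linear_scale[OF lin] by simp
  also have "trace (conjugate (transpose S) (mat 1)) = (HS_norm S)\<^sup>2"
    by (simp add: conjugate_def HS_norm_sq matrix_inner_eq_trace)
  finally show ?thesis
    by (simp add: \<Lambda>_def S_def trace_moment[OF D] field_simps)
qed

text \<open>The transposed inverse is U divided by c, and conjugation by \<open>U\<close> preserves
  the trace; the trial function bound can thus be evaluated directly, without averaging.\<close>

lemma sum_eigval_scaled_orthogonal_le:
  assumes D: "admissible D" and U: "orthogonal_matrix U" and c: "c \<noteq> 0"
  shows "(\<Sum>k<n. eigval ((*v) (c *\<^sub>R U) ` D) k) \<le> (1 / c)\<^sup>2 * (\<Sum>k<n. eigval D k)"
proof -
  have DD: "open D" "bounded D" using D by (auto simp: admissible_def)
  let ?T = "c *\<^sub>R U" and ?S = "(1 / c) *\<^sub>R transpose U"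
  note UU = orthogonal_matrix_mult_transpose[OF U]
  have 1: "?T ** ?S = mat 1" "?S ** ?T = mat 1"
    using c UU by (simp_all add: matrix_scalar_ac scalar_matrix_assoc[symmetric])
  then have "invertible ?T" by (auto simp: invertible_def)
  then obtain c' where "linear_change ?T (matrix_inv ?T) D c'"
    using linear_change_exists DD by blast
  then have lc: "linear_change ?T ?S D c'" by (simp add: matrix_inv_unique[OF 1])
  have tS: "transpose ?S = (1 / c) *\<^sub>R U" by (simp add: transpose_def vec_eq_iff)
  have "conjugate (transpose ?S) R = (1 / c)\<^sup>2 *\<^sub>R conjugate U R" for R
    unfolding tS by (simp add: conjugate_def transpose_scalar matrix_scalar_ac scalar_matrix_assoc[symmetric] power2_eq_square)
  then have "trace (conjugate (transpose ?S) (moment D n)) = (1 / c)\<^sup>2 * trace (conjugate U (moment D n))"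
    by (simp add: trace_def sum_distrib_left)
  also have "\<dots> = (1 / c)\<^sup>2 * (\<Sum>k<n. eigval D k)"
    by (simp only: trace_conjugate[OF U] trace_moment[OF D])
  finally show ?thesis using sum_eigval_image_le[OF D lc, of n] by (simp only:)
qed

text \<open>The inverse of \<open>T\<close> is again a multiple of an orthogonal matrix, so the
  preceding inequality can be applied in both directions; the two factors are reciprocal.\<close>

lemma sum_eigval_scaled_orthogonal:
  assumes D: "admissible D" and U: "orthogonal_matrix U" and T: "invertible T" "T = c *\<^sub>R U"
  shows "(\<Sum>k<n. eigval ((*v) T ` D) k)
    = 1 / real CARD('d) * (HS_norm (matrix_inv T))\<^sup>2 * (\<Sum>k<n. eigval D k)"
proof -
  have DD: "open D" "bounded D" using D by (auto simp: admissible_def)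
  note UU = orthogonal_matrix_mult_transpose[OF U]
  \<comment> \<open>Invertibility excludes the zero matrix, for which the identity matrix would be
    zero.\<close>
  have c: "c \<noteq> 0"
  proof
    assume "c = 0"
    then have "T ** matrix_inv T = 0" by (simp add: T(2) matrix_matrix_mult_def vec_eq_iff)
    then have "(mat 1 :: real^'d^'d) = 0" using matrix_inv_mult[OF T(1)] by simp
    then have "trace (mat 1 :: real^'d^'d) = 0" by (simp add: trace_def)
    then show False by (simp add: trace_I)
  qed
  let ?S = "(1 / c) *\<^sub>R transpose U"
  have 1: "T ** ?S = mat 1" "?S ** T = mat 1"
    using c UU by (simp_all add: T(2) matrix_scalar_ac scalar_matrix_assoc[symmetric])
  have inv: "matrix_inv T = ?S" by (rule matrix_inv_unique[OF 1])
  have oU: "orthogonal_matrix (transpose U)" using U by simp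
  obtain c' where lc: "linear_change T ?S D c'"
    using linear_change_exists[OF T(1) DD] unfolding inv by blast
  have adm: "admissible ((*v) T ` D)" by (rule admissible_image[OF D lc])
  have img: "(*v) ?S ` ((*v) T ` D) = D"
    by (simp add: image_image matrix_vector_mul_assoc 1)
  have "(\<Sum>k<n. eigval D k) \<le> c\<^sup>2 * (\<Sum>k<n. eigval ((*v) T ` D) k)"
    using sum_eigval_scaled_orthogonal_le[OF adm oU, of "1 / c" n] c unfolding img by simp
  then have "(1 / c)\<^sup>2 * (\<Sum>k<n. eigval D k) \<le> (1 / c)\<^sup>2 * (c\<^sup>2 * (\<Sum>k<n. eigval ((*v) T ` D) k))"
    by (intro mult_left_mono) auto
  also have "\<dots> = (\<Sum>k<n. eigval ((*v) T ` D) k)" using c by (simp add: power_divide)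
  finally have "(\<Sum>k<n. eigval ((*v) T ` D) k) = (1 / c)\<^sup>2 * (\<Sum>k<n. eigval D k)"
    using sum_eigval_scaled_orthogonal_le[OF D U c, of n] T(2) by simp
  also have "(1 / c)\<^sup>2 = 1 / real CARD('d) * (HS_norm (matrix_inv T))\<^sup>2"
    unfolding inv HS_norm_scaled_orthogonal[OF oU] by simp
  finally show ?thesis .
qed

text \<open>Phrased with the definite descriptions, so that both boundary conditions match the
  unfolded definitions of the eigenvalues.\<close>

lemma main:
  assumes D: "admissible D" and irr: "irreducible_group (symmetry_group D)" and T: "invertible T"
  shows "(\<Sum>k=1..n. (THE s. eigenvalue_sequence ((*v) T ` D) (F ((*v) T ` D)) s) (k - 1))
      \<le> 1 / real CARD('d) * (HS_norm (matrix_inv T))\<^sup>2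
        * (\<Sum>k=1..n. (THE s. eigenvalue_sequence D (F D) s) (k - 1)) \<and>
    ((\<exists>c U. orthogonal_matrix U \<and> T = c *\<^sub>R U) \<longrightarrow>
      (\<Sum>k=1..n. (THE s. eigenvalue_sequence ((*v) T ` D) (F ((*v) T ` D)) s) (k - 1))
      = 1 / real CARD('d) * (HS_norm (matrix_inv T))\<^sup>2
        * (\<Sum>k=1..n. (THE s. eigenvalue_sequence D (F D) s) (k - 1)))"
proof -
  have "open D" "bounded D" using D by (auto simp: admissible_def)
  then obtain c where "linear_change T (matrix_inv T) D c" using linear_change_exists[OF T] by blast
  then have adm: "admissible ((*v) T ` D)" by (rule admissible_image[OF D])
  \<comment> \<open>Eigenvalues are counted from 1, the sequences from 0.\<close>
  have shift: "(\<Sum>k=1..n. f (k - 1)) = (\<Sum>k<n. f k)" for f :: "nat \<Rightarrow> real"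
    by (rule sum.reindex_bij_witness[of _ Suc "\<lambda>k. k - 1"]) auto
  show ?thesis
    unfolding the_sequence[OF D] the_sequence[OF adm] shift
    using sum_eigval_le_HS_norm[OF D irr T] sum_eigval_scaled_orthogonal[OF D _ T] by blast
qed

end

interpretation dirichlet: boundary_condition H1_0
proof
  show "form_domain D (H1_0 D)" if "open D" "bounded D" for D :: "(real^'d) set"
    using that by (rule form_domain_H1_0)
  show "(\<lambda>y. u (S *v y)) \<in> H1_0 ((*v) T ` D)" if "linear_change T S D c" "u \<in> H1_0 D"
    for D :: "(real^'d) set" and T S c u
  proof -
    have "linear_change.pull S u = (\<lambda>y. u (S *v y))"
      by (rule ext) (rule linear_change.pull_def[OF that(1)])
    then show ?thesis using linear_change.pull_H1_0[OF that] by (simp only:)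
  qed
qed

interpretation neumann: boundary_condition H1
proof
  show "form_domain D (H1 D)" if "open D" "bounded D" for D :: "(real^'d) set"
    using that by (rule form_domain_H1)
  show "(\<lambda>y. u (S *v y)) \<in> H1 ((*v) T ` D)" if "linear_change T S D c" "u \<in> H1 D"
    for D :: "(real^'d) set" and T S c u
  proof -
    have "linear_change.pull S u = (\<lambda>y. u (S *v y))"
      by (rule ext) (rule linear_change.pull_def[OF that(1)])
    then show ?thesis using linear_change.pull_H1[OF that] by (simp only:)
  qed
qed

theorem theorem3p1:
  fixes D :: "(real^'d) set"
  assumes "CARD('d) \<ge> 2"
    and "bounded_domain D"
    and "irreducible_group (symmetry_group D)"
  shows "(\<forall>n\<ge>1. \<forall>T::real^'d^'d. invertible T \<longrightarrow>
           (\<Sum>k=1..n. dirichlet_eigenvalue ((*v) T ` D) k)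
             \<le> 1 / real CARD('d) * (HS_norm (matrix_inv T))\<^sup>2
                 * (\<Sum>k=1..n. dirichlet_eigenvalue D k) \<and>
           ((\<exists>c U. orthogonal_matrix U \<and> T = c *\<^sub>R U) \<longrightarrow>
             (\<Sum>k=1..n. dirichlet_eigenvalue ((*v) T ` D) k)
               = 1 / real CARD('d) * (HS_norm (matrix_inv T))\<^sup>2
                   * (\<Sum>k=1..n. dirichlet_eigenvalue D k))) \<and>
         (lipschitz_boundary D \<longrightarrow> (\<forall>n\<ge>1. \<forall>T::real^'d^'d. invertible T \<longrightarrow>
           (\<Sum>k=1..n. neumann_eigenvalue ((*v) T ` D) k)
             \<le> 1 / real CARD('d) * (HS_norm (matrix_inv T))\<^sup>2
                 * (\<Sum>k=1..n. neumann_eigenvalue D k) \<and>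
           ((\<exists>c U. orthogonal_matrix U \<and> T = c *\<^sub>R U) \<longrightarrow>
             (\<Sum>k=1..n. neumann_eigenvalue ((*v) T ` D) k)
               = 1 / real CARD('d) * (HS_norm (matrix_inv T))\<^sup>2
                   * (\<Sum>k=1..n. neumann_eigenvalue D k))))"
proof -
  have D: "open D" "bounded D" "D \<noteq> {}" using assms(2) by (auto simp: bounded_domain_def)
  have dir: "dirichlet.admissible D"
    using D compactly_embedded_H1_0[OF D(1,2)] by (simp add: dirichlet.admissible_def)
  have neu: "neumann.admissible D" if "lipschitz_boundary D"
    using D compactly_embedded_H1[OF D(1,2) that] by (simp add: neumann.admissible_def)
  show ?thesis
    unfolding dirichlet_eigenvalue_def neumann_eigenvalue_def
    using dirichlet.main[OF dir assms(3)] neumann.main[OF neu assms(3)] by blast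
qed

end
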